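(* Let $M_0$ be a Riemannian manifold with a Lie structure $(M,\mathcal V,g)$ at infinity. Then $M_0$ is complete in the induced metric $g$.
   Context: Manifolds may have corners: they are locally modelled on $[0,\infty)^k\times\mathbb R^{n-k}$, and each hyperface (codimension one boundary face) $H$ is assumed embedded with a smooth defining function $x_H\ge 0$, $H=\{x_H=0\}$, $dx_H\ne 0$ on $H$. $\partial M$ is the union of all hyperfaces and $M\smallsetminus\partial M$ is the interior. A smooth manifold has no corners. A structural Lie algebra of vector fields on $M$ is a real subspace $\mathcal V\subset\Gamma(TM)$ that (i) is closed under Lie brackets, (ii) is closed under multiplication by $C^\infty(M)$ and is a finitely generated projective $C^\infty(M)$-module, (iii) consists of vector fields tangent to all faces of $M$. By the Serre–Swan theorem there is a vector bundle $A=A_{\mathcal V}\to M$ with $\mathcal V\cong\Gamma(A)$ as $C^\infty(M)$-modules, and a bundle map $\varrho:A\to TM$ (the anchor) inducing on sections the inclusion $\mathcal V\subset\Gamma(TM)$. A Lie structure at infinity on a smooth manifold $M_0$ is a pair $(M,\mathcal V)$ where $M$ is a compact manifold, possibly with corners, with interior $M_0$, $\mathcal V$ is a structural Lie algebra of vector fields on $M$, and $\varrho|_{M_0}:A|_{M_0}\to TM_0$ is a fiberwise isomorphism. With a Riemannian metric $g$ on $A$ (a smooth positive definite symmetric 2-tensor on $A$ over all of $M$), which via $\varrho$ induces a Riemannian metric $g$ on $M_0$, one calls $M_0$ a Riemannian manifold with a Lie structure $(M,\mathcal V,g)$ at infinity. *)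

theory Defs
  imports "HOL-Analysis.Analysis"
begin

section \<open>Smooth functions on subsets of a Euclidean space\<close>

primrec Ck_on :: "nat \<Rightarrow> ('a::real_normed_vector \<Rightarrow> 'b::real_normed_vector) \<Rightarrow> 'a set \<Rightarrow> bool" where
  "Ck_on 0 f U \<longleftrightarrow> continuous_on U f"
| "Ck_on (Suc k) f U \<longleftrightarrow>
     f differentiable_on U \<and> (\<forall>v. Ck_on k (\<lambda>x. frechet_derivative f (at x) v) U)"

text \<open>\<^term>\<open>Ck_on\<close> is only meant for open sets. On an arbitrary subset of Euclidean space (in
  particular on a relatively open subset of a quadrant) smoothness means local
  extendability to a smooth function on an open set.\<close>

definition smooth_on_set :: "('a::real_normed_vector \<Rightarrow> 'b::real_normed_vector) \<Rightarrow> 'a set \<Rightarrow> bool" where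
  "smooth_on_set f S \<longleftrightarrow>
     (\<forall>x\<in>S. \<exists>W F. open W \<and> x \<in> W \<and> (\<forall>k. Ck_on k F W) \<and> (\<forall>y\<in>W \<inter> S. F y = f y))"

section \<open>Manifolds with corners\<close>

text \<open>The manifold \<open>M\<close> is the whole type \<open>'m\<close>. Euclidean space of dimension \<open>n\<close> is realised as
  \<^term>\<open>span N\<close> for a set \<open>N\<close> of \<open>n\<close> basis vectors of a type \<open>'e\<close>; taking \<open>N = Basis\<close>
  gives \<open>'e\<close> itself, and \<open>N = {}\<close> covers dimension \<open>0\<close>, which no Euclidean type has.
  A chart carries the set of those coordinate directions that are constrained to be nonnegative;
  the number of these directions may differ from chart to chart.\<close>

definition quadrant :: "'e::euclidean_space set \<Rightarrow> 'e set \<Rightarrow> 'e set" where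
  "quadrant N K = {x \<in> span N. \<forall>b\<in>K. 0 \<le> x \<bullet> b}"

record ('m, 'e) corner_chart =
  chart_dom :: "'m set"
  chart_map :: "'m \<Rightarrow> 'e"
  chart_corner :: "'e set"

definition chart_inv :: "('m, 'e) corner_chart \<Rightarrow> 'e \<Rightarrow> 'm" where
  "chart_inv c = inv_into (chart_dom c) (chart_map c)"

definition is_corner_chart ::
  "'e::euclidean_space set \<Rightarrow> ('m::topological_space, 'e) corner_chart \<Rightarrow> bool" where
  "is_corner_chart N c \<longleftrightarrow>
     open (chart_dom c) \<and>
     chart_corner c \<subseteq> N \<and>
     openin (top_of_set (quadrant N (chart_corner c))) (chart_map c ` chart_dom c) \<and>
     homeomorphism (chart_dom c) (chart_map c ` chart_dom c) (chart_map c) (chart_inv c)"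

definition smooth_atlas ::
  "'e::euclidean_space set \<Rightarrow> ('m::topological_space, 'e) corner_chart set \<Rightarrow> bool" where
  "smooth_atlas N At \<longleftrightarrow>
     N \<subseteq> Basis \<and>
     (\<forall>c\<in>At. is_corner_chart N c) \<and>
     (\<Union>c\<in>At. chart_dom c) = UNIV \<and>
     (\<forall>c\<in>At. \<forall>d\<in>At. smooth_on_set (chart_map d \<circ> chart_inv c)
                         (chart_map c ` (chart_dom c \<inter> chart_dom d)))"

definition smooth_fun_on ::
  "('m, 'e::euclidean_space) corner_chart set \<Rightarrow> 'm set \<Rightarrow> ('m \<Rightarrow> real) \<Rightarrow> bool" where
  "smooth_fun_on At W f \<longleftrightarrow>
     (\<forall>c\<in>At. smooth_on_set (f \<circ> chart_inv c) (chart_map c ` (chart_dom c \<inter> W)))"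

definition smooth_funs :: "('m, 'e::euclidean_space) corner_chart set \<Rightarrow> ('m \<Rightarrow> real) set" where
  "smooth_funs At = {f. smooth_fun_on At UNIV f}"

text \<open>Tangent vectors at \<open>p\<close> are the derivations at \<open>p\<close> of the algebra of smooth functions. At
  boundary points this is the full \<open>n\<close>-dimensional tangent space, not only the
  inward-pointing vectors. To make functionals unique, they vanish off \<^term>\<open>smooth_funs At\<close>.\<close>

definition tangent_space ::
  "('m, 'e::euclidean_space) corner_chart set \<Rightarrow> 'm \<Rightarrow> (('m \<Rightarrow> real) \<Rightarrow> real) set" where
  "tangent_space At p =
     {v. (\<forall>f. f \<notin> smooth_funs At \<longrightarrow> v f = 0) \<and>
         (\<forall>f\<in>smooth_funs At. \<forall>h\<in>smooth_funs At. \<forall>a b.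
            v (\<lambda>q. a * f q + b * h q) = a * v f + b * v h) \<and>
         (\<forall>f\<in>smooth_funs At. \<forall>h\<in>smooth_funs At.
            v (\<lambda>q. f q * h q) = f p * v h + h p * v f)}"

text \<open>The points of codimension \<open>k\<close>: exactly \<open>k\<close> of the constrained coordinates vanish.\<close>

definition depth_stratum ::
  "('m, 'e::euclidean_space) corner_chart set \<Rightarrow> nat \<Rightarrow> 'm set" where
  "depth_stratum At k =
     {p. \<exists>c\<in>At. p \<in> chart_dom c \<and> card {b \<in> chart_corner c. chart_map c p \<bullet> b = 0} = k}"

definition faces_of_codim ::
  "('m::topological_space, 'e::euclidean_space) corner_chart set \<Rightarrow> nat \<Rightarrow> 'm set set" where
  "faces_of_codim At k = closure ` components (depth_stratum At k)"

abbreviation hyperfaces ::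
  "('m::topological_space, 'e::euclidean_space) corner_chart set \<Rightarrow> 'm set set" where
  "hyperfaces At \<equiv> faces_of_codim At 1"

definition defining_function ::
  "('m, 'e::euclidean_space) corner_chart set \<Rightarrow> 'm set \<Rightarrow> ('m \<Rightarrow> real) \<Rightarrow> bool" where
  "defining_function At H x \<longleftrightarrow>
     x \<in> smooth_funs At \<and> (\<forall>p. 0 \<le> x p) \<and> H = {p. x p = 0} \<and>
     (\<forall>p\<in>H. \<exists>v\<in>tangent_space At p. v x \<noteq> 0)"

text \<open>The existence of defining functions includes embeddedness of the hyperfaces: if
  a hyperface met itself in a corner, every nonnegative smooth function vanishing on it would
  have zero differential there.\<close>

definition manifold_with_corners ::
  "'e::euclidean_space set \<Rightarrow>
   ('m::{t2_space, second_countable_topology}, 'e) corner_chart set \<Rightarrow> bool" where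
  "manifold_with_corners N At \<longleftrightarrow>
     smooth_atlas N At \<and> (\<forall>H\<in>hyperfaces At. \<exists>x. defining_function At H x)"

definition mfd_boundary ::
  "('m::topological_space, 'e::euclidean_space) corner_chart set \<Rightarrow> 'm set" where
  "mfd_boundary At = \<Union> (hyperfaces At)"

definition mfd_interior ::
  "('m::topological_space, 'e::euclidean_space) corner_chart set \<Rightarrow> 'm set" where
  "mfd_interior At = - mfd_boundary At"

section \<open>Structural Lie algebras of vector fields\<close>

type_synonym 'm vfield = "'m \<Rightarrow> ('m \<Rightarrow> real) \<Rightarrow> real"

definition vector_fields :: "('m, 'e::euclidean_space) corner_chart set \<Rightarrow> 'm vfield set" where
  "vector_fields At =
     {X. (\<forall>p. X p \<in> tangent_space At p) \<and>
         (\<forall>f\<in>smooth_funs At. (\<lambda>p. X p f) \<in> smooth_funs At)}"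

definition vf_zero :: "'m vfield" where
  "vf_zero = (\<lambda>p f. 0)"

definition vf_add :: "'m vfield \<Rightarrow> 'm vfield \<Rightarrow> 'm vfield" where
  "vf_add X Y = (\<lambda>p f. X p f + Y p f)"

definition vf_scale :: "('m \<Rightarrow> real) \<Rightarrow> 'm vfield \<Rightarrow> 'm vfield" where
  "vf_scale h X = (\<lambda>p f. h p * X p f)"

definition lie_bracket :: "'m vfield \<Rightarrow> 'm vfield \<Rightarrow> 'm vfield" where
  "lie_bracket X Y = (\<lambda>p f. X p (\<lambda>q. Y q f) - Y p (\<lambda>q. X q f))"

text \<open>\<open>X\<close> is tangent to \<open>F\<close> if at the points of \<open>F\<close> it annihilates the ideal of \<open>F\<close>.\<close>

definition tangent_to ::
  "('m, 'e::euclidean_space) corner_chart set \<Rightarrow> 'm vfield \<Rightarrow> 'm set \<Rightarrow> bool" where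
  "tangent_to At X F \<longleftrightarrow>
     (\<forall>p\<in>F. \<forall>f\<in>smooth_funs At. (\<forall>q\<in>F. f q = 0) \<longrightarrow> X p f = 0)"

definition free_module ::
  "('m, 'e::euclidean_space) corner_chart set \<Rightarrow> nat \<Rightarrow> (nat \<Rightarrow> 'm \<Rightarrow> real) set" where
  "free_module At m = {c. (\<forall>i<m. c i \<in> smooth_funs At) \<and> (\<forall>i\<ge>m. c i = (\<lambda>p. 0))}"

text \<open>Finitely generated projective: a direct summand, via a linear inclusion \<open>\<iota>\<close> and a
  linear projection \<open>\<pi>\<close>, of a free module of finite rank over the ring of smooth functions.\<close>

definition fg_projective ::
  "('m, 'e::euclidean_space) corner_chart set \<Rightarrow> 'm vfield set \<Rightarrow> bool" where
  "fg_projective At \<V> \<longleftrightarrow>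
     (\<exists>m \<iota> \<pi>.
        (\<forall>X\<in>\<V>. \<iota> X \<in> free_module At m) \<and>
        (\<forall>X\<in>\<V>. \<forall>Y\<in>\<V>. \<iota> (vf_add X Y) = (\<lambda>i p. \<iota> X i p + \<iota> Y i p)) \<and>
        (\<forall>f\<in>smooth_funs At. \<forall>X\<in>\<V>. \<iota> (vf_scale f X) = (\<lambda>i p. f p * \<iota> X i p)) \<and>
        (\<forall>c\<in>free_module At m. \<pi> c \<in> \<V>) \<and>
        (\<forall>c\<in>free_module At m. \<forall>d\<in>free_module At m.
           \<pi> (\<lambda>i p. c i p + d i p) = vf_add (\<pi> c) (\<pi> d)) \<and>
        (\<forall>f\<in>smooth_funs At. \<forall>c\<in>free_module At m.
           \<pi> (\<lambda>i p. f p * c i p) = vf_scale f (\<pi> c)) \<and>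
        (\<forall>X\<in>\<V>. \<pi> (\<iota> X) = X))"

definition structural_lie_algebra ::
  "('m::topological_space, 'e::euclidean_space) corner_chart set \<Rightarrow> 'm vfield set \<Rightarrow> bool" where
  "structural_lie_algebra At \<V> \<longleftrightarrow>
     \<V> \<subseteq> vector_fields At \<and>
     vf_zero \<in> \<V> \<and>
     (\<forall>X\<in>\<V>. \<forall>Y\<in>\<V>. vf_add X Y \<in> \<V>) \<and>
     (\<forall>a. \<forall>X\<in>\<V>. vf_scale (\<lambda>p. a) X \<in> \<V>) \<and>
     (\<forall>X\<in>\<V>. \<forall>Y\<in>\<V>. lie_bracket X Y \<in> \<V>) \<and>
     (\<forall>f\<in>smooth_funs At. \<forall>X\<in>\<V>. vf_scale f X \<in> \<V>) \<and>
     fg_projective At \<V> \<and>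
     (\<forall>X\<in>\<V>. \<forall>k. \<forall>F\<in>faces_of_codim At k. tangent_to At X F)"

section \<open>Vector bundles, the anchor, and metrics\<close>

text \<open>A vector bundle over \<open>M\<close> is a family of vector spaces, given as subspaces of a common real
  vector space, with a collection of local frames covering \<open>M\<close> whose changes of frame
  are smooth. The rank \<open>r\<close> is only locally constant.\<close>

record ('m, 'v) local_frame =
  frame_dom :: "'m set"
  frame_rank :: nat
  frame_vec :: "nat \<Rightarrow> 'm \<Rightarrow> 'v"

record ('m, 'v) vbundle =
  fibre :: "'m \<Rightarrow> 'v set"
  frames :: "('m, 'v) local_frame set"

definition smooth_in_frame ::
  "('m, 'e::euclidean_space) corner_chart set \<Rightarrow> ('m, 'v::real_vector) local_frame \<Rightarrow>
   'm set \<Rightarrow> ('m \<Rightarrow> 'v) \<Rightarrow> bool" where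
  "smooth_in_frame At e W s \<longleftrightarrow>
     (\<exists>a. (\<forall>i<frame_rank e. smooth_fun_on At (frame_dom e \<inter> W) (a i)) \<and>
          (\<forall>p\<in>frame_dom e \<inter> W. s p = (\<Sum>i<frame_rank e. a i p *\<^sub>R frame_vec e i p)))"

definition is_local_frame ::
  "('m::topological_space \<Rightarrow> 'v::real_vector set) \<Rightarrow> ('m, 'v) local_frame \<Rightarrow> bool" where
  "is_local_frame F e \<longleftrightarrow>
     open (frame_dom e) \<and>
     (\<forall>p\<in>frame_dom e.
        inj_on (\<lambda>i. frame_vec e i p) {..<frame_rank e} \<and>
        independent ((\<lambda>i. frame_vec e i p) ` {..<frame_rank e}) \<and>
        span ((\<lambda>i. frame_vec e i p) ` {..<frame_rank e}) = F p)"

definition vector_bundle ::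
  "('m::topological_space, 'e::euclidean_space) corner_chart set \<Rightarrow>
   ('m, 'v::real_vector) vbundle \<Rightarrow> bool" where
  "vector_bundle At A \<longleftrightarrow>
     (\<forall>p. subspace (fibre A p)) \<and>
     (\<forall>e\<in>frames A. is_local_frame (fibre A) e) \<and>
     (\<Union>e\<in>frames A. frame_dom e) = UNIV \<and>
     (\<forall>e\<in>frames A. \<forall>e'\<in>frames A. \<forall>j<frame_rank e'.
        smooth_in_frame At e (frame_dom e') (frame_vec e' j))"

definition bundle_sections ::
  "('m, 'e::euclidean_space) corner_chart set \<Rightarrow> ('m, 'v::real_vector) vbundle \<Rightarrow>
   ('m \<Rightarrow> 'v) set" where
  "bundle_sections At A =
     {s. (\<forall>p. s p \<in> fibre A p) \<and> (\<forall>e\<in>frames A. smooth_in_frame At e UNIV s)}"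

text \<open>The pair \<open>(A, \<rho>)\<close> realises \<open>\<V>\<close>: composition with the fibrewise linear map \<open>\<rho>\<close> is an
  isomorphism from the sections of \<open>A\<close> onto \<open>\<V>\<close>. It is automatically linear over the smooth
  functions, and \<open>\<rho>\<close> is a smooth bundle map because it maps smooth sections to smooth
  vector fields.\<close>

definition anchored_bundle ::
  "('m::topological_space, 'e::euclidean_space) corner_chart set \<Rightarrow> 'm vfield set \<Rightarrow>
   ('m, 'v::real_vector) vbundle \<Rightarrow> ('m \<Rightarrow> 'v \<Rightarrow> ('m \<Rightarrow> real) \<Rightarrow> real) \<Rightarrow> bool" where
  "anchored_bundle At \<V> A \<rho> \<longleftrightarrow>
     vector_bundle At A \<and>
     (\<forall>p. \<forall>v\<in>fibre A p. \<rho> p v \<in> tangent_space At p) \<and>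
     (\<forall>p. \<forall>v\<in>fibre A p. \<forall>w\<in>fibre A p. \<forall>a b f.
        \<rho> p (a *\<^sub>R v + b *\<^sub>R w) f = a * \<rho> p v f + b * \<rho> p w f) \<and>
     bij_betw (\<lambda>s p. \<rho> p (s p)) (bundle_sections At A) \<V>"

definition lie_structure_at_infinity ::
  "'e::euclidean_space set \<Rightarrow>
   ('m::{t2_space, second_countable_topology}, 'e) corner_chart set \<Rightarrow> 'm vfield set \<Rightarrow>
   ('m, 'v::real_vector) vbundle \<Rightarrow> ('m \<Rightarrow> 'v \<Rightarrow> ('m \<Rightarrow> real) \<Rightarrow> real) \<Rightarrow> bool" where
  "lie_structure_at_infinity N At \<V> A \<rho> \<longleftrightarrow>
     manifold_with_corners N At \<and>
     compact (UNIV :: 'm set) \<and>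
     structural_lie_algebra At \<V> \<and>
     anchored_bundle At \<V> A \<rho> \<and>
     (\<forall>p\<in>mfd_interior At. bij_betw (\<rho> p) (fibre A p) (tangent_space At p))"

definition bundle_metric ::
  "('m, 'e::euclidean_space) corner_chart set \<Rightarrow> ('m, 'v::real_vector) vbundle \<Rightarrow>
   ('m \<Rightarrow> 'v \<Rightarrow> 'v \<Rightarrow> real) \<Rightarrow> bool" where
  "bundle_metric At A g \<longleftrightarrow>
     (\<forall>p. \<forall>u\<in>fibre A p. \<forall>v\<in>fibre A p. \<forall>w\<in>fibre A p. \<forall>a b.
        g p (a *\<^sub>R u + b *\<^sub>R v) w = a * g p u w + b * g p v w) \<and>
     (\<forall>p. \<forall>v\<in>fibre A p. \<forall>w\<in>fibre A p. g p v w = g p w v) \<and>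
     (\<forall>p. \<forall>v\<in>fibre A p. v \<noteq> 0 \<longrightarrow> 0 < g p v v) \<and>
     (\<forall>e\<in>frames A. \<forall>i<frame_rank e. \<forall>j<frame_rank e.
        smooth_fun_on At (frame_dom e) (\<lambda>p. g p (frame_vec e i p) (frame_vec e j p)))"

section \<open>The induced Riemannian distance on the interior\<close>

text \<open>For \<open>p\<close> in the interior, \<^term>\<open>tangent_space At p\<close> is also the tangent space of \<open>M\<^sub>0\<close> at
  \<open>p\<close>, since derivations are local.\<close>

definition induced_metric ::
  "('m, 'v) vbundle \<Rightarrow> ('m \<Rightarrow> 'v \<Rightarrow> ('m \<Rightarrow> real) \<Rightarrow> real) \<Rightarrow> ('m \<Rightarrow> 'v \<Rightarrow> 'v \<Rightarrow> real) \<Rightarrow>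
   'm \<Rightarrow> (('m \<Rightarrow> real) \<Rightarrow> real) \<Rightarrow> (('m \<Rightarrow> real) \<Rightarrow> real) \<Rightarrow> real" where
  "induced_metric A \<rho> g p v w =
     g p (inv_into (fibre A p) (\<rho> p) v) (inv_into (fibre A p) (\<rho> p) w)"

definition velocity ::
  "('m, 'e::euclidean_space) corner_chart set \<Rightarrow> (real \<Rightarrow> 'm) \<Rightarrow> real \<Rightarrow> ('m \<Rightarrow> real) \<Rightarrow> real" where
  "velocity At \<gamma> t =
     (\<lambda>f. if f \<in> smooth_funs At then vector_derivative (f \<circ> \<gamma>) (at t) else 0)"

text \<open>One-sided derivatives are used at the end points of each piece, so a piecewise \<open>C\<^sup>1\<close> curve
  has one-sided velocities at its break points.\<close>

definition C1_arc ::
  "('m, 'e::euclidean_space) corner_chart set \<Rightarrow> (real \<Rightarrow> 'm) \<Rightarrow> real \<Rightarrow> real \<Rightarrow> bool" where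
  "C1_arc At \<gamma> a b \<longleftrightarrow>
     (\<forall>f\<in>smooth_funs At.
        (f \<circ> \<gamma>) differentiable_on {a..b} \<and>
        continuous_on {a..b} (\<lambda>t. vector_derivative (f \<circ> \<gamma>) (at t within {a..b})))"

definition piecewise_C1_curve ::
  "('m::topological_space, 'e::euclidean_space) corner_chart set \<Rightarrow> (real \<Rightarrow> 'm) \<Rightarrow> bool" where
  "piecewise_C1_curve At \<gamma> \<longleftrightarrow>
     continuous_on {0..1} \<gamma> \<and>
     (\<exists>m \<tau>. \<tau> 0 = 0 \<and> \<tau> m = 1 \<and>
            (\<forall>i<m. \<tau> i < \<tau> (Suc i) \<and> C1_arc At \<gamma> (\<tau> i) (\<tau> (Suc i))))"

text \<open>The value of the integrand at the finitely many break points and end points is irrelevant.\<close>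

definition curve_length ::
  "('m, 'e::euclidean_space) corner_chart set \<Rightarrow> ('m, 'v) vbundle \<Rightarrow>
   ('m \<Rightarrow> 'v \<Rightarrow> ('m \<Rightarrow> real) \<Rightarrow> real) \<Rightarrow> ('m \<Rightarrow> 'v \<Rightarrow> 'v \<Rightarrow> real) \<Rightarrow> (real \<Rightarrow> 'm) \<Rightarrow> real" where
  "curve_length At A \<rho> g \<gamma> =
     integral {0..1}
       (\<lambda>t. sqrt (induced_metric A \<rho> g (\<gamma> t) (velocity At \<gamma> t) (velocity At \<gamma> t)))"

text \<open>The distance is \<open>\<infinity>\<close> between different components of the interior.\<close>

definition riemannian_dist ::
  "('m::topological_space, 'e::euclidean_space) corner_chart set \<Rightarrow> ('m, 'v) vbundle \<Rightarrow>
   ('m \<Rightarrow> 'v \<Rightarrow> ('m \<Rightarrow> real) \<Rightarrow> real) \<Rightarrow> ('m \<Rightarrow> 'v \<Rightarrow> 'v \<Rightarrow> real) \<Rightarrow> 'm \<Rightarrow> 'm \<Rightarrow> ereal" where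
  "riemannian_dist At A \<rho> g p q =
     Inf {ereal (curve_length At A \<rho> g \<gamma>) | \<gamma>.
            piecewise_C1_curve At \<gamma> \<and> \<gamma> ` {0..1} \<subseteq> mfd_interior At \<and> \<gamma> 0 = p \<and> \<gamma> 1 = q}"

definition complete_ext_metric :: "'m set \<Rightarrow> ('m \<Rightarrow> 'm \<Rightarrow> ereal) \<Rightarrow> bool" where
  "complete_ext_metric S d \<longleftrightarrow>
     (\<forall>x :: nat \<Rightarrow> 'm.
        (\<forall>k. x k \<in> S) \<and>
        (\<forall>\<epsilon>>0. \<exists>n. \<forall>i\<ge>n. \<forall>j\<ge>n. d (x i) (x j) < ereal \<epsilon>)
        \<longrightarrow> (\<exists>l\<in>S. (\<lambda>k. d (x k) l) \<longlonglongrightarrow> 0))"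

end

theory Submission
  imports Defs
begin

text \<open>
  By compactness a Cauchy sequence in the interior subconverges to some point \<open>l\<close> of \<open>M\<close>. A smooth
  function \<open>f\<close> on \<open>M\<close> satisfies \<open>\<bar>\<rho>(\<xi>) f\<bar> \<le> C \<bar>\<xi>\<bar>\<^sub>g\<close>, since the metric lives on \<open>A\<close> over the
  compact \<open>M\<close>; so \<open>f\<close> is Lipschitz for the distance, and testing with bump functions the whole sequence converges
  to \<open>l\<close> in the topology of \<open>M\<close>. The point \<open>l\<close> cannot lie on a hyperface with defining function
  \<open>u\<close>: vector fields in \<open>\<V>\<close> are tangent to the hyperface, hence map \<open>u\<close> to multiples of \<open>u\<close>, so \<open>ln u\<close>
  is Lipschitz near \<open>l\<close>, yet it tends to \<open>-\<infinity>\<close> along the sequence. As \<open>l\<close> is interior,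
  straight segments in a chart show that the distances to \<open>l\<close> tend to \<open>0\<close>.
\<close>

section \<open>Calculus of smooth functions on open sets\<close>

text \<open>Tangent vectors are given only as derivations of global smooth functions, elements of
  \<open>\<V>\<close> only through global sections, and hyperfaces only as closures of components of
  a stratum. Every chart computation therefore passes through cutoffs, and Hadamard's lemma ties
  derivations to partial derivatives. Two estimates of opposite direction shape the rest. The bound
  on \<open>\<rho> p \<xi> f\<close> by the length of \<open>\<xi>\<close> uses only frames of
  \<open>A\<close> and holds up to the boundary. The length of \<open>\<xi>\<close> is in turn
  controlled by finitely many derivatives \<open>\<rho> p \<xi> f\<close> only where the anchor is
  injective, hence locally in the interior; this reverse control gives continuity of speeds, without
  which lengths would be meaningless, and smallness of distances near an interior point. At the
  boundary no smooth quotient by \<open>u\<close> is formed: an inequality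
  \<open>|X u| \<le> C u\<close> near the point suffices. Since it is local, the curves that join
  late terms of the sequence must be kept near \<open>l\<close>, which is why Lipschitz bounds are
  proved at every parameter of a curve and not only at its end.\<close>

lemma Ck_on_SucI:
  assumes "\<And>x. x \<in> U \<Longrightarrow> (f has_derivative D x) (at x)"
    and "\<And>v. Ck_on k (\<lambda>x. D x v) U" and "open U"
  shows "Ck_on (Suc k) f U"
proof -
  \<comment> \<open>\<open>frechet_derivative\<close> is a choice operator. As \<open>U\<close> is
    open, \<open>Ck_on\<close> depends only on the values on \<open>U\<close>, so the given
    derivatives \<open>D x\<close> may replace the chosen ones.\<close>
  have cong: "Ck_on k (\<lambda>x. frechet_derivative f (at x) v) U" for v
  proof -
    have "\<forall>x\<in>U. f x = g x \<Longrightarrow> Ck_on k f U \<longleftrightarrow> Ck_on k g U" for f g :: "'a \<Rightarrow> 'b"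
    proof (induction k arbitrary: f g)
      case 0
      then show ?case by (simp cong: continuous_on_cong)
    next
      case (Suc k)
      have D: "(f has_derivative E) (at x) \<longleftrightarrow> (g has_derivative E) (at x)" if "x \<in> U" for x E
        using has_derivative_transform_within_open[OF _ \<open>open U\<close> that, of f E UNIV g]
          has_derivative_transform_within_open[OF _ \<open>open U\<close> that, of g E UNIV f] Suc.prems by auto
      have "f differentiable_on U \<longleftrightarrow> g differentiable_on U"
        using D by (auto simp: differentiable_on_def differentiable_def at_within_open[OF _ \<open>open U\<close>])
      moreover have "\<forall>x\<in>U. frechet_derivative f (at x) v = frechet_derivative g (at x) v" for v
        unfolding frechet_derivative_def using D by presburger
      ultimately show ?case
        using Suc.IH[of "\<lambda>x. frechet_derivative f (at x) v" "\<lambda>x. frechet_derivative g (at x) v" for v]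
        unfolding Ck_on.simps by blast
    qed
    from this[of "\<lambda>x. frechet_derivative f (at x) v" "\<lambda>x. D x v"] show ?thesis
      using assms(2)[of v] frechet_derivative_at[OF assms(1)] by auto
  qed
  have "f differentiable_on U"
    using assms(1) by (auto simp: differentiable_on_def differentiable_def intro: has_derivative_at_withinI)
  with cong show ?thesis by simp
qed

lemma Ck_on_has_derivative:
  assumes "Ck_on (Suc k) f U" "open U" "x \<in> U"
  shows "(f has_derivative frechet_derivative f (at x)) (at x)"
  using assms(1,3) by (auto simp: differentiable_on_def at_within_open[OF _ assms(2)] frechet_derivative_works[symmetric])

lemma Ck_on_Suc_imp: "Ck_on (Suc k) f U \<Longrightarrow> Ck_on k f U"
proof (induction k arbitrary: f)
  case 0
  then show ?case by (simp add: differentiable_imp_continuous_on)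
next
  case (Suc k)
  then show ?case by (meson Ck_on.simps(2))
qed

lemma Ck_on_subset: "Ck_on k f U \<Longrightarrow> V \<subseteq> U \<Longrightarrow> Ck_on k f V"
  by (induction k arbitrary: f) (auto intro: continuous_on_subset differentiable_on_subset)

lemma Ck_on_const: "open U \<Longrightarrow> Ck_on k (\<lambda>x. c) U"
proof (induction k arbitrary: c)
  case (Suc k)
  show ?case by (rule Ck_on_SucI[where D="\<lambda>x v. 0"]) (auto intro: Suc)
qed simp

lemma Ck_on_bounded_linear:
  assumes "bounded_linear f" "open U"
  shows "Ck_on k f U"
proof (cases k)
  case 0
  then show ?thesis using assms by (simp add: linear_continuous_on)
next
  case (Suc j)
  show ?thesis unfolding Suc
    by (rule Ck_on_SucI[where D="\<lambda>x. f"])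
      (auto intro: assms bounded_linear_imp_has_derivative Ck_on_const)
qed

lemma Ck_on_add:
  assumes "open U" "Ck_on k f U" "Ck_on k g U"
  shows "Ck_on k (\<lambda>x. f x + g x) U"
  using assms(2,3)
proof (induction k arbitrary: f g)
  case 0
  then show ?case by (simp add: continuous_on_add)
next
  case (Suc k)
  show ?case
  proof (rule Ck_on_SucI[OF _ _ assms(1)])
    fix x assume "x \<in> U"
    then show "((\<lambda>x. f x + g x) has_derivative
        (\<lambda>v. frechet_derivative f (at x) v + frechet_derivative g (at x) v)) (at x)"
      using Suc.prems by (auto intro!: has_derivative_add Ck_on_has_derivative assms(1))
  qed (use Suc in auto)
qed

lemma Ck_on_sum:
  assumes "open U" "\<And>i. i \<in> I \<Longrightarrow> Ck_on k (f i) U"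
  shows "Ck_on k (\<lambda>x. \<Sum>i\<in>I. f i x) U"
  using assms(2)
  by (induction I rule: infinite_finite_induct) (auto intro!: Ck_on_const Ck_on_add assms(1))

text \<open>The product rule yields two bilinear terms of one order less, so a single induction
  serves products, scalar multiples and inner products.\<close>

lemma Ck_on_bilinear:
  assumes "bounded_bilinear B" "open U" "Ck_on k f U" "Ck_on k g U"
  shows "Ck_on k (\<lambda>x. B (f x) (g x)) U"
  using assms(3,4)
proof (induction k arbitrary: f g)
  case 0
  then show ?case
    using bounded_bilinear.continuous_on[OF assms(1)] by simp
next
  case (Suc k)
  show ?case
  proof (rule Ck_on_SucI[OF _ _ assms(2)])
    fix x assume "x \<in> U"
    then show "((\<lambda>x. B (f x) (g x)) has_derivative
        (\<lambda>v. B (f x) (frechet_derivative g (at x) v) + B (frechet_derivative f (at x) v) (g x))) (at x)"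
      using Suc.prems by (auto intro!: bounded_bilinear.FDERIV[OF assms(1)] Ck_on_has_derivative assms(2))
  next
    fix v
    show "Ck_on k (\<lambda>x. B (f x) (frechet_derivative g (at x) v) +
        B (frechet_derivative f (at x) v) (g x)) U"
      using Suc.prems Suc.prems[THEN Ck_on_Suc_imp]
      by (intro Ck_on_add assms(2) Suc.IH) (simp_all del: Ck_on.simps add: Ck_on.simps(2))
  qed
qed

lemmas Ck_on_mult = Ck_on_bilinear[OF bounded_bilinear_mult]

text \<open>\<open>Ck_on\<close> speaks of derivatives in fixed directions, whereas the chain rule
  differentiates \<open>f\<close> in a direction that varies with \<open>x\<close>. Expanding this
  direction in \<open>Basis\<close> leaves a finite sum of products, to which the induction
  hypothesis applies.\<close>

lemma Ck_on_compose:
  fixes f :: "'b::euclidean_space \<Rightarrow> 'c::real_normed_vector" and g :: "'a::real_normed_vector \<Rightarrow> 'b"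
  assumes "open U" "open V" "g ` U \<subseteq> V" "Ck_on k f V" "Ck_on k g U"
  shows "Ck_on k (\<lambda>x. f (g x)) U"
  using assms(4,5)
proof (induction k arbitrary: f)
  case 0
  then show ?case using assms(3) by (auto intro: continuous_on_compose2)
next
  case (Suc k)
  let ?D = "\<lambda>x v. \<Sum>b\<in>Basis. (frechet_derivative g (at x) v \<bullet> b) *\<^sub>R frechet_derivative f (at (g x)) b"
  show ?case
  proof (rule Ck_on_SucI[OF _ _ assms(1)])
    fix x assume x: "x \<in> U"
    then have gx: "g x \<in> V" using assms(3) by auto
    have f': "(f has_derivative frechet_derivative f (at (g x))) (at (g x))"
      using Ck_on_has_derivative[OF Suc.prems(1) assms(2) gx] .
    have "((\<lambda>x. f (g x)) has_derivative
        (\<lambda>v. frechet_derivative f (at (g x)) (frechet_derivative g (at x) v))) (at x)"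
      using has_derivative_compose[OF Ck_on_has_derivative[OF Suc.prems(2) assms(1) x] f'] .
    moreover have "(\<lambda>v. frechet_derivative f (at (g x)) (frechet_derivative g (at x) v)) = ?D x"
    proof
      fix v
      note L = has_derivative_linear[OF f']
      let ?w = "frechet_derivative g (at x) v"
      have "frechet_derivative f (at (g x)) (\<Sum>b\<in>Basis. (?w \<bullet> b) *\<^sub>R b) = ?D x v"
        by (simp only: linear_sum[OF L] linear_scale[OF L])
      then show "frechet_derivative f (at (g x)) ?w = ?D x v" by (simp only: euclidean_representation)
    qed
    ultimately show "((\<lambda>x. f (g x)) has_derivative ?D x) (at x)" by simp
  next
    fix v
    have "Ck_on k (\<lambda>x. frechet_derivative g (at x) v \<bullet> b) U" for b
      by (rule Ck_on_bilinear[OF bounded_bilinear_inner assms(1)])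
        (use Suc.prems assms(1) in \<open>auto intro: Ck_on_const\<close>)
    moreover have "Ck_on k (\<lambda>x. frechet_derivative f (at (g x)) b) U" for b
      by (rule Suc.IH) (use Suc.prems Ck_on_Suc_imp in auto)
    ultimately show "Ck_on k (\<lambda>x. ?D x v) U"
      by (intro Ck_on_sum Ck_on_bilinear[OF bounded_bilinear_scaleR] assms(1))
  qed
qed

section \<open>The flat exponential and bump functions on Euclidean space\<close>

definition flat_exp :: "nat \<Rightarrow> real \<Rightarrow> real" where
  "flat_exp n x = (if 0 < x then inverse x ^ n * exp (- inverse x) else 0)"

lemma flat_exp_tendsto_0: "(flat_exp n \<longlongrightarrow> 0) (at 0)"
proof -
  have "((\<lambda>x. inverse x ^ n / exp (inverse x)) \<longlongrightarrow> (0::real)) (at_right 0)"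
    using filterlim_compose[OF tendsto_power_div_exp_0 filterlim_inverse_at_top_right] .
  then have "(flat_exp n \<longlongrightarrow> 0) (at_right 0)"
    by (rule Lim_transform_eventually)
      (auto simp: eventually_at_right_field flat_exp_def exp_minus divide_inverse intro: exI[of _ 1])
  moreover have "(flat_exp n \<longlongrightarrow> 0) (at_left 0)"
    by (rule Lim_transform_eventually[OF tendsto_const])
      (auto simp: eventually_at_left_field flat_exp_def intro: exI[of _ "-1"])
  ultimately show ?thesis by (simp add: filterlim_split_at)
qed

text \<open>\<open>flat_exp 0\<close> is the classical flat function; the negative powers are
  carried along because differentiation then stays in the span of the family. At \<open>0\<close>
  the difference quotient of the member \<open>n\<close> is the member \<open>n + 1\<close>, which
  tends to \<open>0\<close>.\<close>

lemma DERIV_flat_exp: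
  "(flat_exp n has_real_derivative (flat_exp (n + 2) x - real n * flat_exp (n + 1) x)) (at x)"
proof -
  consider "x > 0" | "x < 0" | "x = 0" by linarith
  then show ?thesis
  proof cases
    case 1
    have "((\<lambda>x. inverse x ^ n * exp (- inverse x)) has_real_derivative
        (flat_exp (n + 2) x - real n * flat_exp (n + 1) x)) (at x)"
      using 1 by (auto intro!: derivative_eq_intros simp: flat_exp_def power2_eq_square)
        (cases n; simp add: algebra_simps)
    then show ?thesis
      by (rule has_field_derivative_transform_within_open[where S="{0<..}"])
        (use 1 in \<open>auto simp: flat_exp_def\<close>)
  next
    case 2
    have "((\<lambda>x. 0) has_real_derivative (flat_exp (n + 2) x - real n * flat_exp (n + 1) x)) (at x)"
      using 2 by (simp add: flat_exp_def)
    then show ?thesis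
      by (rule has_field_derivative_transform_within_open[where S="{..<0}"])
        (use 2 in \<open>auto simp: flat_exp_def\<close>)
  next
    case 3
    have "(\<lambda>h. (flat_exp n (0 + h) - flat_exp n 0) / h) = flat_exp (n + 1)"
      by (auto simp: flat_exp_def fun_eq_iff field_simps)
    then show ?thesis
      using flat_exp_tendsto_0[of "n + 1"] 3 by (simp add: DERIV_def flat_exp_def)
  qed
qed

lemma Ck_on_flat_exp: "Ck_on k (flat_exp n) UNIV"
proof (induction k arbitrary: n)
  case 0
  then show ?case
    using DERIV_flat_exp by (auto intro!: continuous_at_imp_continuous_on DERIV_isCont)
next
  case (Suc k)
  show ?case
  proof (rule Ck_on_SucI)
    show "(flat_exp n has_derivative (\<lambda>v. (flat_exp (n + 2) x + (- real n) * flat_exp (n + 1) x) * v)) (at x)" for x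
      using DERIV_flat_exp[of n x] by (simp add: has_field_derivative_def)
    show "Ck_on k (\<lambda>x. (flat_exp (n + 2) x + (- real n) * flat_exp (n + 1) x) * v) UNIV" for v
      by (intro Ck_on_mult Ck_on_add Ck_on_const Suc open_UNIV)
  qed simp
qed

lemma euclidean_bump:
  fixes y0 :: "'a::euclidean_space"
  assumes "r > 0"
  obtains \<psi> :: "'a \<Rightarrow> real" where "\<And>k. Ck_on k \<psi> UNIV" "\<psi> y0 = 1"
    "\<And>y. 0 \<le> \<psi> y" "\<And>y. y \<notin> cball y0 r \<Longrightarrow> \<psi> y = 0"
proof
  \<comment> \<open>The argument of the flat function is negative off the closed ball. At
    \<open>y0\<close> its value is \<open>exp (- 1 / r^2)\<close>, which the last factor normalises
    to \<open>1\<close>.\<close>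
  define \<psi> where "\<psi> = (\<lambda>y. flat_exp 0 (r\<^sup>2 + (-1) * ((y - y0) \<bullet> (y - y0))) * exp (1 / r\<^sup>2))"
  have id: "Ck_on k (\<lambda>y::'a. y - y0) UNIV" for k
    using Ck_on_add[OF open_UNIV Ck_on_bounded_linear[OF bounded_linear_ident open_UNIV]
        Ck_on_const[OF open_UNIV], of k "- y0"] by simp
  show "Ck_on k \<psi> UNIV" for k
    unfolding \<psi>_def
    by (intro Ck_on_mult Ck_on_compose[OF open_UNIV open_UNIV _ Ck_on_flat_exp] Ck_on_add Ck_on_const
        Ck_on_bilinear[OF bounded_bilinear_inner] id open_UNIV) simp
  show "\<psi> y0 = 1" using assms by (simp add: \<psi>_def flat_exp_def exp_minus field_simps)
  show "0 \<le> \<psi> y" for y by (simp add: \<psi>_def flat_exp_def)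
  show "\<psi> y = 0" if "y \<notin> cball y0 r" for y
  proof -
    have "r < norm (y - y0)" using that by (simp add: dist_norm norm_minus_commute)
    then have "r\<^sup>2 < (norm (y - y0))\<^sup>2" using assms by (simp add: power_strict_mono)
    then show ?thesis by (simp add: \<psi>_def flat_exp_def dot_square_norm)
  qed
qed

section \<open>Hadamard's lemma with smooth coefficients\<close>

lemma segment_in_ball:
  fixes y0 :: "'a::real_normed_vector"
  assumes "y \<in> ball y0 r" "s \<in> {0..1}"
  shows "y0 + s *\<^sub>R (y - y0) \<in> ball y0 r"
proof -
  have "\<bar>s\<bar> * norm (y - y0) \<le> norm (y - y0)"
    using assms(2) by (intro mult_left_le_one_le) auto
  then show ?thesis using assms(1) by (simp add: dist_norm norm_minus_commute)
qed

text \<open>The weight \<open>s ^ j\<close> closes the induction: differentiating under the integral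
  in \<open>y\<close> brings out one more factor \<open>s\<close> by the chain rule. Hadamard's
  lemma uses \<open>j = 0\<close>.\<close>

lemma Ck_on_weighted_integral:
  fixes G :: "'a::euclidean_space \<Rightarrow> real"
  assumes "\<And>k. Ck_on k G (ball y0 r)"
  shows "Ck_on k (\<lambda>y. integral {0..1} (\<lambda>s. s ^ j * G (y0 + s *\<^sub>R (y - y0)))) (ball y0 r)"
  using assms
proof (induction k arbitrary: G j)
  note inb = segment_in_ball[of _ y0 r]
  have cont: "continuous_on (ball y0 r \<times> cbox 0 1) (\<lambda>(y, s). s ^ i * G (y0 + s *\<^sub>R (y - y0)))"
    if "continuous_on (ball y0 r) G" for G :: "'a \<Rightarrow> real" and i
    unfolding split_beta
    by (intro continuous_intros continuous_on_compose2[OF that]) (use inb in auto)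
  {
    case 0
    then have "continuous_on (ball y0 r) G" by (metis Ck_on.simps(1))
    from integral_continuous_on_param[OF cont[OF this, of j]] show ?case by (simp add: cbox_interval)
  next
    case (Suc k)
    have cG: "continuous_on (ball y0 r) G" using Suc.prems[of 0] by simp
    define D where "D y v = integral {0..1} (\<lambda>s. s ^ (j + 1) * frechet_derivative G (at (y0 + s *\<^sub>R (y - y0))) v)" for y v
    have DG: "Ck_on k (\<lambda>x. frechet_derivative G (at x) v) (ball y0 r)" for v k
      using Suc.prems[of "Suc k"] by simp
    show ?case
    proof (rule Ck_on_SucI)
      show "Ck_on k (\<lambda>y. D y v) (ball y0 r)" for v
        unfolding D_def by (rule Suc.IH) (rule DG)
    next
      fix y assume y: "y \<in> ball y0 r"
      \<comment> \<open>\<open>leibniz_rule\<close> asks for a derivative that is continuous as a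
        bounded linear map, so the derivative is packed into the type of such maps; continuity is
        then checked one direction at a time.\<close>
      define fx where "fx y s = Blinfun (\<lambda>v. s ^ (j + 1) * frechet_derivative G (at (y0 + s *\<^sub>R (y - y0))) v)" for y s
      have G': "(G has_derivative frechet_derivative G (at x)) (at x)" if "x \<in> ball y0 r" for x
        using Ck_on_has_derivative[OF Suc.prems _ that] by blast
      have bl: "bounded_linear (\<lambda>v. s ^ (j + 1) * frechet_derivative G (at (y0 + s *\<^sub>R (y - y0))) v)"
        if "y \<in> ball y0 r" "s \<in> {0..1}" for y s
        using has_derivative_bounded_linear[OF G'[OF inb[OF that]]] by (rule bounded_linear_const_mult)
      have ap: "blinfun_apply (fx y s) v = s ^ (j + 1) * frechet_derivative G (at (y0 + s *\<^sub>R (y - y0))) v"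
        if "y \<in> ball y0 r" "s \<in> {0..1}" for y s v
        unfolding fx_def using bounded_linear_Blinfun_apply[OF bl[OF that]] by simp
      have d: "((\<lambda>y. s ^ j * G (y0 + s *\<^sub>R (y - y0))) has_derivative blinfun_apply (fx y s)) (at y within ball y0 r)"
        if "y \<in> ball y0 r" "s \<in> cbox 0 1" for y s
      proof -
        have s: "s \<in> {0..1}" using that by simp
        have "((\<lambda>y. y0 + s *\<^sub>R (y - y0)) has_derivative (\<lambda>v. s *\<^sub>R v)) (at y)"
          by (auto intro!: derivative_eq_intros simp: scaleR_diff_right)
        from has_derivative_compose[OF this G'[OF inb[OF that(1) s]]]
        have "((\<lambda>y. s ^ j * G (y0 + s *\<^sub>R (y - y0))) has_derivative
            (\<lambda>v. s ^ j * frechet_derivative G (at (y0 + s *\<^sub>R (y - y0))) (s *\<^sub>R v))) (at y)"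
          by (rule has_derivative_mult_right)
        moreover have "(\<lambda>v. s ^ j * frechet_derivative G (at (y0 + s *\<^sub>R (y - y0))) (s *\<^sub>R v)) = blinfun_apply (fx y s)"
          using ap[OF that(1) s] has_derivative_linear[OF G'[OF inb[OF that(1) s]]]
          by (auto simp: linear_scale fun_eq_iff)
        ultimately show ?thesis by (auto intro: has_derivative_at_withinI)
      qed
      have int: "(\<lambda>s. s ^ j * G (y0 + s *\<^sub>R (y - y0))) integrable_on cbox 0 1" if "y \<in> ball y0 r" for y
        by (intro integrable_continuous continuous_intros continuous_on_compose2[OF cG]) (use inb that in auto)
      have cfx: "continuous_on (ball y0 r \<times> cbox 0 1) (\<lambda>(y, s). fx y s)"
      proof (rule continuous_on_blinfun_componentwise)
        fix i :: 'a
        have "continuous_on (ball y0 r) (\<lambda>x. frechet_derivative G (at x) i)" using DG[of 0] by simp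
        from cont[OF this, of "j + 1"]
        show "continuous_on (ball y0 r \<times> cbox 0 1) (\<lambda>x. blinfun_apply (case x of (y, s) \<Rightarrow> fx y s) i)"
          by (rule continuous_on_cong[THEN iffD1, rotated -1]) (auto simp: ap)
      qed
      have "((\<lambda>y. integral (cbox 0 1) (\<lambda>s. s ^ j * G (y0 + s *\<^sub>R (y - y0)))) has_derivative
          blinfun_apply (integral (cbox 0 1) (fx y))) (at y within ball y0 r)"
        by (rule leibniz_rule[OF d int cfx y]) auto
      moreover have "blinfun_apply (integral (cbox 0 1) (fx y)) = D y"
      proof
        fix v
        have "continuous_on (cbox 0 1) (\<lambda>s. case (y, s) of (y, s) \<Rightarrow> fx y s)"
          by (rule continuous_on_compose2[OF cfx]) (use y in \<open>auto intro!: continuous_intros\<close>)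
        then have "fx y integrable_on cbox 0 1" by (simp add: integrable_continuous_interval)
        then have "blinfun_apply (integral (cbox 0 1) (fx y)) v = integral (cbox 0 1) (\<lambda>s. fx y s v)"
          by (rule blinfun_apply_integral)
        also have "\<dots> = D y v"
          unfolding D_def cbox_interval by (rule integral_cong) (use ap[OF y] in simp)
        finally show "blinfun_apply (integral (cbox 0 1) (fx y)) v = D y v" .
      qed
      ultimately show "((\<lambda>y. integral {0..1} (\<lambda>s. s ^ j * G (y0 + s *\<^sub>R (y - y0)))) has_derivative D y) (at y)"
        using y by (simp add: cbox_interval at_within_open[OF y])
    qed simp
  }
qed

text \<open>The fundamental theorem of calculus along the segment from \<open>y0\<close> to
  \<open>y\<close>; \<open>h b\<close> averages the partial derivative in direction \<open>b\<close>
  over this segment. Smooth coefficients are needed, not just a first-order estimate, because a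
  derivation is going to be applied to the products.\<close>

lemma Hadamard:
  fixes F :: "'a::euclidean_space \<Rightarrow> real"
  assumes F: "\<And>k. Ck_on k F (ball y0 r)"
  obtains h where "\<And>b k. Ck_on k (h b) (ball y0 r)"
    "\<And>y. y \<in> ball y0 r \<Longrightarrow> F y = F y0 + (\<Sum>b\<in>Basis. ((y - y0) \<bullet> b) * h b y)"
    "\<And>b. h b y0 = frechet_derivative F (at y0) b"
proof
  define h where "h b y = integral {0..1} (\<lambda>s. s ^ 0 * frechet_derivative F (at (y0 + s *\<^sub>R (y - y0))) b)" for b y
  have DF: "Ck_on k (\<lambda>x. frechet_derivative F (at x) v) (ball y0 r)" for v k
    using F[of "Suc k"] by simp
  show "Ck_on k (h b) (ball y0 r)" for b k
    unfolding h_def by (rule Ck_on_weighted_integral) (rule DF)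
  show "h b y0 = frechet_derivative F (at y0) b" for b by (simp add: h_def)
  fix y assume y: "y \<in> ball y0 r"
  note inb = segment_in_ball[OF y]
  have F': "(F has_derivative frechet_derivative F (at x)) (at x)" if "x \<in> ball y0 r" for x
    using Ck_on_has_derivative[OF F _ that] by blast
  have lin: "frechet_derivative F (at x) w = (\<Sum>b\<in>Basis. (w \<bullet> b) * frechet_derivative F (at x) b)"
    if "x \<in> ball y0 r" for x w
  proof -
    note L = has_derivative_linear[OF F'[OF that]]
    have "frechet_derivative F (at x) (\<Sum>b\<in>Basis. (w \<bullet> b) *\<^sub>R b) =
        (\<Sum>b\<in>Basis. (w \<bullet> b) * frechet_derivative F (at x) b)"
      by (simp only: linear_sum[OF L] linear_scale[OF L] real_scaleR_def)
    then show ?thesis by (simp only: euclidean_representation)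
  qed
  have "((\<lambda>s. F (y0 + s *\<^sub>R (y - y0))) has_vector_derivative
      (\<Sum>b\<in>Basis. ((y - y0) \<bullet> b) * frechet_derivative F (at (y0 + s *\<^sub>R (y - y0))) b)) (at s within {0..1})"
    if "s \<in> {0..1}" for s
  proof -
    have "((\<lambda>s. y0 + s *\<^sub>R (y - y0)) has_derivative (\<lambda>t. t *\<^sub>R (y - y0))) (at s within {0..1})"
      by (auto intro!: derivative_eq_intros)
    from has_derivative_compose[OF this F'[OF inb[OF that]]] show ?thesis
      using has_derivative_linear[OF F'[OF inb[OF that]]] lin[OF inb[OF that], of "y - y0"]
      by (simp add: has_vector_derivative_def linear_scale)
  qed
  then have "((\<lambda>s. \<Sum>b\<in>Basis. ((y - y0) \<bullet> b) * frechet_derivative F (at (y0 + s *\<^sub>R (y - y0))) b)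
      has_integral (F (y0 + 1 *\<^sub>R (y - y0)) - F (y0 + 0 *\<^sub>R (y - y0)))) {0..1}"
    by (intro fundamental_theorem_of_calculus) auto
  note FTC = this
  have "(\<lambda>s. frechet_derivative F (at (y0 + s *\<^sub>R (y - y0))) b) integrable_on {0..1}" for b
  proof -
    have "continuous_on (ball y0 r) (\<lambda>x. frechet_derivative F (at x) b)" using DF[of 0] by simp
    then have "continuous_on {0..1} (\<lambda>s. frechet_derivative F (at (y0 + s *\<^sub>R (y - y0))) b)"
      by (rule continuous_on_compose2) (use inb in \<open>auto intro!: continuous_intros\<close>)
    then show ?thesis by (rule integrable_continuous_interval)
  qed
  then have "((\<lambda>s. \<Sum>b\<in>Basis. ((y - y0) \<bullet> b) * frechet_derivative F (at (y0 + s *\<^sub>R (y - y0))) b)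
      has_integral (\<Sum>b\<in>Basis. ((y - y0) \<bullet> b) * h b y)) {0..1}"
    unfolding h_def by (intro has_integral_sum has_integral_mult_right) (auto simp: integrable_integral)
  from has_integral_unique[OF FTC this]
  show "F y = F y0 + (\<Sum>b\<in>Basis. ((y - y0) \<bullet> b) * h b y)" by simp
qed

section \<open>Smooth functions and derivations on manifolds with corners\<close>

lemma smooth_on_setE:
  assumes "smooth_on_set f S" "x \<in> S"
  obtains W F where "open W" "x \<in> W" "\<And>k. Ck_on k F W" "\<And>y. y \<in> W \<Longrightarrow> y \<in> S \<Longrightarrow> F y = f y"
proof -
  obtain W F where *: "open W \<and> x \<in> W \<and> (\<forall>k. Ck_on k F W) \<and> (\<forall>y\<in>W \<inter> S. F y = f y)"
    using assms unfolding smooth_on_set_def by metis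
  show thesis by (rule that[of W F]) (use * in auto)
qed

text \<open>Extendability at a single point through a single chart, expressed by
  \<open>chart_map\<close> rather than by its inverse. Smoothness on an open set then reduces to
  finding, for each point, one chart in which this holds.\<close>

definition smooth_at ::
  "('m, 'e::euclidean_space) corner_chart \<Rightarrow> ('m \<Rightarrow> real) \<Rightarrow> 'm \<Rightarrow> bool" where
  "smooth_at c f q \<longleftrightarrow>
     (\<exists>U F. open U \<and> chart_map c q \<in> U \<and> (\<forall>k. Ck_on k F U) \<and>
        (\<forall>p\<in>chart_dom c. chart_map c p \<in> U \<longrightarrow> F (chart_map c p) = f p))"

lemma smooth_atE:
  assumes "smooth_at c f q"
  obtains U F where "open U" "chart_map c q \<in> U" "\<And>k. Ck_on k F U"
    "\<And>p. p \<in> chart_dom c \<Longrightarrow> chart_map c p \<in> U \<Longrightarrow> F (chart_map c p) = f p"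
  using assms unfolding smooth_at_def by blast

lemma smooth_atI:
  assumes "open U" "chart_map c q \<in> U" "\<And>k. Ck_on k F U"
    "\<And>p. p \<in> chart_dom c \<Longrightarrow> chart_map c p \<in> U \<Longrightarrow> F (chart_map c p) = f p"
  shows "smooth_at c f q"
  using assms unfolding smooth_at_def by blast

lemma smooth_at_binary:
  fixes c :: "('m, 'e::euclidean_space) corner_chart"
  assumes "smooth_at c f q" "smooth_at c g q"
    and "\<And>k (U::'e set) F G. open U \<Longrightarrow> Ck_on k F U \<Longrightarrow> Ck_on k G U \<Longrightarrow> Ck_on k (\<lambda>x. B (F x) (G x)) U"
  shows "smooth_at c (\<lambda>p. B (f p) (g p)) q"
proof -
  obtain U F where U: "open U" "chart_map c q \<in> U" "\<And>k. Ck_on k F U"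
    "\<And>p. p \<in> chart_dom c \<Longrightarrow> chart_map c p \<in> U \<Longrightarrow> F (chart_map c p) = f p"
    using assms(1) by (rule smooth_atE) (rule that)
  obtain V G where V: "open V" "chart_map c q \<in> V" "\<And>k. Ck_on k G V"
    "\<And>p. p \<in> chart_dom c \<Longrightarrow> chart_map c p \<in> V \<Longrightarrow> G (chart_map c p) = g p"
    using assms(2) by (rule smooth_atE) (rule that)
  show ?thesis
  proof (rule smooth_atI[of "U \<inter> V" c q "\<lambda>x. B (F x) (G x)"])
    show "Ck_on k (\<lambda>x. B (F x) (G x)) (U \<inter> V)" for k
      by (rule assms(3)[OF open_Int[OF U(1) V(1)] Ck_on_subset[OF U(3)] Ck_on_subset[OF V(3)]]) auto
  qed (use U V in auto)
qed

lemma smooth_at_const: "smooth_at c (\<lambda>p. a) q"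
  by (rule smooth_atI[of UNIV c q "\<lambda>x. a"]) (auto intro: Ck_on_const)

lemma smooth_at_add: "smooth_at c f q \<Longrightarrow> smooth_at c g q \<Longrightarrow> smooth_at c (\<lambda>p. f p + g p) q"
  by (rule smooth_at_binary) (auto intro: Ck_on_add)

lemma smooth_at_mult: "smooth_at c f q \<Longrightarrow> smooth_at c g q \<Longrightarrow> smooth_at c (\<lambda>p. f p * g p) q"
  by (rule smooth_at_binary) (auto intro: Ck_on_mult)

section \<open>Charts, their images in quadrants, and changes of chart\<close>

locale corner_atlas =
  fixes N :: "'e::euclidean_space set" and At :: "('m::t2_space, 'e) corner_chart set"
  assumes atlas: "smooth_atlas N At"
begin

lemma N_Basis: "N \<subseteq> Basis" and finite_N: "finite N"
  using atlas by (auto simp: smooth_atlas_def intro: finite_subset)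

lemma chart_ex: "\<exists>c\<in>At. q \<in> chart_dom c"
  using atlas unfolding smooth_atlas_def by (metis UNIV_I UN_E)

lemma chart_cover: obtains c where "c \<in> At" "q \<in> chart_dom c"
  using chart_ex by blast

context
  fixes c assumes c: "c \<in> At"
begin

lemma is_chart: "is_corner_chart N c"
  using atlas c by (auto simp: smooth_atlas_def)

lemma open_chart_dom: "open (chart_dom c)" and corner_subset: "chart_corner c \<subseteq> N"
  and chart_homeo: "homeomorphism (chart_dom c) (chart_map c ` chart_dom c) (chart_map c) (chart_inv c)"
  and openin_chart_image: "openin (top_of_set (quadrant N (chart_corner c))) (chart_map c ` chart_dom c)"
  using is_chart by (auto simp: is_corner_chart_def)

lemma finite_corner: "finite (chart_corner c)"
  using corner_subset finite_N finite_subset by blast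

lemma chart_inv_map: "q \<in> chart_dom c \<Longrightarrow> chart_inv c (chart_map c q) = q"
  using chart_homeo by (auto simp: homeomorphism_def)

lemma continuous_chart_map: "continuous_on (chart_dom c) (chart_map c)"
  and continuous_chart_inv: "continuous_on (chart_map c ` chart_dom c) (chart_inv c)"
  using chart_homeo by (auto simp: homeomorphism_def)

lemma chart_map_in_quadrant: "q \<in> chart_dom c \<Longrightarrow> chart_map c q \<in> quadrant N (chart_corner c)"
  using openin_chart_image openin_imp_subset by blast

lemma open_chart_preimage: "open U \<Longrightarrow> open {q \<in> chart_dom c. chart_map c q \<in> U}"
  using continuous_open_preimage[OF continuous_chart_map open_chart_dom, of U]
  by (simp add: vimage_def Int_def)

lemma chart_image_open:
  assumes "open W"
  obtains U where "open U" "\<And>q. q \<in> chart_dom c \<Longrightarrow> chart_map c q \<in> U \<longleftrightarrow> q \<in> W"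
proof -
  have "openin (top_of_set (chart_dom c)) (chart_dom c \<inter> W)"
    using assms by (simp add: openin_open_Int)
  then have "openin (top_of_set (chart_map c ` chart_dom c)) (chart_map c ` (chart_dom c \<inter> W))"
    by (rule homeomorphism_imp_open_map[OF chart_homeo])
  then obtain U where U: "open U" "chart_map c ` (chart_dom c \<inter> W) = chart_map c ` chart_dom c \<inter> U"
    unfolding openin_open by (elim exE conjE) (rule that)
  have "chart_map c q \<in> U \<longleftrightarrow> q \<in> W" if "q \<in> chart_dom c" for q
  proof
    assume "chart_map c q \<in> U"
    then have "chart_map c q \<in> chart_map c ` (chart_dom c \<inter> W)"
      unfolding U(2) using that by (intro IntI imageI)
    then obtain p where p: "chart_map c q = chart_map c p" "p \<in> chart_dom c \<inter> W" by (rule imageE)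
    then have "q = p" using chart_inv_map[OF that] chart_inv_map[of p] by (metis IntD1)
    then show "q \<in> W" using p(2) by (metis IntD2)
  next
    assume "q \<in> W"
    then have "chart_map c q \<in> chart_map c ` (chart_dom c \<inter> W)" using that by (intro imageI IntI)
    then show "chart_map c q \<in> U" unfolding U(2) by (rule IntD2)
  qed
  with U(1) show thesis by (rule that)
qed

text \<open>The image of a chart is only relatively open, so what fits into it is a ball cut with
  the quadrant. A closed ball is chosen because this intersection is then compact.\<close>

lemma quadrant_ball:
  assumes "q \<in> chart_dom c" "open W" "q \<in> W"
  obtains r where "r > 0"
    "\<And>y. y \<in> quadrant N (chart_corner c) \<Longrightarrow> y \<in> cball (chart_map c q) r \<Longrightarrow>
       \<exists>p. p \<in> chart_dom c \<and> p \<in> W \<and> chart_map c p = y \<and> chart_inv c y = p"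
proof -
  obtain U where U: "open U" "\<And>q. q \<in> chart_dom c \<Longrightarrow> chart_map c q \<in> U \<longleftrightarrow> q \<in> W"
    using chart_image_open[OF assms(2)] by blast
  obtain V where V: "open V" "chart_map c ` chart_dom c = quadrant N (chart_corner c) \<inter> V"
    using openin_chart_image unfolding openin_open by metis
  have "chart_map c q \<in> chart_map c ` chart_dom c" using assms(1) by (rule imageI)
  then have "chart_map c q \<in> U \<inter> V" unfolding V(2) using U(2)[OF assms(1)] assms(3) by simp
  then obtain r where r: "r > 0" "cball (chart_map c q) r \<subseteq> U \<inter> V"
    using U(1) V(1) by (metis open_Int open_contains_cball)
  show thesis
  proof
    fix y assume "y \<in> quadrant N (chart_corner c)" "y \<in> cball (chart_map c q) r"
    then have y: "y \<in> quadrant N (chart_corner c) \<inter> V" "y \<in> U" using r(2) by (auto simp: subset_iff)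
    then obtain p where p: "y = chart_map c p" "p \<in> chart_dom c" unfolding V(2)[symmetric] by (elim imageE)
    have "p \<in> W" using U(2)[OF p(2)] y(2) p(1) by simp
    then show "\<exists>p. p \<in> chart_dom c \<and> p \<in> W \<and> chart_map c p = y \<and> chart_inv c y = p"
      using p(2) chart_inv_map[OF p(2)] unfolding p(1) by (intro exI[of _ p] conjI refl)
  qed (rule r(1))
qed

lemma smooth_at_cong:
  assumes "smooth_at c f q" "open W" "q \<in> W" "q \<in> chart_dom c" "\<And>p. p \<in> W \<Longrightarrow> f p = g p"
  shows "smooth_at c g q"
proof -
  obtain U F where U: "open U" "chart_map c q \<in> U" "\<And>k. Ck_on k F U"
    "\<And>p. p \<in> chart_dom c \<Longrightarrow> chart_map c p \<in> U \<Longrightarrow> F (chart_map c p) = f p"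
    using assms(1) by (rule smooth_atE) (rule that)
  obtain V where V: "open V" "\<And>q. q \<in> chart_dom c \<Longrightarrow> chart_map c q \<in> V \<longleftrightarrow> q \<in> W"
    using chart_image_open[OF assms(2)] by blast
  show ?thesis
    by (rule smooth_atI[of "U \<inter> V" c q F])
      (use U V assms in \<open>auto intro: Ck_on_subset[of _ F U]\<close>)
qed

text \<open>The transition map has a smooth extension \<open>G\<close> near the image of
  \<open>q\<close>, and \<open>F\<close> composed with \<open>G\<close> extends \<open>f\<close>.
  The set \<open>V\<close> restricts to images of the overlap, where \<open>G\<close> is known to be
  the transition map.\<close>

lemma smooth_at_transition:
  assumes d: "d \<in> At" and q: "q \<in> chart_dom c" "q \<in> chart_dom d" and f: "smooth_at d f q"
  shows "smooth_at c f q"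
proof -
  obtain U F where U: "open U" "chart_map d q \<in> U" "\<And>k. Ck_on k F U"
    "\<And>p. p \<in> chart_dom d \<Longrightarrow> chart_map d p \<in> U \<Longrightarrow> F (chart_map d p) = f p"
    using f by (rule smooth_atE) (rule that)
  have "smooth_on_set (chart_map d \<circ> chart_inv c) (chart_map c ` (chart_dom c \<inter> chart_dom d))"
    using atlas c d by (auto simp: smooth_atlas_def)
  moreover have "chart_map c q \<in> chart_map c ` (chart_dom c \<inter> chart_dom d)" using q by (intro imageI IntI)
  ultimately obtain W G where W: "open W" "chart_map c q \<in> W" "\<And>k. Ck_on k G W"
    "\<And>y. y \<in> W \<Longrightarrow> y \<in> chart_map c ` (chart_dom c \<inter> chart_dom d) \<Longrightarrow>
       G y = (chart_map d \<circ> chart_inv c) y"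
    by (rule smooth_on_setE) (rule that)
  have dd: "open (chart_dom d)" using d atlas by (auto simp: smooth_atlas_def is_corner_chart_def)
  obtain V where V: "open V" "\<And>q. q \<in> chart_dom c \<Longrightarrow> chart_map c q \<in> V \<longleftrightarrow> q \<in> chart_dom d"
    using chart_image_open[OF dd] by blast
  have G: "G (chart_map c p) = chart_map d p"
    if "p \<in> chart_dom c" "chart_map c p \<in> V" "chart_map c p \<in> W" for p
  proof -
    have "chart_map c p \<in> chart_map c ` (chart_dom c \<inter> chart_dom d)"
      using that V(2)[of p] by (intro imageI IntI) auto
    from W(4)[OF that(3) this] show ?thesis using chart_inv_map[OF that(1)] by simp
  qed
  let ?Z = "V \<inter> (W \<inter> G -` U)"
  have oW: "open (W \<inter> G -` U)"
    using W(3)[of 0] W(1) U(1) by (auto intro: continuous_open_preimage)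
  show ?thesis
  proof (rule smooth_atI[of ?Z c q "\<lambda>x. F (G x)"])
    show "open ?Z" using oW V(1) by blast
    show "Ck_on k (\<lambda>x. F (G x)) ?Z" for k
      by (rule Ck_on_compose[OF \<open>open ?Z\<close> U(1) _ U(3) Ck_on_subset[OF W(3)]]) auto
  qed (use G U V W q in auto)
qed

lemma smooth_at_coordinate:
  assumes "open U" "chart_map c q \<in> U" "\<And>k. Ck_on k F U"
  shows "smooth_at c (\<lambda>p. F (chart_map c p)) q"
  by (rule smooth_atI) (use assms in auto)

end

lemma smooth_fun_on_iff:
  assumes "open W"
  shows "smooth_fun_on At W f \<longleftrightarrow> (\<forall>c\<in>At. \<forall>q\<in>chart_dom c \<inter> W. smooth_at c f q)"
proof safe
  fix c q assume f: "smooth_fun_on At W f" and c: "c \<in> At" and q: "q \<in> chart_dom c" "q \<in> W"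
  then have "smooth_on_set (f \<circ> chart_inv c) (chart_map c ` (chart_dom c \<inter> W))"
    by (simp add: smooth_fun_on_def)
  moreover have "chart_map c q \<in> chart_map c ` (chart_dom c \<inter> W)" using q by (intro imageI IntI)
  ultimately obtain U F where U: "open U" "chart_map c q \<in> U" "\<And>k. Ck_on k F U"
    "\<And>y. y \<in> U \<Longrightarrow> y \<in> chart_map c ` (chart_dom c \<inter> W) \<Longrightarrow> F y = (f \<circ> chart_inv c) y"
    by (rule smooth_on_setE) (rule that)
  obtain V where V: "open V" "\<And>q. q \<in> chart_dom c \<Longrightarrow> chart_map c q \<in> V \<longleftrightarrow> q \<in> W"
    using chart_image_open[OF c assms] by blast
  show "smooth_at c f q"
  proof (rule smooth_atI[of "U \<inter> V" c q F])
    show "F (chart_map c p) = f p" if "p \<in> chart_dom c" "chart_map c p \<in> U \<inter> V" for p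
    proof -
      have "chart_map c p \<in> chart_map c ` (chart_dom c \<inter> W)"
        using that V(2)[of p] by (intro imageI IntI) auto
      then show ?thesis using U(4)[of "chart_map c p"] that chart_inv_map[OF c that(1)] by simp
    qed
  qed (use U V q in \<open>auto intro: Ck_on_subset[of _ F U]\<close>)
next
  assume *: "\<forall>c\<in>At. \<forall>q\<in>chart_dom c \<inter> W. smooth_at c f q"
  show "smooth_fun_on At W f"
    unfolding smooth_fun_on_def smooth_on_set_def
  proof (intro ballI)
    fix c y assume c: "c \<in> At" and "y \<in> chart_map c ` (chart_dom c \<inter> W)"
    then obtain q where q: "y = chart_map c q" "q \<in> chart_dom c" "q \<in> W" by (elim imageE IntE) (rule that)
    with c * have "smooth_at c f q" by simp
    then obtain U F where U: "open U" "chart_map c q \<in> U" "\<And>k. Ck_on k F U"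
      "\<And>p. p \<in> chart_dom c \<Longrightarrow> chart_map c p \<in> U \<Longrightarrow> F (chart_map c p) = f p"
      by (rule smooth_atE) (rule that)
    then show "\<exists>W' F. open W' \<and> y \<in> W' \<and> (\<forall>k. Ck_on k F W') \<and>
        (\<forall>y\<in>W' \<inter> chart_map c ` (chart_dom c \<inter> W). F y = (f \<circ> chart_inv c) y)"
      using q(1) chart_inv_map[OF c] by (intro exI[of _ U] exI[of _ F]) auto
  qed
qed

lemma smooth_funs_iff: "f \<in> smooth_funs At \<longleftrightarrow> (\<forall>c\<in>At. \<forall>q\<in>chart_dom c. smooth_at c f q)"
  by (simp add: smooth_funs_def smooth_fun_on_iff)

lemma smooth_funs_smooth_at: "f \<in> smooth_funs At \<Longrightarrow> c \<in> At \<Longrightarrow> q \<in> chart_dom c \<Longrightarrow> smooth_at c f q"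
  by (simp add: smooth_funs_iff)

lemma smooth_fun_onI:
  assumes "open W" "\<And>q. q \<in> W \<Longrightarrow> \<exists>c\<in>At. q \<in> chart_dom c \<and> smooth_at c f q"
  shows "smooth_fun_on At W f"
  using assms smooth_at_transition by (auto simp: smooth_fun_on_iff) metis

lemma smooth_funsI:
  assumes "\<And>q. \<exists>c\<in>At. q \<in> chart_dom c \<and> smooth_at c f q"
  shows "f \<in> smooth_funs At"
  using assms smooth_fun_onI[of UNIV f] by (simp add: smooth_funs_def)

lemma smooth_funs_const: "(\<lambda>p. a) \<in> smooth_funs At"
  by (simp add: smooth_funs_iff smooth_at_const)

lemma smooth_funs_add: "f \<in> smooth_funs At \<Longrightarrow> h \<in> smooth_funs At \<Longrightarrow> (\<lambda>p. f p + h p) \<in> smooth_funs At"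
  by (simp add: smooth_funs_iff smooth_at_add)

lemma smooth_funs_mult: "f \<in> smooth_funs At \<Longrightarrow> h \<in> smooth_funs At \<Longrightarrow> (\<lambda>p. f p * h p) \<in> smooth_funs At"
  by (simp add: smooth_funs_iff smooth_at_mult)

lemma smooth_funs_lincomb:
  "f \<in> smooth_funs At \<Longrightarrow> h \<in> smooth_funs At \<Longrightarrow> (\<lambda>p. a * f p + b * h p) \<in> smooth_funs At"
  by (intro smooth_funs_add smooth_funs_mult smooth_funs_const)

lemma smooth_at_isCont:
  assumes "c \<in> At" "q \<in> chart_dom c" "smooth_at c f q"
  shows "isCont f q"
proof -
  obtain U F where U: "open U" "chart_map c q \<in> U" "\<And>k. Ck_on k F U"
    "\<And>p. p \<in> chart_dom c \<Longrightarrow> chart_map c p \<in> U \<Longrightarrow> F (chart_map c p) = f p"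
    using assms(3) by (rule smooth_atE) (rule that)
  have "isCont F (chart_map c q)"
    using U(3)[of 0] U(1,2) by (simp add: continuous_on_eq_continuous_at)
  moreover have "isCont (chart_map c) q"
    using continuous_chart_map[OF assms(1)] open_chart_dom[OF assms(1)] assms(2)
    by (simp add: continuous_on_eq_continuous_at)
  ultimately have "isCont (\<lambda>p. F (chart_map c p)) q" by (rule continuous_at_compose[unfolded o_def, rotated])
  moreover have "eventually (\<lambda>p. F (chart_map c p) = f p) (nhds q)"
    using eventually_nhds_in_open[OF open_chart_preimage[OF assms(1) U(1)], of q] assms(2) U(2)
    by (auto elim!: eventually_mono simp: U(4))
  ultimately show ?thesis by (metis isCont_cong)
qed

lemma smooth_funs_continuous: "f \<in> smooth_funs At \<Longrightarrow> continuous_on A f"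
  by (meson chart_ex smooth_at_isCont smooth_funs_smooth_at continuous_at_imp_continuous_on)

section \<open>Cutoffs and bump functions on the manifold\<close>

lemma closed_quadrant: "closed (quadrant N K)"
proof -
  have "quadrant N K = span N \<inter> (\<Inter>b\<in>K. {x. 0 \<le> b \<bullet> x})"
    by (auto simp: quadrant_def inner_commute)
  moreover have "closed (\<Inter>b\<in>K. {x. 0 \<le> b \<bullet> x})"
    by (intro closed_INT ballI closed_halfspace_ge)
  ultimately show ?thesis by (simp add: closed_Int closed_subspace)
qed

text \<open>Off the closed set \<open>K\<close> the product is locally zero, so \<open>f\<close> may
  be arbitrary there. This turns chart expressions into globally smooth functions.\<close>

lemma smooth_funs_cutoff:
  assumes "\<eta> \<in> smooth_funs At" "closed K" "\<And>p. p \<notin> K \<Longrightarrow> \<eta> p = 0"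
    and "\<And>p. p \<in> K \<Longrightarrow> \<exists>c\<in>At. p \<in> chart_dom c \<and> smooth_at c f p"
  shows "(\<lambda>p. \<eta> p * f p) \<in> smooth_funs At"
proof (rule smooth_funsI)
  fix q
  show "\<exists>c\<in>At. q \<in> chart_dom c \<and> smooth_at c (\<lambda>p. \<eta> p * f p) q"
  proof (cases "q \<in> K")
    case True
    with assms(4) obtain c where "c \<in> At" "q \<in> chart_dom c" "smooth_at c f q" by blast
    then show ?thesis
      by (intro bexI[of _ c] conjI smooth_at_mult smooth_funs_smooth_at[OF assms(1)])
  next
    case False
    obtain c where "c \<in> At" "q \<in> chart_dom c" by (rule chart_cover)
    moreover have "smooth_at c (\<lambda>p. \<eta> p * f p) q"
      by (rule smooth_at_cong[OF \<open>c \<in> At\<close> smooth_at_const[of c 0], where W="- K"])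
        (use False assms(2,3) \<open>q \<in> chart_dom c\<close> in auto)
    ultimately show ?thesis by blast
  qed
qed

text \<open>A Euclidean bump function in a chart, extended by zero. The extension is smooth because
  \<open>K\<close>, the preimage of the quadrant part of a closed ball, is compact and hence closed
  in the Hausdorff space \<open>M\<close>.\<close>

lemma bump_function:
  assumes "open W" "q \<in> W"
  obtains \<eta> K where "\<eta> \<in> smooth_funs At" "\<eta> q = 1" "\<And>p. 0 \<le> \<eta> p" "closed K" "K \<subseteq> W"
    "\<And>p. p \<notin> K \<Longrightarrow> \<eta> p = 0"
proof -
  obtain c where c: "c \<in> At" "q \<in> chart_dom c" by (rule chart_cover)
  let ?Q = "quadrant N (chart_corner c)"
  obtain r where r: "r > 0"
    "\<And>y. y \<in> ?Q \<Longrightarrow> y \<in> cball (chart_map c q) r \<Longrightarrow>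
       \<exists>p. p \<in> chart_dom c \<and> p \<in> W \<and> chart_map c p = y \<and> chart_inv c y = p"
    using quadrant_ball[OF c assms] by blast
  obtain \<psi> :: "'e \<Rightarrow> real" where \<psi>: "\<And>k. Ck_on k \<psi> UNIV" "\<psi> (chart_map c q) = 1" "\<And>y. 0 \<le> \<psi> y"
    "\<And>y. y \<notin> cball (chart_map c q) r \<Longrightarrow> \<psi> y = 0"
    using euclidean_bump[OF r(1), of "chart_map c q"] by blast
  define K where "K = chart_inv c ` (?Q \<inter> cball (chart_map c q) r)"
  define \<eta> where "\<eta> p = (if p \<in> chart_dom c then \<psi> (chart_map c p) else 0)" for p
  have "compact K"
    unfolding K_def
  proof (rule compact_continuous_image)
    have "?Q \<inter> cball (chart_map c q) r \<subseteq> chart_map c ` chart_dom c" using r(2) by blast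
    then show "continuous_on (?Q \<inter> cball (chart_map c q) r) (chart_inv c)"
      using continuous_chart_inv[OF c(1)] continuous_on_subset by blast
    show "compact (?Q \<inter> cball (chart_map c q) r)"
      using closed_quadrant by (intro closed_Int_compact) auto
  qed
  then have K: "closed K" by (rule compact_imp_closed)
  have KW: "K \<subseteq> W \<inter> chart_dom c" unfolding K_def using r(2) by fastforce
  have \<eta>0: "\<eta> p = 0" if "p \<notin> K" for p
  proof (cases "p \<in> chart_dom c")
    case True
    then have "chart_map c p \<notin> cball (chart_map c q) r"
      using that chart_map_in_quadrant[OF c(1) True] chart_inv_map[OF c(1) True] unfolding K_def
      by (metis IntI image_eqI)
    then show ?thesis using \<psi>(4) by (simp add: \<eta>_def)
  qed (simp add: \<eta>_def)
  have "\<eta> \<in> smooth_funs At"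
  proof (rule smooth_funsI)
    fix p
    show "\<exists>c\<in>At. p \<in> chart_dom c \<and> smooth_at c \<eta> p"
    proof (cases "p \<in> chart_dom c")
      case True
      have "smooth_at c \<eta> p"
        by (rule smooth_at_cong[OF c(1) smooth_at_coordinate[OF c(1) open_UNIV UNIV_I \<psi>(1)] open_chart_dom[OF c(1)] True True])
          (simp add: \<eta>_def)
      then show ?thesis using c(1) True by blast
    next
      case False
      obtain d where d: "d \<in> At" "p \<in> chart_dom d" by (rule chart_cover)
      have "smooth_at d \<eta> p"
        by (rule smooth_at_cong[OF d(1) smooth_at_const[of d 0], where W="- K"])
          (use False KW K \<eta>0 d(2) in auto)
      then show ?thesis using d by blast
    qed
  qed
  moreover have "\<eta> q = 1" "\<And>p. 0 \<le> \<eta> p" using \<psi> c(2) by (auto simp: \<eta>_def)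
  ultimately show thesis using that K KW \<eta>0 by blast
qed

subsection \<open>Derivations\<close>

lemma tangent_lincomb:
  "v \<in> tangent_space At q \<Longrightarrow> f \<in> smooth_funs At \<Longrightarrow> h \<in> smooth_funs At \<Longrightarrow>
   v (\<lambda>p. a * f p + b * h p) = a * v f + b * v h"
  by (auto simp: tangent_space_def)

lemma tangent_mult:
  "v \<in> tangent_space At q \<Longrightarrow> f \<in> smooth_funs At \<Longrightarrow> h \<in> smooth_funs At \<Longrightarrow>
   v (\<lambda>p. f p * h p) = f q * v h + h q * v f"
  by (auto simp: tangent_space_def)

text \<open>The product rule for \<open>1 = 1 * 1\<close> gives \<open>v 1 = 0\<close>, and
  linearity gives the rest.\<close>

lemma tangent_const: "v \<in> tangent_space At q \<Longrightarrow> v (\<lambda>p. a) = 0"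
  using tangent_mult[of v q "\<lambda>p. 1" "\<lambda>p. 1"] tangent_lincomb[of v q "\<lambda>p. 1" "\<lambda>p. 1" a 0]
  by (simp add: smooth_funs_const)

lemma smooth_funs_sum:
  "(\<And>i. i \<in> I \<Longrightarrow> f i \<in> smooth_funs At) \<Longrightarrow> (\<lambda>p. \<Sum>i\<in>I. f i p) \<in> smooth_funs At"
  by (induction I rule: infinite_finite_induct) (auto intro: smooth_funs_const smooth_funs_add)

lemma tangent_sum:
  assumes "v \<in> tangent_space At q" "\<And>i. i \<in> I \<Longrightarrow> f i \<in> smooth_funs At"
  shows "v (\<lambda>p. \<Sum>i\<in>I. f i p) = (\<Sum>i\<in>I. v (f i))"
  using assms(2)
proof (induction I rule: infinite_finite_induct)
  case (insert x F)
  then show ?case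
    using tangent_lincomb[OF assms(1), of "f x" "\<lambda>p. \<Sum>i\<in>F. f i p" 1 1] smooth_funs_sum[of F f] by simp
qed (simp_all add: tangent_const[OF assms(1)])

text \<open>Hadamard's lemma writes \<open>u - u q\<close> near \<open>q\<close> as a sum of
  coordinates vanishing at \<open>q\<close> times coefficients. A derivation sees only the values of
  the coefficients at \<open>q\<close>, which are the partial derivatives. Directions outside
  \<open>N\<close> contribute nothing, since chart values lie in \<open>span N\<close>. In later
  use, \<open>v u \<noteq> 0\<close> forces some partial derivative along \<open>N\<close> to be
  nonzero.\<close>

lemma derivation_zero:
  assumes c: "c \<in> At" "q \<in> chart_dom c" and v: "v \<in> tangent_space At q" and u: "u \<in> smooth_funs At"
    and U: "open U" "chart_map c q \<in> U" "\<And>k. Ck_on k F U"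
      "\<And>p. p \<in> chart_dom c \<Longrightarrow> chart_map c p \<in> U \<Longrightarrow> F (chart_map c p) = u p"
    and zero: "\<And>b. b \<in> N \<Longrightarrow> frechet_derivative F (at (chart_map c q)) b = 0"
  shows "v u = 0"
proof -
  let ?y = "chart_map c q"
  obtain r where r: "r > 0" "ball ?y r \<subseteq> U" using U(1,2) by (meson open_contains_ball)
  obtain h where h: "\<And>b k. Ck_on k (h b) (ball ?y r)"
    "\<And>y. y \<in> ball ?y r \<Longrightarrow> F y = F ?y + (\<Sum>b\<in>Basis. ((y - ?y) \<bullet> b) * h b y)"
    "\<And>b. h b ?y = frechet_derivative F (at ?y) b"
    using Hadamard[OF Ck_on_subset[OF U(3) r(2)]] by blast
  let ?W = "{p \<in> chart_dom c. chart_map c p \<in> ball ?y r}"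
  have W: "open ?W" "q \<in> ?W" using open_chart_preimage[OF c(1) open_ball] c(2) r(1) by simp_all
  obtain \<eta> K where \<eta>: "\<eta> \<in> smooth_funs At" "\<eta> q = 1" "\<And>p. 0 \<le> \<eta> p" "closed K" "K \<subseteq> ?W"
    "\<And>p. p \<notin> K \<Longrightarrow> \<eta> p = 0"
    by (rule bump_function[OF W]) (rule that)
  \<comment> \<open>The rules for \<open>v\<close> concern globally smooth functions only, so
    coordinate and coefficient each receive a factor \<open>\<eta>\<close>, and their product
    carries the square of \<open>\<eta>\<close>.\<close>
  define X where "X b p = \<eta> p * ((chart_map c p - ?y) \<bullet> b)" for b p
  define G where "G b p = \<eta> p * h b (chart_map c p)" for b p
  have cut: "(\<lambda>p. \<eta> p * f (chart_map c p)) \<in> smooth_funs At" if "\<And>k. Ck_on k f (ball ?y r)" for f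
  proof (rule smooth_funs_cutoff[OF \<eta>(1,4)])
    show "\<eta> p = 0" if "p \<notin> K" for p using that by (rule \<eta>(6))
    fix p assume "p \<in> K"
    then have p: "p \<in> ?W" using \<eta>(5) by blast
    then have "smooth_at c (\<lambda>p. f (chart_map c p)) p"
      by (intro smooth_at_coordinate[OF c(1), of "ball ?y r"] that) auto
    then show "\<exists>d\<in>At. p \<in> chart_dom d \<and> smooth_at d (\<lambda>p. f (chart_map c p)) p"
      using c(1) p by blast
  qed
  have G: "G b \<in> smooth_funs At" for b unfolding G_def by (rule cut) (rule h)
  have "Ck_on k (\<lambda>y. (y + (- ?y)) \<bullet> b) (ball ?y r)" for b k
    by (intro Ck_on_bilinear[OF bounded_bilinear_inner] Ck_on_add Ck_on_const
        Ck_on_bounded_linear[OF bounded_linear_ident]) auto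
  then have X: "X b \<in> smooth_funs At" for b unfolding X_def by (intro cut) simp
  have vX: "v (\<lambda>p. X b p * G b p) = 0" if "b \<in> Basis" for b
  proof (cases "b \<in> N")
    case True
    have "v (\<lambda>p. X b p * G b p) = X b q * v (G b) + G b q * v (X b)"
      by (rule tangent_mult[OF v X G])
    then show ?thesis using zero[OF True] by (simp add: X_def G_def h(3))
  next
    case False
    have "(\<lambda>p. X b p * G b p) = (\<lambda>p. 0)"
    proof
      fix p
      show "X b p * G b p = 0"
      proof (cases "p \<in> K")
        case True
        then have "chart_map c p - ?y \<in> span N"
          using \<eta>(5) chart_map_in_quadrant[OF c(1)] c(2)
          by (auto simp: quadrant_def intro!: span_diff)
        moreover have "b \<bullet> a = 0" if "a \<in> N" for a
          using that False N_Basis \<open>b \<in> Basis\<close> by (auto simp: inner_Basis)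
        ultimately have "(chart_map c p - ?y) \<bullet> b = 0"
          using orthogonal_to_span[of "chart_map c p - ?y" N b] by (auto simp: orthogonal_def inner_commute)
        then show ?thesis by (simp add: X_def)
      qed (simp add: X_def \<eta>(6))
    qed
    then show ?thesis using tangent_const[OF v] by simp
  qed
  \<comment> \<open>Since \<open>w q = 0\<close> and \<open>\<eta> q = 1\<close>, multiplying
    \<open>w\<close> by the square of \<open>\<eta>\<close> does not change its value under
    \<open>v\<close>.\<close>
  define w where "w p = u p + (- u q)" for p
  have w: "w \<in> smooth_funs At" unfolding w_def by (intro smooth_funs_add u smooth_funs_const)
  have "(\<lambda>p. (\<eta> p * \<eta> p) * w p) = (\<lambda>p. \<Sum>b\<in>Basis. X b p * G b p)"
  proof
    fix p
    show "(\<eta> p * \<eta> p) * w p = (\<Sum>b\<in>Basis. X b p * G b p)"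
    proof (cases "p \<in> K")
      case True
      then have p: "p \<in> chart_dom c" "chart_map c p \<in> ball ?y r" using \<eta>(5) by auto
      have "u q = F ?y" using U c(2) by simp
      moreover have "u p = F (chart_map c p)" using U(4)[OF p(1)] p(2) r(2) by auto
      ultimately have "w p = (\<Sum>b\<in>Basis. ((chart_map c p - ?y) \<bullet> b) * h b (chart_map c p))"
        using h(2)[OF p(2)] by (simp add: w_def)
      then show ?thesis by (simp add: X_def G_def sum_distrib_left mult_ac)
    qed (simp add: X_def \<eta>(6))
  qed
  moreover have "v (\<lambda>p. \<Sum>b\<in>Basis. X b p * G b p) = 0"
    by (subst tangent_sum[OF v]) (auto intro: smooth_funs_mult X G simp: vX)
  moreover have "v (\<lambda>p. (\<eta> p * \<eta> p) * w p) = v w"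
    using tangent_mult[OF v smooth_funs_mult[OF \<eta>(1) \<eta>(1)] w] \<eta>(2) by (simp add: w_def)
  moreover have "v w = v u"
    using tangent_lincomb[OF v u smooth_funs_const, of 1 1 "- u q"] tangent_const[OF v]
    unfolding w_def by simp
  ultimately show ?thesis by simp
qed

end

lemma Ck_on_line_derivative:
  assumes "\<And>k. Ck_on k F U" "open U" "y + s *\<^sub>R b \<in> U"
  shows "((\<lambda>t. F (y + t *\<^sub>R b)) has_real_derivative frechet_derivative F (at (y + s *\<^sub>R b)) b) (at s)"
proof -
  note F' = Ck_on_has_derivative[OF assms(1,2,3)]
  have "((\<lambda>t. y + t *\<^sub>R b) has_derivative (\<lambda>t. t *\<^sub>R b)) (at s)"
    by (auto intro!: derivative_eq_intros)
  from has_derivative_compose[OF this F'] show ?thesis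
    by (simp add: has_field_derivative_def linear_scale[OF has_derivative_linear[OF F']] mult_commute_abs)
qed

text \<open>Sliding a point towards a hyperplane, without crossing it, takes it no farther from a
  centre on that hyperplane. This keeps normal segments inside balls around a boundary
  point.\<close>

lemma norm_diff_scaleR_le:
  fixes z b :: "'a::real_inner"
  assumes "norm b = 1" "0 \<le> a" "a \<le> z \<bullet> b"
  shows "norm (z - a *\<^sub>R b) \<le> norm z"
proof -
  have "(norm (z - a *\<^sub>R b))\<^sup>2 = (norm z)\<^sup>2 - 2 * a * (z \<bullet> b) + a * a"
    using assms(1) by (simp add: power2_norm_eq_inner norm_eq_1 inner_diff inner_commute algebra_simps)
  also have "\<dots> \<le> (norm z)\<^sup>2"
    using mult_left_mono[OF assms(3,2)] mult_nonneg_nonneg[OF assms(2) order_trans[OF assms(2,3)]] by linarith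
  finally show ?thesis by (rule power2_le_imp_le) simp
qed

subsection \<open>Hyperfaces\<close>

locale corner_manifold = corner_atlas +
  assumes hyperface_defining: "\<And>H. H \<in> hyperfaces At \<Longrightarrow> \<exists>x. defining_function At H x"
begin

lemma local_extension:
  assumes c: "c \<in> At" "q \<in> chart_dom c" and f: "f \<in> smooth_funs At"
  obtains r F where "r > 0" "\<And>k. Ck_on k F (ball (chart_map c q) r)"
    "\<And>y. y \<in> quadrant N (chart_corner c) \<Longrightarrow> y \<in> ball (chart_map c q) r \<Longrightarrow>
      chart_inv c y \<in> chart_dom c \<and> chart_map c (chart_inv c y) = y \<and> F y = f (chart_inv c y)"
proof -
  obtain U F where U: "open U" "chart_map c q \<in> U" "\<And>k. Ck_on k F U"
    "\<And>p. p \<in> chart_dom c \<Longrightarrow> chart_map c p \<in> U \<Longrightarrow> F (chart_map c p) = f p"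
    using smooth_funs_smooth_at[OF f c] by (rule smooth_atE) (rule that)
  obtain r where r: "r > 0" "\<And>y. y \<in> quadrant N (chart_corner c) \<Longrightarrow> y \<in> cball (chart_map c q) r \<Longrightarrow>
       \<exists>p. p \<in> chart_dom c \<and> p \<in> UNIV \<and> chart_map c p = y \<and> chart_inv c y = p"
    by (rule quadrant_ball[OF c open_UNIV UNIV_I]) (rule that)
  obtain s where s: "s > 0" "ball (chart_map c q) s \<subseteq> U" using U(1,2) by (meson open_contains_ball)
  show thesis
  proof (rule that[of "min r s" F])
    show "min r s > 0" using r s by simp
    show "Ck_on k F (ball (chart_map c q) (min r s))" for k
      by (rule Ck_on_subset[OF U(3)]) (use s in auto)
    fix y assume y: "y \<in> quadrant N (chart_corner c)" "y \<in> ball (chart_map c q) (min r s)"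
    then obtain p where p: "p \<in> chart_dom c" "chart_map c p = y" "chart_inv c y = p"
      using r(2)[of y] by auto
    moreover have "y \<in> U" using y(2) s(2) by auto
    ultimately show "chart_inv c y \<in> chart_dom c \<and> chart_map c (chart_inv c y) = y \<and> F y = f (chart_inv c y)"
      using U(4)[of p] by simp
  qed
qed

lemma chart_direction:
  assumes "c \<in> At" "b \<in> N" "b' \<in> chart_corner c"
  shows "b \<bullet> b' = (if b = b' then 1 else 0)"
  using assms corner_subset[OF assms(1)] N_Basis by (auto simp: inner_Basis subset_iff)

text \<open>Without an active constraint one can move a little both ways along every direction of
  \<open>N\<close>, so the zero of \<open>x \<ge> 0\<close> at \<open>q\<close> is a local minimum
  on each such line. All partial derivatives along \<open>N\<close> vanish, and every derivation at
  \<open>q\<close> kills \<open>x\<close>, contrary to \<open>dx \<noteq> 0\<close> on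
  \<open>H\<close>.\<close>

lemma hyperface_active:
  assumes c: "c \<in> At" "q \<in> chart_dom c" and x: "defining_function At H x" and q: "q \<in> H"
  shows "\<exists>b\<in>chart_corner c. chart_map c q \<bullet> b = 0"
proof (rule ccontr)
  let ?y = "chart_map c q"
  assume "\<not> ?thesis"
  moreover have y: "?y \<in> quadrant N (chart_corner c)" by (rule chart_map_in_quadrant[OF c])
  ultimately have pos: "0 < ?y \<bullet> b" if "b \<in> chart_corner c" for b
    using that by (force simp: quadrant_def less_le)
  have xs: "x \<in> smooth_funs At" and x0: "\<And>p. 0 \<le> x p" and xq: "x q = 0"
    using x q by (auto simp: defining_function_def)
  obtain v where v: "v \<in> tangent_space At q" "v x \<noteq> 0"
    using x q by (auto simp: defining_function_def)
  obtain r F where r: "r > 0" and F: "\<And>k. Ck_on k F (ball ?y r)"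
    and loc: "\<And>y. y \<in> quadrant N (chart_corner c) \<Longrightarrow> y \<in> ball ?y r \<Longrightarrow>
      chart_inv c y \<in> chart_dom c \<and> chart_map c (chart_inv c y) = y \<and> F y = x (chart_inv c y)"
    by (rule local_extension[OF c xs]) (rule that)
  have "v x = 0"
  proof (rule derivation_zero[OF c v(1) xs open_ball _ F])
    show "?y \<in> ball ?y r" using r by simp
    fix p assume "p \<in> chart_dom c" "chart_map c p \<in> ball ?y r"
    then show "F (chart_map c p) = x p"
      using loc[OF chart_map_in_quadrant[OF c(1)]] chart_inv_map[OF c(1)] by metis
  next
    fix b assume b: "b \<in> N"
    \<comment> \<open>A shift by less than \<open>d\<close> along a direction of \<open>N\<close>
      keeps the constrained coordinates nonnegative and the point in the ball on which
      \<open>F\<close> represents \<open>x\<close>.\<close>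
    define d where "d = Min (insert r ((\<lambda>b. ?y \<bullet> b) ` chart_corner c))"
    have d: "0 < d" "d \<le> r" "\<And>b. b \<in> chart_corner c \<Longrightarrow> d \<le> ?y \<bullet> b"
      unfolding d_def using r pos finite_corner[OF c(1)] by auto
    have "((\<lambda>t. F (?y + t *\<^sub>R b)) has_real_derivative frechet_derivative F (at (?y + 0 *\<^sub>R b)) b) (at 0)"
      by (rule Ck_on_line_derivative[OF F open_ball]) (use r in simp)
    then have "frechet_derivative F (at (?y + 0 *\<^sub>R b)) b = 0"
    proof (rule DERIV_local_min[OF _ d(1)], intro allI impI)
      fix t :: real assume t: "\<bar>0 - t\<bar> < d"
      have nb: "norm b = 1" using b N_Basis by auto
      have "?y + t *\<^sub>R b \<in> quadrant N (chart_corner c)"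
        using y b d(3) t chart_direction[OF c(1) b]
        by (fastforce simp: quadrant_def inner_add_left intro: span_add span_scale span_base)
      moreover have "?y + t *\<^sub>R b \<in> ball ?y r" using t d(2) nb by (simp add: dist_norm)
      ultimately have "F (?y + t *\<^sub>R b) = x (chart_inv c (?y + t *\<^sub>R b))" using loc by blast
      moreover have "F ?y = 0" using loc[OF y] r chart_inv_map[OF c] xq by simp
      ultimately show "F (?y + 0 *\<^sub>R b) \<le> F (?y + t *\<^sub>R b)" using x0 by simp
    qed
    then show "frechet_derivative F (at ?y) b = 0" by simp
  qed
  with v(2) show False by simp
qed

text \<open>The points near \<open>q\<close> at which \<open>b\<^sub>0\<close> is the only active direction form a convex set in the chart,
  so they lie in a single component of the codimension one stratum.\<close>

lemma active_hyperface:
  assumes c: "c \<in> At" "q \<in> chart_dom c" and b0: "b0 \<in> chart_corner c" "chart_map c q \<bullet> b0 = 0"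
  obtains H r where "H \<in> hyperfaces At" "r > 0"
    "\<And>y. y \<in> quadrant N (chart_corner c) \<Longrightarrow> y \<in> ball (chart_map c q) r \<Longrightarrow> y \<bullet> b0 = 0 \<Longrightarrow> chart_inv c y \<in> H"
proof -
  let ?y = "chart_map c q" and ?K = "chart_corner c"
  let ?Q = "quadrant N ?K"
  obtain r where r: "r > 0" "\<And>y. y \<in> ?Q \<Longrightarrow> y \<in> cball ?y r \<Longrightarrow>
       \<exists>p. p \<in> chart_dom c \<and> p \<in> UNIV \<and> chart_map c p = y \<and> chart_inv c y = p"
    by (rule quadrant_ball[OF c open_UNIV UNIV_I]) (rule that)
  \<comment> \<open>Moving along \<open>e\<close> increases every constrained coordinate except that
    of \<open>b0\<close>, which stays unchanged. This will show that \<open>P\<close> is dense in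
    the part of the ball that lies on the hyperplane of \<open>b0\<close> in the quadrant.\<close>
  define e where "e = (\<Sum>b\<in>?K - {b0}. b)"
  have KN: "?K \<subseteq> N" by (rule corner_subset[OF c(1)])
  have e_inner: "e \<bullet> b = (if b = b0 then 0 else 1)" if "b \<in> ?K" for b
  proof -
    have "e \<bullet> b = (\<Sum>a\<in>?K - {b0}. if a = b then 1 else 0)"
      unfolding e_def inner_sum_left
      by (rule sum.cong) (use chart_direction[OF c(1) _ that] KN in auto)
    then show ?thesis using that finite_corner[OF c(1)] by simp
  qed
  have e_span: "e \<in> span N" unfolding e_def using KN by (intro span_sum span_base) auto
  define P where "P = {y \<in> ?Q \<inter> ball ?y r. y \<bullet> b0 = 0 \<and> (\<forall>b\<in>?K - {b0}. 0 < y \<bullet> b)}"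
  have "0 \<le> y \<bullet> b" if "\<forall>b\<in>?K - {b0}. 0 < y \<bullet> b" "y \<bullet> b0 = 0" "b \<in> ?K" for y b
    using that by (cases "b = b0") (auto intro: less_imp_le)
  then have "P = span N \<inter> ball ?y r \<inter> {y. b0 \<bullet> y = 0} \<inter> (\<Inter>b\<in>?K - {b0}. {y. 0 < b \<bullet> y})"
    unfolding P_def quadrant_def by (auto simp: inner_commute)
  moreover have "convex (\<Inter>b\<in>?K - {b0}. {y. 0 < b \<bullet> y})"
    using convex_halfspace_gt[of 0] by (intro convex_INT) simp
  ultimately have "convex P"
    by (simp add: convex_Int subspace_imp_convex convex_hyperplane)
  have inP: "\<exists>y'\<in>P. dist y' y < \<epsilon>" if "y \<in> ?Q" "y \<in> ball ?y r" "y \<bullet> b0 = 0" "\<epsilon> > 0" for y \<epsilon>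
  proof
    define m where "m = min \<epsilon> (r - dist ?y y)"
    \<comment> \<open>The displacement \<open>t e\<close> has norm below \<open>m\<close>; the
      \<open>+ 1\<close> covers \<open>e = 0\<close>, which occurs if \<open>b0\<close> is the only
      constraint.\<close>
    define t where "t = m / (2 * (norm e + 1))"
    have m: "m > 0" "m \<le> \<epsilon>" "m \<le> r - dist ?y y" using that by (auto simp: m_def)
    have t: "t > 0" unfolding t_def using m by (intro divide_pos_pos) (auto simp: add_nonneg_pos)
    have "t * norm e \<le> t * (norm e + 1)" using t by simp
    also have "\<dots> = m / 2"
      using norm_ge_zero[of e] by (simp add: t_def field_simps add_nonneg_eq_0_iff)
    finally have te: "norm (t *\<^sub>R e) < m" using t m by simp
    show "dist (y + t *\<^sub>R e) y < \<epsilon>" using te m(2) by (simp add: dist_norm)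
    have "dist ?y (y + t *\<^sub>R e) \<le> dist ?y y + norm (t *\<^sub>R e)"
      using dist_triangle[of ?y "y + t *\<^sub>R e" y] by (simp add: dist_norm)
    then have "y + t *\<^sub>R e \<in> ball ?y r" using te m(3) by simp
    moreover have "y + t *\<^sub>R e \<in> ?Q" "0 < (y + t *\<^sub>R e) \<bullet> b" if "b \<in> ?K - {b0}" for b
      using that \<open>y \<in> ?Q\<close> e_inner e_span t
      by (auto simp: quadrant_def inner_add_left intro!: span_add span_scale add_nonneg_pos)
    moreover have "y + t *\<^sub>R e \<in> ?Q"
      using \<open>y \<in> ?Q\<close> e_inner e_span t
      by (auto simp: quadrant_def inner_add_left intro!: span_add span_scale)
    moreover have "(y + t *\<^sub>R e) \<bullet> b0 = 0" using that(3) e_inner[OF b0(1)] by (simp add: inner_add_left)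
    ultimately show "y + t *\<^sub>R e \<in> P" unfolding P_def by blast
  qed
  have yQ: "?y \<in> ?Q" by (rule chart_map_in_quadrant[OF c])
  have cont: "continuous_on (?Q \<inter> cball ?y r) (chart_inv c)"
  proof (rule continuous_on_subset[OF continuous_chart_inv[OF c(1)]])
    show "?Q \<inter> cball ?y r \<subseteq> chart_map c ` chart_dom c"
    proof
      fix y assume "y \<in> ?Q \<inter> cball ?y r"
      then obtain p where "p \<in> chart_dom c" "chart_map c p = y" using r(2)[of y] by blast
      then show "y \<in> chart_map c ` chart_dom c" by blast
    qed
  qed
  have Psub: "P \<subseteq> ?Q \<inter> cball ?y r" unfolding P_def by auto
  have "connected (chart_inv c ` P)"
    by (intro connected_continuous_image continuous_on_subset[OF cont Psub] convex_connected \<open>convex P\<close>)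
  moreover have "chart_inv c ` P \<subseteq> depth_stratum At 1"
  proof
    fix p assume "p \<in> chart_inv c ` P"
    then obtain y where y: "p = chart_inv c y" "y \<in> P" by (rule imageE)
    then have "y \<in> ?Q" "y \<in> cball ?y r" using Psub by auto
    from r(2)[OF this] y(1) have p: "p \<in> chart_dom c" "chart_map c p = y" by auto
    have "{b \<in> ?K. y \<bullet> b = 0} = {b0}" using y(2) b0(1) unfolding P_def by force
    then show "p \<in> depth_stratum At 1"
      unfolding depth_stratum_def using c(1) p by (auto intro!: bexI[of _ c])
  qed
  moreover have "chart_inv c ` P \<noteq> {}" using inP[OF yQ _ b0(2), of 1] r(1) by auto
  ultimately obtain S where S: "S \<in> components (depth_stratum At 1)" "chart_inv c ` P \<subseteq> S"
    using exists_component_superset[of "chart_inv c ` P" "depth_stratum At 1"] by blast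
  have clP: "closure P \<subseteq> ?Q \<inter> cball ?y r"
    by (rule closure_minimal[OF Psub]) (intro closed_Int closed_quadrant closed_cball)
  \<comment> \<open>Points with further active directions lie outside the stratum. They are reached
    as limits of \<open>P\<close>, since \<open>chart_inv c\<close> is continuous on
    \<open>closure P\<close>.\<close>
  have "chart_inv c ` closure P \<subseteq> closure S"
    by (rule image_closure_subset[OF continuous_on_subset[OF cont clP]])
      (use S(2) closure_subset in auto)
  moreover have "y \<in> closure P" if "y \<in> ?Q" "y \<in> ball ?y r" "y \<bullet> b0 = 0" for y
    using inP[OF that] by (simp add: closure_approachable)
  ultimately show thesis
    using S(1) r(1) by (intro that[of "closure S" r]) (auto simp: faces_of_codim_def)
qed

lemma boundary_iff:
  assumes c: "c \<in> At" "q \<in> chart_dom c"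
  shows "q \<in> mfd_boundary At \<longleftrightarrow> (\<exists>b\<in>chart_corner c. chart_map c q \<bullet> b = 0)"
proof
  assume "q \<in> mfd_boundary At"
  then obtain H where "H \<in> hyperfaces At" "q \<in> H" by (auto simp: mfd_boundary_def)
  then show "\<exists>b\<in>chart_corner c. chart_map c q \<bullet> b = 0"
    using hyperface_defining hyperface_active[OF c] by metis
next
  assume "\<exists>b\<in>chart_corner c. chart_map c q \<bullet> b = 0"
  then obtain b where b: "b \<in> chart_corner c" "chart_map c q \<bullet> b = 0" by blast
  obtain H r where H: "H \<in> hyperfaces At" "r > 0"
    "\<And>y. y \<in> quadrant N (chart_corner c) \<Longrightarrow> y \<in> ball (chart_map c q) r \<Longrightarrow> y \<bullet> b = 0 \<Longrightarrow> chart_inv c y \<in> H"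
    by (rule active_hyperface[OF c b]) (rule that)
  from H(3)[OF chart_map_in_quadrant[OF c]] have "q \<in> H" using H(2) b(2) chart_inv_map[OF c] by simp
  with H(1) show "q \<in> mfd_boundary At" by (auto simp: mfd_boundary_def)
qed

lemma interior_iff:
  assumes "c \<in> At" "q \<in> chart_dom c"
  shows "q \<in> mfd_interior At \<longleftrightarrow> (\<forall>b\<in>chart_corner c. 0 < chart_map c q \<bullet> b)"
  using boundary_iff[OF assms] chart_map_in_quadrant[OF assms]
  by (force simp: mfd_interior_def quadrant_def less_le)

text \<open>A substitute for dividing \<open>f\<close> by \<open>u\<close>. Let \<open>s\<close> be
  the coordinate in the direction \<open>b0\<close> normal to \<open>H\<close>. Near
  \<open>q\<close> the derivative of \<open>u\<close> along \<open>b0\<close> is bounded below by a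
  positive constant and that of \<open>f\<close> is bounded, and both functions vanish at
  \<open>s = 0\<close>. By the mean value theorem \<open>u\<close> is at least, and the absolute
  value of \<open>f\<close> at most, a multiple of \<open>s\<close>.\<close>

lemma hyperface_estimate:
  assumes "q \<in> mfd_boundary At"
  obtains H u where "H \<in> hyperfaces At" "defining_function At H u" "u q = 0"
    "\<And>f. f \<in> smooth_funs At \<Longrightarrow> \<forall>p\<in>H. f p = 0 \<Longrightarrow>
       \<exists>W C. open W \<and> q \<in> W \<and> (\<forall>p\<in>W. \<bar>f p\<bar> \<le> C * u p)"
proof -
  obtain c where c: "c \<in> At" "q \<in> chart_dom c" by (rule chart_cover)
  let ?y = "chart_map c q" and ?K = "chart_corner c"
  let ?Q = "quadrant N ?K"
  obtain b0 where b0: "b0 \<in> ?K" "?y \<bullet> b0 = 0" using assms boundary_iff[OF c] by blast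
  have b0N: "b0 \<in> N" using b0(1) corner_subset[OF c(1)] by blast
  have nb: "norm b = 1" if "b \<in> N" for b using that N_Basis by auto
  obtain H r0 where H: "H \<in> hyperfaces At" and r0: "r0 > 0"
    "\<And>y. y \<in> ?Q \<Longrightarrow> y \<in> ball ?y r0 \<Longrightarrow> y \<bullet> b0 = 0 \<Longrightarrow> chart_inv c y \<in> H"
    by (rule active_hyperface[OF c b0]) (rule that)
  obtain u where u: "defining_function At H u" using hyperface_defining[OF H] by blast
  have us: "u \<in> smooth_funs At" and u0: "\<And>p. 0 \<le> u p" and uH: "\<And>p. p \<in> H \<longleftrightarrow> u p = 0"
    using u by (auto simp: defining_function_def)
  have yQ: "?y \<in> ?Q" by (rule chart_map_in_quadrant[OF c])
  have qH: "q \<in> H" using r0(2)[OF yQ] r0(1) b0(2) chart_inv_map[OF c] by simp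
  obtain v where v: "v \<in> tangent_space At q" "v u \<noteq> 0"
    using u qH by (auto simp: defining_function_def)
  obtain r1 U where r1: "r1 > 0" and U: "\<And>k. Ck_on k U (ball ?y r1)"
    and Uu: "\<And>y. y \<in> ?Q \<Longrightarrow> y \<in> ball ?y r1 \<Longrightarrow>
      chart_inv c y \<in> chart_dom c \<and> chart_map c (chart_inv c y) = y \<and> U y = u (chart_inv c y)"
    by (rule local_extension[OF c us]) (rule that)
  have Uy: "U ?y = 0" using Uu[OF yQ] r1 chart_inv_map[OF c] qH uH by simp
  have D: "((\<lambda>t. U (?y + t *\<^sub>R b)) has_real_derivative frechet_derivative U (at ?y) b) (at 0)" for b
    using Ck_on_line_derivative[OF U open_ball, of ?y 0 b] r1 by simp
  have fwd: "?y + t *\<^sub>R b \<in> ?Q" if "b \<in> N" "0 \<le> t" for b t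
    unfolding quadrant_def
  proof (intro CollectI conjI ballI)
    show "?y + t *\<^sub>R b \<in> span N"
      using yQ that(1) by (auto simp: quadrant_def intro: span_add span_scale span_base)
    show "0 \<le> (?y + t *\<^sub>R b) \<bullet> b'" if "b' \<in> ?K" for b'
      using chart_direction[OF c(1) \<open>b \<in> N\<close> that] yQ that \<open>0 \<le> t\<close>
      by (auto simp: quadrant_def inner_add_left)
  qed
  have inb: "?y + t *\<^sub>R b \<in> ball ?y r" if "b \<in> N" "0 \<le> t" "t < r" for b t r
    using that nb[OF that(1)] by (simp add: dist_norm)
  \<comment> \<open>Moving forward along any direction of \<open>N\<close> stays in the quadrant,
    and \<open>u \<ge> 0\<close> with \<open>u q = 0\<close>.\<close>
  have nonneg: "0 \<le> frechet_derivative U (at ?y) b" if b: "b \<in> N" for b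
  proof (rule ccontr)
    assume "\<not> 0 \<le> frechet_derivative U (at ?y) b"
    then obtain d where d: "d > 0" "\<And>h. 0 < h \<Longrightarrow> h < d \<Longrightarrow> U (?y + (0 + h) *\<^sub>R b) < U (?y + 0 *\<^sub>R b)"
      using DERIV_neg_dec_right[OF D, of b] by (auto simp: not_le)
    define h where "h = min d r1 / 2"
    have h: "0 < h" "h < d" "h < r1" using d(1) r1 by (auto simp: h_def)
    have "U (?y + h *\<^sub>R b) < 0" using d(2)[OF h(1,2)] Uy by simp
    moreover have "U (?y + h *\<^sub>R b) = u (chart_inv c (?y + h *\<^sub>R b))"
      using Uu[OF fwd[OF b] inb[OF b]] h by simp
    ultimately show False using u0 by (metis not_le)
  qed
  \<comment> \<open>Moving along \<open>b \<noteq> b0\<close> stays on the hyperplane of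
    \<open>b0\<close>, hence in \<open>H\<close>, where \<open>u\<close> vanishes.\<close>
  have nonpos: "frechet_derivative U (at ?y) b \<le> 0" if b: "b \<in> N" "b \<noteq> b0" for b
  proof (rule ccontr)
    assume "\<not> frechet_derivative U (at ?y) b \<le> 0"
    then obtain d where d: "d > 0" "\<And>h. 0 < h \<Longrightarrow> h < d \<Longrightarrow> U (?y + 0 *\<^sub>R b) < U (?y + (0 + h) *\<^sub>R b)"
      using DERIV_pos_inc_right[OF D, of b] by (auto simp: not_le)
    define h where "h = min d (min r0 r1) / 2"
    have h: "0 < h" "h < d" "h < r1" "h < r0" using d(1) r1 r0(1) by (auto simp: h_def)
    have "0 < U (?y + h *\<^sub>R b)" using d(2)[OF h(1,2)] Uy by simp
    moreover have "U (?y + h *\<^sub>R b) = u (chart_inv c (?y + h *\<^sub>R b))"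
      using Uu[OF fwd[OF b(1)] inb[OF b(1)]] h by simp
    moreover have "(?y + h *\<^sub>R b) \<bullet> b0 = 0"
      using b0(2) chart_direction[OF c(1) b(1) b0(1)] b(2) by (simp add: inner_add_left)
    then have "chart_inv c (?y + h *\<^sub>R b) \<in> H"
      using r0(2)[OF fwd[OF b(1)] inb[OF b(1)]] h by simp
    ultimately show False using uH by simp
  qed
  define l where "l = frechet_derivative U (at ?y) b0"
  \<comment> \<open>If the normal derivative vanished, so would all derivatives along
    \<open>N\<close>, and no tangent vector at \<open>q\<close> could detect
    \<open>u\<close>.\<close>
  have "l \<noteq> 0"
  proof
    assume l0: "l = 0"
    have "v u = 0"
    proof (rule derivation_zero[OF c v(1) us open_ball _ U])
      show "?y \<in> ball ?y r1" using r1 by simp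
      fix p assume "p \<in> chart_dom c" "chart_map c p \<in> ball ?y r1"
      then show "U (chart_map c p) = u p"
        using Uu[OF chart_map_in_quadrant[OF c(1)]] chart_inv_map[OF c(1)] by metis
    next
      fix b assume "b \<in> N"
      then show "frechet_derivative U (at ?y) b = 0"
        using nonneg[of b] nonpos[of b] l0 by (cases "b = b0") (auto simp: l_def)
    qed
    with v(2) show False by simp
  qed
  with nonneg[OF b0N] have l: "l > 0" by (simp add: l_def)
  have near: "\<exists>r>0. r \<le> \<rho> \<and> (\<forall>y\<in>ball ?y r. \<bar>frechet_derivative F (at y) b0 - frechet_derivative F (at ?y) b0\<bar> < \<delta>)"
    if F: "\<And>k. Ck_on k F (ball ?y \<rho>)" and pos: "\<rho> > 0" "\<delta> > 0" for F :: "'a \<Rightarrow> real" and \<rho> \<delta> :: real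
  proof -
    have "continuous_on (ball ?y \<rho>) (\<lambda>x. frechet_derivative F (at x) b0)" using F[of 1] by simp
    then obtain d where d: "d > 0" "\<And>y. y \<in> ball ?y \<rho> \<Longrightarrow> dist y ?y < d \<Longrightarrow>
        dist (frechet_derivative F (at y) b0) (frechet_derivative F (at ?y) b0) < \<delta>"
      using pos unfolding continuous_on_iff by (metis centre_in_ball)
    show ?thesis
      by (rule exI[of _ "min d \<rho>"]) (use d pos in \<open>auto simp: dist_real_def dist_commute\<close>)
  qed
  \<comment> \<open>The tolerance \<open>l / 2\<close> leaves \<open>l / 2\<close> as a lower bound
    for the normal derivative; hence the factor \<open>2 / l\<close> in the final constant.\<close>
  obtain r2 where r2: "r2 > 0" "r2 \<le> r1"
    "\<And>y. y \<in> ball ?y r2 \<Longrightarrow> \<bar>frechet_derivative U (at y) b0 - l\<bar> < l / 2"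
    using near[OF U r1, of "l / 2"] l unfolding l_def by auto
  show thesis
  proof (rule that[OF H u])
    show "u q = 0" using uH qH by simp
    fix f assume fs: "f \<in> smooth_funs At" and fH: "\<forall>p\<in>H. f p = 0"
    obtain r3 F where r3: "r3 > 0" and F: "\<And>k. Ck_on k F (ball ?y r3)"
      and Ff: "\<And>y. y \<in> ?Q \<Longrightarrow> y \<in> ball ?y r3 \<Longrightarrow>
        chart_inv c y \<in> chart_dom c \<and> chart_map c (chart_inv c y) = y \<and> F y = f (chart_inv c y)"
      by (rule local_extension[OF c fs]) (rule that)
    obtain r4 where r4: "r4 > 0" "r4 \<le> r3"
      "\<And>y. y \<in> ball ?y r4 \<Longrightarrow> \<bar>frechet_derivative F (at y) b0 - frechet_derivative F (at ?y) b0\<bar> < 1"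
      using near[OF F r3, of 1] by auto
    define C where "C = \<bar>frechet_derivative F (at ?y) b0\<bar> + 1"
    define r where "r = min r0 (min r2 r4)"
    have r: "r > 0" "r \<le> r0" "r \<le> r1" "r \<le> r2" "r \<le> r3" "r \<le> r4"
      using r0(1) r2 r4 by (auto simp: r_def)
    let ?W = "{p \<in> chart_dom c. chart_map c p \<in> ball ?y r}"
    have "\<bar>f p\<bar> \<le> (2 * C / l) * u p" if p: "p \<in> ?W" for p
    proof -
      define y where "y = chart_map c p"
      define s where "s = y \<bullet> b0"
      \<comment> \<open>\<open>z\<close> is the foot of the perpendicular from \<open>y\<close> to
        the hyperplane. It represents a point of \<open>H\<close>, so the extensions of
        \<open>u\<close> and \<open>f\<close> vanish there, and the segment up to \<open>y\<close>
        stays in the ball.\<close>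
      define z where "z = y - s *\<^sub>R b0"
      have pc: "p \<in> chart_dom c" and yb: "y \<in> ball ?y r" using p by (auto simp: y_def)
      have yQ': "y \<in> ?Q" unfolding y_def by (rule chart_map_in_quadrant[OF c(1) pc])
      have py: "chart_inv c y = p" unfolding y_def by (rule chart_inv_map[OF c(1) pc])
      have s: "0 \<le> s" using yQ' b0(1) by (auto simp: quadrant_def s_def)
      have zQ: "z \<in> ?Q" "z \<bullet> b0 = 0"
      proof -
        have "z \<bullet> b = (if b = b0 then 0 else y \<bullet> b)" if "b \<in> ?K" for b
          using chart_direction[OF c(1) b0N that] by (simp add: z_def inner_diff_left s_def)
        then show "z \<in> ?Q" "z \<bullet> b0 = 0"
          using yQ' b0N b0(1) by (auto simp: quadrant_def z_def intro: span_diff span_scale span_base)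
      qed
      have seg: "z + t *\<^sub>R b0 \<in> ball ?y r" if "0 \<le> t" "t \<le> s" for t
      proof -
        have "norm ((y - ?y) - (s - t) *\<^sub>R b0) \<le> norm (y - ?y)"
          by (rule norm_diff_scaleR_le) (use nb[OF b0N] that b0(2) in \<open>auto simp: s_def inner_diff_left\<close>)
        moreover have "(y - ?y) - (s - t) *\<^sub>R b0 = (z + t *\<^sub>R b0) - ?y"
          by (simp add: z_def algebra_simps)
        ultimately show ?thesis using yb by (simp add: dist_norm norm_minus_commute)
      qed
      have zb: "z \<in> ball ?y r" using seg[of 0] s by simp
      have zH: "chart_inv c z \<in> H" using r0(2)[OF zQ(1) _ zQ(2)] zb r(2) by auto
      have MVT: "\<exists>t\<in>{0..s}. G y = s * frechet_derivative G (at (z + t *\<^sub>R b0)) b0"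
        if G: "\<And>k. Ck_on k G (ball ?y \<rho>)" "r \<le> \<rho>" "G z = 0" for G :: "'a \<Rightarrow> real" and \<rho>
      proof (cases "s = 0")
        case True
        then show ?thesis using G(3) by (auto simp: z_def)
      next
        case False
        then have "\<exists>t>0. t < s \<and> G (z + s *\<^sub>R b0) - G (z + 0 *\<^sub>R b0) =
            (s - 0) * frechet_derivative G (at (z + t *\<^sub>R b0)) b0"
          using s seg G(2) by (intro MVT2 Ck_on_line_derivative[OF G(1) open_ball]) fastforce+
        then show ?thesis using G(3) by (auto simp: z_def)
      qed
      have "U z = 0" using Uu[OF zQ(1)] zb r(3) zH uH by auto
      then obtain t where t: "t \<in> {0..s}" "U y = s * frechet_derivative U (at (z + t *\<^sub>R b0)) b0"
        using MVT[OF U r(3)] by blast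
      have "z + t *\<^sub>R b0 \<in> ball ?y r2" using seg[of t] t(1) r(4) by auto
      from r2(3)[OF this] have "l / 2 \<le> frechet_derivative U (at (z + t *\<^sub>R b0)) b0" by linarith
      then have "s * (l / 2) \<le> U y" unfolding t(2) using s by (rule mult_left_mono)
      moreover have "U y = u p" using Uu[OF yQ'] yb r(3) py by auto
      ultimately have su: "s * l / 2 \<le> u p" by simp
      have "F z = 0" using Ff[OF zQ(1)] zb r(5) zH fH by auto
      then obtain t where t: "t \<in> {0..s}" "F y = s * frechet_derivative F (at (z + t *\<^sub>R b0)) b0"
        using MVT[OF F r(5)] by blast
      have "z + t *\<^sub>R b0 \<in> ball ?y r4" using seg[of t] t(1) r(6) by auto
      from r4(3)[OF this] have "\<bar>frechet_derivative F (at (z + t *\<^sub>R b0)) b0\<bar> \<le> C"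
        unfolding C_def by linarith
      then have "\<bar>F y\<bar> \<le> s * C" unfolding t(2) using s by (simp add: abs_mult mult_left_mono)
      moreover have "F y = f p" using Ff[OF yQ'] yb r(5) py by auto
      moreover have "s * C = (2 * C / l) * (s * l / 2)" using l by simp
      moreover have "(2 * C / l) * (s * l / 2) \<le> (2 * C / l) * u p"
        using su l by (intro mult_left_mono) (auto simp: C_def)
      ultimately show ?thesis by linarith
    qed
    moreover have "open ?W" "q \<in> ?W" using open_chart_preimage[OF c(1) open_ball] c(2) r(1) by simp_all
    ultimately show "\<exists>W C. open W \<and> q \<in> W \<and> (\<forall>p\<in>W. \<bar>f p\<bar> \<le> C * u p)" by blast
  qed
qed

end

section \<open>Finite-dimensional estimates\<close>

text \<open>By homogeneity it is enough to bound the form on the unit sphere of the sum norm, where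
  it attains a positive minimum by compactness.\<close>

lemma pos_def_form_bound:
  fixes G :: "nat \<Rightarrow> nat \<Rightarrow> real"
  assumes pos: "\<And>a. \<exists>i<r. a i \<noteq> 0 \<Longrightarrow> 0 < (\<Sum>i<r. \<Sum>j<r. a i * a j * G i j)"
  obtains c where "c > 0" "\<And>a. c * (\<Sum>i<r. \<bar>a i\<bar>)\<^sup>2 \<le> (\<Sum>i<r. \<Sum>j<r. a i * a j * G i j)"
proof -
  let ?Q = "\<lambda>a. \<Sum>i<r. \<Sum>j<r. a i * a j * G i j"
  \<comment> \<open>Vectors are functions on all of \<open>nat\<close>; pinning the coordinates from
    \<open>r\<close> on to \<open>0\<close> makes the box a compact product. For
    \<open>r = 0\<close> the set is empty.\<close>
  define S where "S = PiE UNIV (\<lambda>i::nat. if i < r then {-1..1} else {0::real}) \<inter> {a. (\<Sum>i<r. \<bar>a i\<bar>) = 1}"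
  have "compactin (product_topology (\<lambda>i::nat. euclidean) UNIV)
      (PiE UNIV (\<lambda>i. if i < r then {-1..1} else {0::real}))"
    by (subst compactin_PiE) simp
  then have "compact (PiE UNIV (\<lambda>i::nat. if i < r then {-1..1} else {0::real}))"
    by (simp only: euclidean_product_topology compactin_euclidean_iff)
  moreover have "closed {a. (\<Sum>i<r. \<bar>a i\<bar>) = (1::real)}"
    by (intro closed_Collect_eq continuous_intros continuous_on_product_coordinates)
  ultimately have S: "compact S" unfolding S_def by (rule compact_Int_closed)
  have Q: "continuous_on S ?Q"
    by (intro continuous_intros continuous_on_subset[OF continuous_on_product_coordinates]) auto
  obtain c where c: "c > 0" "\<And>a. a \<in> S \<Longrightarrow> c \<le> ?Q a"
  proof (cases "S = {}")
    case True
    then show thesis using that[of 1] by simp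
  next
    case False
    then obtain a where a: "a \<in> S" "\<And>b. b \<in> S \<Longrightarrow> ?Q a \<le> ?Q b"
      using continuous_attains_inf[OF S _ Q] by blast
    have "\<exists>i<r. a i \<noteq> 0"
    proof (rule ccontr)
      assume "\<not> ?thesis"
      then have "(\<Sum>i<r. \<bar>a i\<bar>) = 0" by simp
      with a(1) show False by (simp add: S_def)
    qed
    then show thesis using that[OF pos a(2)] by blast
  qed
  show thesis
  proof (rule that[OF c(1)])
    fix a :: "nat \<Rightarrow> real"
    define \<sigma> where "\<sigma> = (\<Sum>i<r. \<bar>a i\<bar>)"
    show "c * (\<Sum>i<r. \<bar>a i\<bar>)\<^sup>2 \<le> ?Q a"
    proof (cases "\<sigma> = 0")
      case True
      then have "\<forall>i<r. a i = 0" by (simp add: \<sigma>_def sum_nonneg_eq_0_iff)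
      then show ?thesis by simp
    next
      case False
      then have \<sigma>: "\<sigma> > 0" using sum_nonneg[of "{..<r}" "\<lambda>i. \<bar>a i\<bar>"] by (simp add: \<sigma>_def less_le)
      define b where "b i = (if i < r then a i / \<sigma> else 0)" for i
      have "\<bar>a i\<bar> \<le> \<sigma>" if "i < r" for i
        unfolding \<sigma>_def using that by (intro member_le_sum) auto
      then have le: "- \<sigma> \<le> a i" "a i \<le> \<sigma>" if "i < r" for i
        using that by (auto simp: abs_le_iff minus_le_iff)
      have "(\<Sum>i<r. \<bar>b i\<bar>) = (\<Sum>i<r. \<bar>a i\<bar> / \<sigma>)"
        by (rule sum.cong) (use \<sigma> in \<open>auto simp: b_def\<close>)
      also have "\<dots> = 1" using \<sigma> by (simp add: sum_divide_distrib[symmetric] \<sigma>_def[symmetric])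
      finally have "b \<in> S"
        using \<sigma> le by (auto simp: S_def b_def PiE_iff field_simps)
      have ab: "a i = \<sigma> * b i" if "i < r" for i using \<sigma> that by (simp add: b_def)
      have "?Q a = (\<Sum>i<r. \<Sum>j<r. \<sigma>\<^sup>2 * (b i * b j * G i j))"
        by (intro sum.cong) (auto simp: ab power2_eq_square)
      also have "\<dots> = \<sigma>\<^sup>2 * ?Q b" by (simp add: sum_distrib_left)
      also have "\<dots> \<ge> \<sigma>\<^sup>2 * c" using c(2)[OF \<open>b \<in> S\<close>] by (intro mult_left_mono) auto
      finally show ?thesis by (simp add: \<sigma>_def mult.commute)
    qed
  qed
qed

lemma form_abs_le:
  fixes G :: "nat \<Rightarrow> nat \<Rightarrow> real"
  assumes "\<And>i j. i < r \<Longrightarrow> j < r \<Longrightarrow> \<bar>G i j\<bar> \<le> B"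
  shows "\<bar>\<Sum>i<r. \<Sum>j<r. a i * a j * G i j\<bar> \<le> B * (\<Sum>i<r. \<bar>a i\<bar>)\<^sup>2"
proof -
  have "\<bar>\<Sum>i<r. \<Sum>j<r. a i * a j * G i j\<bar> \<le> (\<Sum>i<r. \<Sum>j<r. \<bar>a i\<bar> * \<bar>a j\<bar> * B)"
    by (intro order_trans[OF sum_abs] sum_mono)
      (use assms in \<open>auto simp: abs_mult intro!: mult_left_mono\<close>)
  also have "\<dots> = B * (\<Sum>i<r. \<bar>a i\<bar>)\<^sup>2"
    by (simp add: power2_eq_square sum_product sum_distrib_left sum_distrib_right mult_ac)
  finally show ?thesis .
qed

text \<open>Each \<open>a j - w j\<close> is at most \<open>\<epsilon>\<close> times the sum norm of
  \<open>a\<close>. Summed over \<open>j\<close>, this error is at most half of that norm and is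
  absorbed on the left, so no inverse matrix is formed.\<close>

lemma near_identity_system:
  fixes R :: "nat \<Rightarrow> nat \<Rightarrow> real"
  assumes R: "\<And>i j. i < r \<Longrightarrow> j < r \<Longrightarrow> \<bar>R i j - (if i = j then 1 else 0)\<bar> \<le> \<epsilon>"
    and \<epsilon>: "real r * \<epsilon> \<le> 1 / 2"
    and w: "\<And>j. j < r \<Longrightarrow> w j = (\<Sum>i<r. a i * R i j)"
  shows "(\<Sum>i<r. \<bar>a i\<bar>) \<le> 2 * (\<Sum>j<r. \<bar>w j\<bar>)"
    and "j < r \<Longrightarrow> \<bar>a j - w j\<bar> \<le> 2 * \<epsilon> * (\<Sum>j<r. \<bar>w j\<bar>)"
proof -
  have dev: "\<bar>a j - w j\<bar> \<le> \<epsilon> * (\<Sum>i<r. \<bar>a i\<bar>)" if j: "j < r" for j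
  proof -
    have "a j = (\<Sum>i<r. a i * (if i = j then 1 else 0))"
      using j by (simp add: if_distrib cong: if_cong)
    then have "a j - w j = - (\<Sum>i<r. a i * (R i j - (if i = j then 1 else 0)))"
      by (simp add: w[OF j] right_diff_distrib sum_subtractf)
    also have "\<bar>\<dots>\<bar> \<le> (\<Sum>i<r. \<bar>a i * (R i j - (if i = j then 1 else 0))\<bar>)"
      by (simp only: abs_minus_cancel sum_abs)
    also have "\<dots> \<le> (\<Sum>i<r. \<bar>a i\<bar> * \<epsilon>)"
      unfolding abs_mult using R[OF _ j] by (intro sum_mono mult_left_mono) auto
    finally show ?thesis by (simp add: sum_distrib_left mult.commute)
  qed
  have "(\<Sum>j<r. \<bar>a j\<bar>) \<le> (\<Sum>j<r. \<bar>w j\<bar> + \<epsilon> * (\<Sum>i<r. \<bar>a i\<bar>))"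
    by (intro sum_mono) (use dev in \<open>fastforce simp: abs_le_iff\<close>)
  also have "\<dots> = (\<Sum>j<r. \<bar>w j\<bar>) + real r * \<epsilon> * (\<Sum>i<r. \<bar>a i\<bar>)"
    by (simp add: sum.distrib)
  also have "\<dots> \<le> (\<Sum>j<r. \<bar>w j\<bar>) + 1 / 2 * (\<Sum>i<r. \<bar>a i\<bar>)"
    by (intro add_left_mono mult_right_mono \<epsilon> sum_nonneg) simp
  finally show le: "(\<Sum>i<r. \<bar>a i\<bar>) \<le> 2 * (\<Sum>j<r. \<bar>w j\<bar>)" by simp
  assume j: "j < r"
  have "0 \<le> \<epsilon>" using R[OF j j] by linarith
  from mult_left_mono[OF le this] dev[OF j] show "\<bar>a j - w j\<bar> \<le> 2 * \<epsilon> * (\<Sum>j<r. \<bar>w j\<bar>)" by linarith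
qed

text \<open>Induction on the number of coordinates, as in Gaussian elimination. Later
  \<open>Z\<close> consists of the vectors of values that given tangent vectors take on a smooth
  function, and the result provides functions dual to these tangent vectors.\<close>

lemma dual_basis_exists:
  fixes Z :: "(nat \<Rightarrow> real) set"
  assumes lin: "\<And>x y a b. x \<in> Z \<Longrightarrow> y \<in> Z \<Longrightarrow> (\<lambda>i. a * x i + b * y i) \<in> Z"
    and ne: "Z \<noteq> {}"
    and indep: "\<And>a. (\<forall>x\<in>Z. (\<Sum>i<r. a i * x i) = 0) \<Longrightarrow> \<forall>i<r. a i = 0"
  shows "\<exists>z. \<forall>j<r. z j \<in> Z \<and> (\<forall>i<r. z j i = (if i = j then 1 else 0))"
  using indep
proof (induction r)
  case 0
  then show ?case by simp
next
  case (Suc r)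
  have "\<forall>i<r. a i = 0" if "\<forall>x\<in>Z. (\<Sum>i<r. a i * x i) = 0" for a
  proof -
    have "\<forall>x\<in>Z. (\<Sum>i<Suc r. (if i < r then a i else 0) * x i) = 0" using that by simp
    note 0 = Suc.prems[OF this, rule_format]
    show ?thesis
    proof (intro allI impI)
      fix i assume "i < r"
      with 0[of i] show "a i = 0" by simp
    qed
  qed
  from Suc.IH[OF this] obtain z where z: "\<And>j. j < r \<Longrightarrow> z j \<in> Z"
    "\<And>i j. i < r \<Longrightarrow> j < r \<Longrightarrow> z j i = (if i = j then 1 else 0)" by blast
  have sum_in: "(\<lambda>i. \<Sum>j<n. c j * z j i) \<in> Z" if "n \<le> r" for n c
    using that
  proof (induction n)
    case 0
    obtain x where "x \<in> Z" using ne by blast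
    from lin[OF this this, of 0 0] show ?case by simp
  next
    case (Suc n)
    then show ?case using lin[of "\<lambda>i. \<Sum>j<n. c j * z j i" "z n" 1 "c n"] z(1)[of n] by simp
  qed
  \<comment> \<open>Otherwise the coordinate \<open>r\<close> minus this combination of the earlier
    ones would vanish on \<open>Z\<close>, against independence.\<close>
  have "\<exists>x\<in>Z. x r \<noteq> (\<Sum>j<r. z j r * x j)"
  proof (rule ccontr)
    assume "\<not> ?thesis"
    then have "\<forall>x\<in>Z. (\<Sum>i<Suc r. (if i < r then - z i r else 1) * x i) = 0"
      by (simp add: sum_negf)
    from Suc.prems[OF this] show False by auto
  qed
  then obtain x where x: "x \<in> Z" "x r \<noteq> (\<Sum>j<r. z j r * x j)" by blast
  \<comment> \<open>Removing from \<open>x\<close> its part along the dual vectors found so far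
    kills the first \<open>r\<close> coordinates but not the next one. Rescaled, \<open>h\<close> is
    the new dual vector, and multiples of it correct the old ones.\<close>
  define h where "h i = x i - (\<Sum>j<r. x j * z j i)" for i
  have hZ: "h \<in> Z"
    using lin[OF x(1) sum_in[OF order_refl, of x], of 1 "-1"] by (simp add: h_def[abs_def])
  have h0: "h i = 0" if "i < r" for i
  proof -
    have "(\<Sum>j<r. x j * z j i) = (\<Sum>j<r. if j = i then x j else 0)"
      by (rule sum.cong) (use that z(2) in auto)
    then show ?thesis using that by (simp add: h_def)
  qed
  have hr: "h r \<noteq> 0" using x(2) by (simp add: h_def mult.commute)
  define z' where "z' j = (if j < r then (\<lambda>i. z j i - z j r / h r * h i) else (\<lambda>i. h i / h r))" for j
  have "z' j \<in> Z" if "j < Suc r" for j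
    using lin[OF z(1) hZ, of j 1 "- (z j r / h r)"] lin[OF hZ hZ, of "1 / h r" 0] that
    by (auto simp: z'_def)
  moreover have "z' j i = (if i = j then 1 else 0)" if "j < Suc r" "i < Suc r" for i j
    using that hr h0 z(2) by (auto simp: z'_def less_Suc_eq)
  ultimately show ?case by blast
qed

section \<open>Lie structures at infinity\<close>

locale lie_metric = corner_manifold N At
  for N :: "'e::euclidean_space set"
    and At :: "('m::{t2_space, second_countable_topology}, 'e) corner_chart set" +
  fixes \<V> :: "'m vfield set"
    and A :: "('m, 'v::real_vector) vbundle"
    and \<rho> :: "'m \<Rightarrow> 'v \<Rightarrow> ('m \<Rightarrow> real) \<Rightarrow> real"
    and g :: "'m \<Rightarrow> 'v \<Rightarrow> 'v \<Rightarrow> real"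
  assumes compact_M: "compact (UNIV :: 'm set)"
    and structural: "structural_lie_algebra At \<V>"
    and anchored: "anchored_bundle At \<V> A \<rho>"
    and anchor_iso: "\<And>p. p \<in> mfd_interior At \<Longrightarrow> bij_betw (\<rho> p) (fibre A p) (tangent_space At p)"
    and metric: "bundle_metric At A g"
begin

lemma bundle_A: "vector_bundle At A"
  using anchored by (simp add: anchored_bundle_def)

lemma subspace_fibre: "subspace (fibre A p)"
  using bundle_A by (simp add: vector_bundle_def)

lemma frame_cover: obtains e where "e \<in> frames A" "p \<in> frame_dom e"
  using bundle_A unfolding vector_bundle_def by (metis UNIV_I UN_E)

lemma anchor_tangent: "\<xi> \<in> fibre A p \<Longrightarrow> \<rho> p \<xi> \<in> tangent_space At p"
  using anchored by (simp add: anchored_bundle_def)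

lemma anchor_linear:
  "\<xi> \<in> fibre A p \<Longrightarrow> \<zeta> \<in> fibre A p \<Longrightarrow> \<rho> p (a *\<^sub>R \<xi> + b *\<^sub>R \<zeta>) f = a * \<rho> p \<xi> f + b * \<rho> p \<zeta> f"
  using anchored by (simp add: anchored_bundle_def)

lemma metric_linear:
  "\<xi> \<in> fibre A p \<Longrightarrow> \<zeta> \<in> fibre A p \<Longrightarrow> w \<in> fibre A p \<Longrightarrow>
   g p (a *\<^sub>R \<xi> + b *\<^sub>R \<zeta>) w = a * g p \<xi> w + b * g p \<zeta> w"
  and metric_sym: "\<xi> \<in> fibre A p \<Longrightarrow> \<zeta> \<in> fibre A p \<Longrightarrow> g p \<xi> \<zeta> = g p \<zeta> \<xi>"
  and metric_pos: "\<xi> \<in> fibre A p \<Longrightarrow> \<xi> \<noteq> 0 \<Longrightarrow> 0 < g p \<xi> \<xi>"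
  using metric by (simp_all add: bundle_metric_def)

lemma fibre_sum: "(\<And>i. i \<in> I \<Longrightarrow> x i \<in> fibre A p) \<Longrightarrow> (\<Sum>i\<in>I. a i *\<^sub>R x i) \<in> fibre A p"
  using subspace_fibre by (intro subspace_sum subspace_scale) auto

lemma anchor_sum:
  assumes "\<And>i. i \<in> I \<Longrightarrow> x i \<in> fibre A p"
  shows "\<rho> p (\<Sum>i\<in>I. a i *\<^sub>R x i) f = (\<Sum>i\<in>I. a i * \<rho> p (x i) f)"
  using assms
proof (induction I rule: infinite_finite_induct)
  case (insert i F)
  then show ?case
    using anchor_linear[of "x i" p "\<Sum>i\<in>F. a i *\<^sub>R x i" "a i" 1 f] fibre_sum[of F x p a] by simp
qed (use anchor_linear[OF subspace_0[OF subspace_fibre] subspace_0[OF subspace_fibre], of p 0 0 f] in auto)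

lemma metric_sum_left:
  assumes "\<And>i. i \<in> I \<Longrightarrow> x i \<in> fibre A p" "w \<in> fibre A p"
  shows "g p (\<Sum>i\<in>I. a i *\<^sub>R x i) w = (\<Sum>i\<in>I. a i * g p (x i) w)"
  using assms
proof (induction I rule: infinite_finite_induct)
  case (insert i F)
  then show ?case
    using metric_linear[of "x i" p "\<Sum>i\<in>F. a i *\<^sub>R x i" w "a i" 1] fibre_sum[of F x p a] by simp
qed (use metric_linear[OF subspace_0[OF subspace_fibre] subspace_0[OF subspace_fibre] assms(2), of 0 0] in auto)

lemma metric_sum:
  assumes "\<And>i. i \<in> I \<Longrightarrow> x i \<in> fibre A p"
  shows "g p (\<Sum>i\<in>I. a i *\<^sub>R x i) (\<Sum>j\<in>I. a j *\<^sub>R x j) = (\<Sum>i\<in>I. \<Sum>j\<in>I. a i * a j * g p (x i) (x j))"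
proof -
  let ?s = "\<Sum>j\<in>I. a j *\<^sub>R x j"
  have s: "?s \<in> fibre A p" using assms by (rule fibre_sum)
  have "g p ?s ?s = (\<Sum>i\<in>I. a i * g p (x i) ?s)" using assms s by (rule metric_sum_left)
  also have "\<dots> = (\<Sum>i\<in>I. a i * (\<Sum>j\<in>I. a j * g p (x i) (x j)))"
  proof (rule sum.cong[OF refl])
    fix i assume i: "i \<in> I"
    have "g p (x i) ?s = g p ?s (x i)" using assms i s by (intro metric_sym)
    also have "\<dots> = (\<Sum>j\<in>I. a j * g p (x j) (x i))" using assms i by (intro metric_sum_left)
    also have "\<dots> = (\<Sum>j\<in>I. a j * g p (x i) (x j))"
      using assms i by (intro sum.cong refl arg_cong[of _ _ "(*) _"] metric_sym) auto
    finally show "a i * g p (x i) ?s = a i * (\<Sum>j\<in>I. a j * g p (x i) (x j))" by simp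
  qed
  finally show ?thesis by (simp add: sum_distrib_left mult.assoc)
qed

section \<open>Local frames of \<open>A\<close> and estimates in frame coefficients\<close>

context
  fixes e assumes e: "e \<in> frames A"
begin

lemma local_frame: "is_local_frame (fibre A) e"
  using bundle_A e by (simp add: vector_bundle_def)

lemma open_frame_dom: "open (frame_dom e)"
  using local_frame by (simp add: is_local_frame_def)

lemma frame_in_fibre: "p \<in> frame_dom e \<Longrightarrow> i < frame_rank e \<Longrightarrow> frame_vec e i p \<in> fibre A p"
  using local_frame span_base unfolding is_local_frame_def by (metis imageI lessThan_iff)

lemma frame_expand:
  assumes "p \<in> frame_dom e" "\<xi> \<in> fibre A p"
  obtains a where "\<xi> = (\<Sum>i<frame_rank e. a i *\<^sub>R frame_vec e i p)"
proof -
  let ?E = "\<lambda>i. frame_vec e i p"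
  have E: "inj_on ?E {..<frame_rank e}" "span (?E ` {..<frame_rank e}) = fibre A p"
    using local_frame assms(1) by (auto simp: is_local_frame_def)
  then have "\<xi> \<in> range (\<lambda>u. \<Sum>v\<in>?E ` {..<frame_rank e}. u v *\<^sub>R v)"
    using assms(2) by (simp flip: span_finite)
  then obtain u where "\<xi> = (\<Sum>v\<in>?E ` {..<frame_rank e}. u v *\<^sub>R v)" by (rule rangeE)
  then have "\<xi> = (\<Sum>i<frame_rank e. u (?E i) *\<^sub>R ?E i)" using sum.reindex[OF E(1)] by simp
  then show thesis by (rule that)
qed

lemma frame_independent:
  assumes "p \<in> frame_dom e" "(\<Sum>i<frame_rank e. a i *\<^sub>R frame_vec e i p) = 0" "i < frame_rank e"
  shows "a i = 0"
proof -
  let ?E = "\<lambda>i. frame_vec e i p" and ?I = "{..<frame_rank e}"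
  have E: "inj_on ?E ?I" "independent (?E ` ?I)"
    using local_frame assms(1) by (auto simp: is_local_frame_def)
  have "(\<Sum>v\<in>?E ` ?I. a (the_inv_into ?I ?E v) *\<^sub>R v) = (\<Sum>i\<in>?I. a (the_inv_into ?I ?E (?E i)) *\<^sub>R ?E i)"
    by (rule sum.reindex[OF E(1), unfolded o_def])
  also have "\<dots> = (\<Sum>i\<in>?I. a i *\<^sub>R ?E i)"
    by (rule sum.cong) (simp_all add: the_inv_into_f_f[OF E(1)])
  finally have "(\<Sum>v\<in>?E ` ?I. a (the_inv_into ?I ?E v) *\<^sub>R v) = 0" using assms(2) by simp
  then have "a (the_inv_into ?I ?E (?E i)) = 0"
    using independentD[OF E(2) _ subset_refl, of "\<lambda>v. a (the_inv_into ?I ?E v)" "?E i"] assms(3) by simp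
  then show ?thesis using the_inv_into_f_f[OF E(1), of i] assms(3) by simp
qed

lemma frame_anchor:
  "p \<in> frame_dom e \<Longrightarrow> \<rho> p (\<Sum>i<frame_rank e. a i *\<^sub>R frame_vec e i p) f =
    (\<Sum>i<frame_rank e. a i * \<rho> p (frame_vec e i p) f)"
  by (rule anchor_sum) (simp add: frame_in_fibre)

lemma frame_metric:
  "p \<in> frame_dom e \<Longrightarrow>
    g p (\<Sum>i<frame_rank e. a i *\<^sub>R frame_vec e i p) (\<Sum>i<frame_rank e. a i *\<^sub>R frame_vec e i p) =
    (\<Sum>i<frame_rank e. \<Sum>j<frame_rank e. a i * a j * g p (frame_vec e i p) (frame_vec e j p))"
  by (rule metric_sum) (simp add: frame_in_fibre)

text \<open>\<open>\<V>\<close> is reached only through global sections, so a frame vector is cut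
  off before the anchor is applied. Its coefficients in another frame are smooth on the overlap of
  the domains, and the factor \<open>\<eta>\<close> makes them smooth on the whole second
  domain.\<close>

lemma cutoff_section:
  assumes \<eta>: "\<eta> \<in> smooth_funs At" "closed K" "K \<subseteq> frame_dom e" "\<And>p. p \<notin> K \<Longrightarrow> \<eta> p = 0"
    and i: "i < frame_rank e"
  shows "(\<lambda>p. \<rho> p (if p \<in> frame_dom e then \<eta> p *\<^sub>R frame_vec e i p else 0)) \<in> \<V>"
proof -
  define s where "s p = (if p \<in> frame_dom e then \<eta> p *\<^sub>R frame_vec e i p else 0)" for p
  have "s \<in> bundle_sections At A"
    unfolding bundle_sections_def
  proof (intro CollectI conjI allI ballI)
    fix p
    show "s p \<in> fibre A p"
      using subspace_fibre[of p] frame_in_fibre[OF _ i]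
      by (auto simp: s_def intro: subspace_scale subspace_0)
  next
    fix e' assume e': "e' \<in> frames A"
    have oe': "open (frame_dom e')" using bundle_A e' by (auto simp: vector_bundle_def is_local_frame_def)
    have "smooth_in_frame At e' (frame_dom e) (frame_vec e i)"
      using bundle_A e e' i by (simp add: vector_bundle_def)
    then obtain a where a: "\<And>j. j < frame_rank e' \<Longrightarrow> smooth_fun_on At (frame_dom e' \<inter> frame_dom e) (a j)"
      "\<And>p. p \<in> frame_dom e' \<inter> frame_dom e \<Longrightarrow>
        frame_vec e i p = (\<Sum>j<frame_rank e'. a j p *\<^sub>R frame_vec e' j p)"
      unfolding smooth_in_frame_def by blast
    have "smooth_fun_on At (frame_dom e' \<inter> UNIV) (\<lambda>p. \<eta> p * a j p)" if j: "j < frame_rank e'" for j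
    proof (rule smooth_fun_onI)
      show "open (frame_dom e' \<inter> UNIV)" using oe' by simp
      fix q assume q: "q \<in> frame_dom e' \<inter> UNIV"
      obtain c where c: "c \<in> At" "q \<in> chart_dom c" by (rule chart_cover)
      have "smooth_at c (\<lambda>p. \<eta> p * a j p) q"
      proof (cases "q \<in> K")
        case True
        then have "smooth_at c (a j) q"
          using a(1)[OF j] smooth_fun_on_iff[OF open_Int[OF oe' open_frame_dom]] c q \<eta>(3) by auto
        then show ?thesis by (rule smooth_at_mult[OF smooth_funs_smooth_at[OF \<eta>(1) c]])
      next
        case False
        show ?thesis
          by (rule smooth_at_cong[OF c(1) smooth_at_const[of c 0], where W="- K"])
            (use False \<eta>(2,4) c(2) in auto)
      qed
      with c show "\<exists>c\<in>At. q \<in> chart_dom c \<and> smooth_at c (\<lambda>p. \<eta> p * a j p) q" by blast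
    qed
    moreover have "s p = (\<Sum>j<frame_rank e'. (\<eta> p * a j p) *\<^sub>R frame_vec e' j p)"
      if "p \<in> frame_dom e' \<inter> UNIV" for p
    proof (cases "p \<in> frame_dom e")
      case True
      then show ?thesis using a(2)[of p] that by (simp add: s_def scaleR_sum_right)
    next
      case False
      then have "\<eta> p = 0" using \<eta>(3,4) by blast
      then show ?thesis using False by (simp add: s_def)
    qed
    ultimately show "smooth_in_frame At e' UNIV s"
      unfolding smooth_in_frame_def by (intro exI[of _ "\<lambda>j p. \<eta> p * a j p"]) blast
  qed
  moreover have "bij_betw (\<lambda>s p. \<rho> p (s p)) (bundle_sections At A) \<V>"
    using anchored by (simp add: anchored_bundle_def)
  ultimately have "(\<lambda>p. \<rho> p (s p)) \<in> \<V>" by (auto dest!: bij_betwE)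
  then show ?thesis by (simp only: s_def)
qed

lemma anchor_cutoff:
  assumes "p \<in> frame_dom e" "i < frame_rank e"
  shows "\<rho> p (if p \<in> frame_dom e then a *\<^sub>R frame_vec e i p else 0) f = a * \<rho> p (frame_vec e i p) f"
  using anchor_linear[OF frame_in_fibre[OF assms] frame_in_fibre[OF assms], of a 0 f] assms(1) by simp

text \<open>The anchor is known to be smooth only on global sections. Near \<open>q\<close> the
  coefficient is the quotient of a smooth function, obtained from the cut off frame vector, by
  \<open>\<eta>\<close>, which is nonzero there.\<close>

lemma anchor_coeff_isCont:
  assumes q: "q \<in> frame_dom e" and i: "i < frame_rank e" and f: "f \<in> smooth_funs At"
  shows "isCont (\<lambda>p. \<rho> p (frame_vec e i p) f) q"
proof -
  obtain \<eta> K where \<eta>: "\<eta> \<in> smooth_funs At" "\<eta> q = 1" "\<And>p. 0 \<le> \<eta> p" "closed K" "K \<subseteq> frame_dom e"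
    "\<And>p. p \<notin> K \<Longrightarrow> \<eta> p = 0"
    by (rule bump_function[OF open_frame_dom q]) (rule that)
  define h where "h p = \<rho> p (if p \<in> frame_dom e then \<eta> p *\<^sub>R frame_vec e i p else 0) f" for p
  have "(\<lambda>p. \<rho> p (if p \<in> frame_dom e then \<eta> p *\<^sub>R frame_vec e i p else 0)) \<in> vector_fields At"
    using cutoff_section[OF \<eta>(1,4,5,6) i] structural by (auto simp: structural_lie_algebra_def)
  then have "h \<in> smooth_funs At" using f unfolding vector_fields_def h_def by blast
  then have "isCont h q" "isCont \<eta> q"
    using smooth_funs_continuous[of _ UNIV] \<eta>(1) by (auto simp: continuous_on_eq_continuous_at)
  then have c: "isCont (\<lambda>p. h p / \<eta> p) q" using \<eta>(2) by (intro continuous_intros) auto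
  have "eventually (\<lambda>p. p \<in> frame_dom e) (nhds q)"
    using open_frame_dom q by (rule eventually_nhds_in_open)
  moreover have "eventually (\<lambda>p. \<eta> p \<noteq> 0) (nhds q)"
    using \<open>isCont \<eta> q\<close> \<eta>(2) by (simp add: continuous_within tendsto_imp_eventually_ne
        eventually_nhds_conv_at)
  ultimately have "eventually (\<lambda>p. h p / \<eta> p = \<rho> p (frame_vec e i p) f) (nhds q)"
  proof eventually_elim
    case (elim p)
    then show ?case using anchor_cutoff[OF elim(1) i] by (simp add: h_def)
  qed
  with c show ?thesis by (metis isCont_cong)
qed

lemma metric_coeff_isCont:
  assumes q: "q \<in> frame_dom e" and "i < frame_rank e" "j < frame_rank e"
  shows "isCont (\<lambda>p. g p (frame_vec e i p) (frame_vec e j p)) q"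
proof -
  have "smooth_fun_on At (frame_dom e) (\<lambda>p. g p (frame_vec e i p) (frame_vec e j p))"
    using metric e assms by (simp add: bundle_metric_def)
  moreover obtain c where c: "c \<in> At" "q \<in> chart_dom c" by (rule chart_cover)
  ultimately show ?thesis
    using q by (intro smooth_at_isCont[OF c]) (simp add: smooth_fun_on_iff[OF open_frame_dom])
qed

text \<open>At \<open>q\<close> the Gram form dominates \<open>c\<close> times the squared sum norm.
  Nearby its entries change by less than \<open>c / 2\<close>, which costs at most half of this
  bound; hence the constant \<open>sqrt (2 / c)\<close>. Boundary points are included, because
  \<open>g\<close> is definite on \<open>A\<close> over all of \<open>M\<close>.\<close>

lemma frame_norm_bound:
  assumes q: "q \<in> frame_dom e"
  obtains W C where "open W" "q \<in> W" "W \<subseteq> frame_dom e" "C > 0"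
    "\<And>p a. p \<in> W \<Longrightarrow> (\<Sum>i<frame_rank e. \<bar>a i\<bar>) \<le>
       C * sqrt (g p (\<Sum>i<frame_rank e. a i *\<^sub>R frame_vec e i p) (\<Sum>i<frame_rank e. a i *\<^sub>R frame_vec e i p))"
proof -
  let ?r = "frame_rank e"
  define G where "G p i j = g p (frame_vec e i p) (frame_vec e j p)" for p i j
  have "0 < (\<Sum>i<?r. \<Sum>j<?r. a i * a j * G q i j)" if "\<exists>i<?r. a i \<noteq> 0" for a
  proof -
    let ?s = "\<Sum>i<?r. a i *\<^sub>R frame_vec e i q"
    have "?s \<noteq> 0" using frame_independent[OF q, of a] that by blast
    moreover have "?s \<in> fibre A q" by (rule fibre_sum) (simp add: frame_in_fibre q)
    ultimately have "0 < g q ?s ?s" by (intro metric_pos)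
    then show ?thesis by (simp add: frame_metric[OF q] G_def)
  qed
  then obtain c where c: "c > 0" "\<And>a. c * (\<Sum>i<?r. \<bar>a i\<bar>)\<^sup>2 \<le> (\<Sum>i<?r. \<Sum>j<?r. a i * a j * G q i j)"
    by (rule pos_def_form_bound) (assumption, rule that)
  have "eventually (\<lambda>p. \<bar>G p i j - G q i j\<bar> < c / 2) (nhds q)" if "i < ?r" "j < ?r" for i j
  proof -
    have "((\<lambda>p. G p i j) \<longlongrightarrow> G q i j) (nhds q)"
      using metric_coeff_isCont[OF q that] by (simp add: G_def isCont_def tendsto_nhds_iff)
    from tendstoD[OF this, of "c / 2"] c(1) show ?thesis by (simp add: dist_real_def)
  qed
  then have "eventually (\<lambda>p. \<forall>i\<in>{..<?r}. \<forall>j\<in>{..<?r}. \<bar>G p i j - G q i j\<bar> < c / 2) (nhds q)"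
    by (intro eventually_ball_finite ballI) auto
  then have "eventually (\<lambda>p. (\<forall>i\<in>{..<?r}. \<forall>j\<in>{..<?r}. \<bar>G p i j - G q i j\<bar> < c / 2) \<and> p \<in> frame_dom e) (nhds q)"
    using eventually_nhds_in_open[OF open_frame_dom q] by (rule eventually_conj)
  then obtain W where W: "open W" "q \<in> W"
    "\<And>p. p \<in> W \<Longrightarrow> (\<forall>i\<in>{..<?r}. \<forall>j\<in>{..<?r}. \<bar>G p i j - G q i j\<bar> < c / 2) \<and> p \<in> frame_dom e"
    unfolding eventually_nhds by blast
  show thesis
  proof (rule that[OF W(1,2)])
    show "W \<subseteq> frame_dom e" using W(3) by blast
    show "0 < sqrt (2 / c)" using c(1) by simp
    fix p a assume p: "p \<in> W"
    let ?Q = "\<lambda>p. \<Sum>i<?r. \<Sum>j<?r. a i * a j * G p i j" and ?\<sigma> = "\<Sum>i<?r. \<bar>a i\<bar>"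
    have "\<bar>\<Sum>i<?r. \<Sum>j<?r. a i * a j * (G p i j - G q i j)\<bar> \<le> (c / 2) * ?\<sigma>\<^sup>2"
      by (rule form_abs_le) (use W(3)[OF p] in \<open>auto intro: less_imp_le\<close>)
    then have "\<bar>?Q p - ?Q q\<bar> \<le> (c / 2) * ?\<sigma>\<^sup>2" by (simp add: right_diff_distrib sum_subtractf)
    then have "(c / 2) * ?\<sigma>\<^sup>2 \<le> ?Q p" using c(2)[of a] by linarith
    then have "?\<sigma>\<^sup>2 \<le> 2 / c * ?Q p" using c(1) by (simp add: field_simps)
    then have "?\<sigma> \<le> sqrt (2 / c * ?Q p)" by (rule real_le_rsqrt)
    then show "?\<sigma> \<le> sqrt (2 / c) *
        sqrt (g p (\<Sum>i<?r. a i *\<^sub>R frame_vec e i p) (\<Sum>i<?r. a i *\<^sub>R frame_vec e i p))"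
      using W(3)[OF p] by (simp only: frame_metric G_def real_sqrt_mult)
  qed
qed

text \<open>The weight \<open>u\<close> lets one estimate serve twice: with \<open>u = 1\<close> for
  arbitrary smooth functions, and with \<open>f = u\<close> a defining function differentiated by
  fields tangent to its hyperface.\<close>

lemma anchor_bound:
  assumes q: "q \<in> frame_dom e" and u: "\<And>p. 0 \<le> u p"
    and coeff: "\<And>i. i < frame_rank e \<Longrightarrow>
      \<exists>W C. open W \<and> q \<in> W \<and> (\<forall>p\<in>W. \<bar>\<rho> p (frame_vec e i p) f\<bar> \<le> C * u p)"
  shows "\<exists>W C. open W \<and> q \<in> W \<and> 0 \<le> C \<and>
    (\<forall>p\<in>W. \<forall>\<xi>\<in>fibre A p. \<bar>\<rho> p \<xi> f\<bar> \<le> C * u p * sqrt (g p \<xi> \<xi>))"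
proof -
  let ?r = "frame_rank e"
  obtain W C where W: "open W" "q \<in> W" "W \<subseteq> frame_dom e" "C > 0"
    "\<And>p a. p \<in> W \<Longrightarrow> (\<Sum>i<?r. \<bar>a i\<bar>) \<le>
       C * sqrt (g p (\<Sum>i<?r. a i *\<^sub>R frame_vec e i p) (\<Sum>i<?r. a i *\<^sub>R frame_vec e i p))"
    by (rule frame_norm_bound[OF q]) (rule that)
  have "\<forall>i. \<exists>W C. i < ?r \<longrightarrow> open W \<and> q \<in> W \<and> (\<forall>p\<in>W. \<bar>\<rho> p (frame_vec e i p) f\<bar> \<le> C * u p)"
    using coeff by blast
  then obtain V B where VB: "\<And>i. i < ?r \<Longrightarrow> open (V i)" "\<And>i. i < ?r \<Longrightarrow> q \<in> V i"
    "\<And>i p. i < ?r \<Longrightarrow> p \<in> V i \<Longrightarrow> \<bar>\<rho> p (frame_vec e i p) f\<bar> \<le> B i * u p"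
    by metis
  define D where "D = (\<Sum>i<?r. \<bar>B i\<bar>)"
  let ?W = "W \<inter> (\<Inter>i<?r. V i)"
  have "\<bar>\<rho> p \<xi> f\<bar> \<le> (D * C) * u p * sqrt (g p \<xi> \<xi>)" if p: "p \<in> ?W" and \<xi>: "\<xi> \<in> fibre A p" for p \<xi>
  proof -
    have pe: "p \<in> frame_dom e" "p \<in> W" using p W(3) by auto
    obtain a where a: "\<xi> = (\<Sum>i<?r. a i *\<^sub>R frame_vec e i p)" by (rule frame_expand[OF pe(1) \<xi>])
    have co: "\<bar>\<rho> p (frame_vec e i p) f\<bar> \<le> D * u p" if "i < ?r" for i
    proof -
      have "\<bar>\<rho> p (frame_vec e i p) f\<bar> \<le> B i * u p" using VB(3) that p by auto
      also have "\<dots> \<le> \<bar>B i\<bar> * u p" using u by (intro mult_right_mono) auto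
      also have "\<bar>B i\<bar> \<le> D" unfolding D_def using that by (intro member_le_sum) auto
      then have "\<bar>B i\<bar> * u p \<le> D * u p" using u by (rule mult_right_mono)
      finally show ?thesis .
    qed
    have "\<bar>\<rho> p \<xi> f\<bar> = \<bar>\<Sum>i<?r. a i * \<rho> p (frame_vec e i p) f\<bar>" by (simp add: a frame_anchor[OF pe(1)])
    also have "\<dots> \<le> (\<Sum>i<?r. \<bar>a i\<bar> * (D * u p))"
      using co by (intro order_trans[OF sum_abs] sum_mono) (auto simp: abs_mult intro: mult_left_mono)
    also have "\<dots> = (D * u p) * (\<Sum>i<?r. \<bar>a i\<bar>)" by (simp add: sum_distrib_left mult.commute)
    also have "\<dots> \<le> (D * u p) * (C * sqrt (g p \<xi> \<xi>))"
      unfolding a by (intro mult_left_mono W(5) pe mult_nonneg_nonneg u) (simp add: D_def sum_nonneg)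
    finally show ?thesis by (simp add: mult_ac)
  qed
  moreover have "open ?W" "q \<in> ?W" "0 \<le> D * C"
    using W VB by (auto simp: D_def intro!: open_Int open_INT sum_nonneg mult_nonneg_nonneg)
  ultimately show ?thesis by blast
qed

end

end

section \<open>Bounds for the anchor on all of \<open>M\<close> and near the boundary\<close>

lemma isCont_locally_bounded:
  fixes h :: "'a::t2_space \<Rightarrow> real"
  assumes "isCont h q"
  shows "\<exists>W. open W \<and> q \<in> W \<and> (\<forall>p\<in>W. \<bar>h p\<bar> \<le> \<bar>h q\<bar> + 1)"
proof -
  have "(h \<longlongrightarrow> h q) (nhds q)" using assms by (simp add: isCont_def tendsto_nhds_iff)
  from tendstoD[OF this, of 1] have "eventually (\<lambda>p. \<bar>h p\<bar> \<le> \<bar>h q\<bar> + 1) (nhds q)"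
    by (auto simp: dist_real_def elim!: eventually_mono)
  then show ?thesis by (auto simp: eventually_nhds)
qed

context lie_metric
begin

text \<open>The coefficients of the anchor are locally bounded, at boundary points too. Compactness
  leaves finitely many neighbourhoods, and the sum of their constants dominates each of
  them.\<close>

lemma anchor_bound_smooth:
  assumes f: "f \<in> smooth_funs At"
  obtains C where "0 \<le> C" "\<And>p \<xi>. \<xi> \<in> fibre A p \<Longrightarrow> \<bar>\<rho> p \<xi> f\<bar> \<le> C * sqrt (g p \<xi> \<xi>)"
proof -
  have "\<exists>W C. open W \<and> q \<in> W \<and> 0 \<le> C \<and> (\<forall>p\<in>W. \<forall>\<xi>\<in>fibre A p. \<bar>\<rho> p \<xi> f\<bar> \<le> C * 1 * sqrt (g p \<xi> \<xi>))" for q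
  proof -
    obtain e where e: "e \<in> frames A" "q \<in> frame_dom e" by (rule frame_cover)
    show ?thesis
    proof (rule anchor_bound[OF e])
      fix i assume "i < frame_rank e"
      from isCont_locally_bounded[OF anchor_coeff_isCont[OF e this f]]
      obtain W where "open W" "q \<in> W"
        "\<forall>p\<in>W. \<bar>\<rho> p (frame_vec e i p) f\<bar> \<le> \<bar>\<rho> q (frame_vec e i q) f\<bar> + 1" by blast
      then show "\<exists>W C. open W \<and> q \<in> W \<and> (\<forall>p\<in>W. \<bar>\<rho> p (frame_vec e i p) f\<bar> \<le> C * 1)"
        by (intro exI[of _ W] exI[of _ "\<bar>\<rho> q (frame_vec e i q) f\<bar> + 1"]) simp
    qed simp
  qed
  then obtain W C where WC: "\<And>q. open (W q)" "\<And>q. q \<in> W q" "\<And>q. 0 \<le> C q"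
    "\<And>q p \<xi>. p \<in> W q \<Longrightarrow> \<xi> \<in> fibre A p \<Longrightarrow> \<bar>\<rho> p \<xi> f\<bar> \<le> C q * 1 * sqrt (g p \<xi> \<xi>)"
    by metis
  have cover: "UNIV \<subseteq> (\<Union>q\<in>UNIV. W q)" using WC(2) by blast
  obtain D where D: "D \<subseteq> UNIV" "finite D" "UNIV \<subseteq> (\<Union>q\<in>D. W q)"
    by (rule compactE_image[OF compact_M _ cover]) (rule WC(1), rule that)
  show thesis
  proof (rule that[of "\<Sum>q\<in>D. C q"])
    show "0 \<le> (\<Sum>q\<in>D. C q)" using WC(3) by (intro sum_nonneg)
    fix p \<xi> assume \<xi>: "\<xi> \<in> fibre A p"
    obtain q where q: "q \<in> D" "p \<in> W q" using D(3) by blast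
    have "0 \<le> g p \<xi> \<xi>"
      using metric_pos[OF \<xi>] metric_linear[OF \<xi> \<xi> \<xi>, of 0 0] by (cases "\<xi> = 0") auto
    moreover have "C q \<le> (\<Sum>q\<in>D. C q)" using q(1) D(2) WC(3) by (intro member_le_sum) auto
    ultimately have "C q * sqrt (g p \<xi> \<xi>) \<le> (\<Sum>q\<in>D. C q) * sqrt (g p \<xi> \<xi>)"
      by (intro mult_right_mono) auto
    with WC(4)[OF q(2) \<xi>] show "\<bar>\<rho> p \<xi> f\<bar> \<le> (\<Sum>q\<in>D. C q) * sqrt (g p \<xi> \<xi>)" by simp
  qed
qed

text \<open>Since the fields in \<open>\<V>\<close> are tangent to a hyperface, they differentiate its defining function
  \<open>u\<close> to a multiple of \<open>u\<close>. So \<open>ln u\<close> is locally Lipschitz for the metric, although it is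
  unbounded near the hyperface.\<close>

lemma boundary_weight:
  assumes "q \<in> mfd_boundary At"
  obtains u W C where "u \<in> smooth_funs At" "u q = 0" "\<And>p. 0 \<le> u p" "\<And>p. p \<in> mfd_interior At \<Longrightarrow> 0 < u p"
    "open W" "q \<in> W" "0 \<le> C"
    "\<And>p \<xi>. p \<in> W \<Longrightarrow> \<xi> \<in> fibre A p \<Longrightarrow> \<bar>\<rho> p \<xi> u\<bar> \<le> C * u p * sqrt (g p \<xi> \<xi>)"
proof -
  obtain H u where H: "H \<in> hyperfaces At" and u: "defining_function At H u" and uq: "u q = 0"
    and est: "\<And>f. f \<in> smooth_funs At \<Longrightarrow> \<forall>p\<in>H. f p = 0 \<Longrightarrow>
       \<exists>W C. open W \<and> q \<in> W \<and> (\<forall>p\<in>W. \<bar>f p\<bar> \<le> C * u p)"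
    by (rule hyperface_estimate[OF assms]) (rule that)
  have us: "u \<in> smooth_funs At" and u0: "\<And>p. 0 \<le> u p" and uH: "\<And>p. p \<in> H \<longleftrightarrow> u p = 0"
    using u by (auto simp: defining_function_def)
  have uint: "0 < u p" if "p \<in> mfd_interior At" for p
    using that H uH[of p] u0[of p] by (force simp: mfd_interior_def mfd_boundary_def less_le)
  obtain e where e: "e \<in> frames A" "q \<in> frame_dom e" by (rule frame_cover)
  obtain \<eta> K where \<eta>: "\<eta> \<in> smooth_funs At" "\<eta> q = 1" "\<And>p. 0 \<le> \<eta> p" "closed K" "K \<subseteq> frame_dom e"
    "\<And>p. p \<notin> K \<Longrightarrow> \<eta> p = 0"
    by (rule bump_function[OF open_frame_dom[OF e(1)] e(2)]) (rule that)
  \<comment> \<open>On \<open>V\<close> the cutoff exceeds \<open>1 / 2\<close>, so returning from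
    the cut off field to the frame vector costs a factor \<open>2\<close> in the constant.\<close>
  define V where "V = {p. 1 / 2 < \<eta> p} \<inter> frame_dom e"
  have "open {p. 1 / 2 < \<eta> p}"
    by (intro open_Collect_less continuous_on_const smooth_funs_continuous \<eta>(1))
  then have V: "open V" "q \<in> V"
    using open_frame_dom[OF e(1)] e(2) \<eta>(2) by (auto simp: V_def)
  have "\<exists>W C. open W \<and> q \<in> W \<and> 0 \<le> C \<and>
    (\<forall>p\<in>W. \<forall>\<xi>\<in>fibre A p. \<bar>\<rho> p \<xi> u\<bar> \<le> C * u p * sqrt (g p \<xi> \<xi>))"
  proof (rule anchor_bound[OF e u0])
    fix i assume i: "i < frame_rank e"
    define X where "X = (\<lambda>p. \<rho> p (if p \<in> frame_dom e then \<eta> p *\<^sub>R frame_vec e i p else 0))"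
    have X: "X \<in> \<V>" unfolding X_def using cutoff_section[OF e(1) \<eta>(1,4,5,6) i] .
    define h where "h = (\<lambda>p. X p u)"
    have "X \<in> vector_fields At" "tangent_to At X H"
      using X structural H by (auto simp: structural_lie_algebra_def)
    then have "h \<in> smooth_funs At" "\<forall>p\<in>H. h p = 0"
      using us uH by (auto simp: vector_fields_def h_def tangent_to_def)
    then obtain W C where W: "open W" "q \<in> W" "\<forall>p\<in>W. \<bar>h p\<bar> \<le> C * u p" using est by blast
    have "\<bar>\<rho> p (frame_vec e i p) u\<bar> \<le> (2 * C) * u p" if p: "p \<in> W \<inter> V" for p
    proof -
      have p': "p \<in> frame_dom e" "1 / 2 < \<eta> p" using p by (auto simp: V_def)
      have "h p = \<eta> p * \<rho> p (frame_vec e i p) u"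
        using anchor_cutoff[OF e(1) p'(1) i] by (simp add: h_def X_def)
      then have "\<bar>h p\<bar> = \<eta> p * \<bar>\<rho> p (frame_vec e i p) u\<bar>" using \<eta>(3)[of p] by (simp add: abs_mult)
      also have "\<dots> \<ge> 1 / 2 * \<bar>\<rho> p (frame_vec e i p) u\<bar>"
        using p'(2) by (intro mult_right_mono) auto
      finally have "1 / 2 * \<bar>\<rho> p (frame_vec e i p) u\<bar> \<le> \<bar>h p\<bar>" .
      moreover have "\<bar>h p\<bar> \<le> C * u p" using W(3) p by blast
      ultimately show ?thesis by simp
    qed
    then show "\<exists>W C. open W \<and> q \<in> W \<and> (\<forall>p\<in>W. \<bar>\<rho> p (frame_vec e i p) u\<bar> \<le> C * u p)"
      using W V by (intro exI[of _ "W \<inter> V"] exI[of _ "2 * C"]) auto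
  qed
  then show thesis using that[OF us uq u0 uint] by blast
qed

text \<open>At an interior point the anchor is injective, so a frame remains independent as a family
  of derivations. Linear algebra on their values then produces the dual functions.\<close>

lemma dual_functions:
  assumes q: "q \<in> mfd_interior At" and e: "e \<in> frames A" "q \<in> frame_dom e"
  obtains f where "\<And>j. j < frame_rank e \<Longrightarrow> f j \<in> smooth_funs At"
    "\<And>i j. i < frame_rank e \<Longrightarrow> j < frame_rank e \<Longrightarrow> \<rho> q (frame_vec e i q) (f j) = (if i = j then 1 else 0)"
proof -
  let ?r = "frame_rank e"
  define ev where "ev f i = (if i < ?r then \<rho> q (frame_vec e i q) f else 0)" for f i
  have inF: "frame_vec e i q \<in> fibre A q" if "i < ?r" for i by (rule frame_in_fibre[OF e that])
  have "\<exists>z. \<forall>j<?r. z j \<in> ev ` smooth_funs At \<and> (\<forall>i<?r. z j i = (if i = j then 1 else 0))"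
  proof (rule dual_basis_exists)
    fix x y and a b :: real
    assume "x \<in> ev ` smooth_funs At" "y \<in> ev ` smooth_funs At"
    then obtain f h where fh: "f \<in> smooth_funs At" "h \<in> smooth_funs At" "x = ev f" "y = ev h" by blast
    have "(\<lambda>i. a * x i + b * y i) = ev (\<lambda>p. a * f p + b * h p)"
      using tangent_lincomb[OF anchor_tangent[OF inF] fh(1,2)] by (auto simp: ev_def fh fun_eq_iff)
    then show "(\<lambda>i. a * x i + b * y i) \<in> ev ` smooth_funs At"
      using smooth_funs_lincomb[OF fh(1,2)] by blast
  next
    show "ev ` smooth_funs At \<noteq> {}" using smooth_funs_const by blast
  next
    fix a assume a: "\<forall>x\<in>ev ` smooth_funs At. (\<Sum>i<?r. a i * x i) = 0"
    let ?s = "\<Sum>i<?r. a i *\<^sub>R frame_vec e i q"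
    have s: "?s \<in> fibre A q" using inF by (intro fibre_sum) auto
    have z: "0 \<in> fibre A q" by (rule subspace_0[OF subspace_fibre])
    have "\<rho> q ?s f = 0" for f
    \<comment> \<open>Injectivity of the anchor needs equality of functionals on all
      \<open>f\<close>; off the smooth functions both are \<open>0\<close> by the convention in
      \<open>tangent_space\<close>.\<close>
    proof (cases "f \<in> smooth_funs At")
      case True
      then have "(\<Sum>i<?r. a i * ev f i) = 0" using a by blast
      then show ?thesis by (simp add: frame_anchor[OF e] ev_def)
    next
      case False
      then show ?thesis using anchor_tangent[OF s] by (simp add: tangent_space_def)
    qed
    moreover have "\<rho> q 0 f = 0" for f using anchor_linear[OF z z, of 0 0 f] by simp
    ultimately have "\<rho> q ?s = \<rho> q 0" by (simp add: fun_eq_iff)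
    then have "?s = 0" using anchor_iso[OF q] s z by (auto simp: bij_betw_def dest: inj_onD)
    then show "\<forall>i<?r. a i = 0" using frame_independent[OF e] by blast
  qed
  then obtain z where z: "\<And>j. j < ?r \<Longrightarrow> z j \<in> ev ` smooth_funs At"
    "\<And>i j. i < ?r \<Longrightarrow> j < ?r \<Longrightarrow> z j i = (if i = j then 1 else 0)" by blast
  have "\<exists>f\<in>smooth_funs At. z j = ev f" if "j < ?r" for j using z(1)[OF that] by blast
  then obtain f where f: "\<And>j. j < ?r \<Longrightarrow> f j \<in> smooth_funs At \<and> z j = ev (f j)" by metis
  show thesis
  proof (rule that)
    show "f j \<in> smooth_funs At" if "j < ?r" for j using f[OF that] by blast
    show "\<rho> q (frame_vec e i q) (f j) = (if i = j then 1 else 0)" if "i < ?r" "j < ?r" for i j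
      using f[OF that(2)] z(2)[OF that] that by (simp add: ev_def)
  qed
qed

text \<open>The functions are dual to the frame at \<open>q\<close> only. At nearby \<open>p\<close>
  the matrix of derivatives differs from the identity by at most \<open>\<epsilon> p\<close> in each
  entry, so the frame coefficients are still read off from the derivatives
  \<open>\<rho> p \<xi> (f j)\<close>, with an error that disappears as \<open>p\<close> tends to
  \<open>q\<close>.\<close>

lemma dual_coefficients:
  assumes q: "q \<in> mfd_interior At" and e: "e \<in> frames A" "q \<in> frame_dom e"
  obtains f and \<epsilon> :: "'m \<Rightarrow> real" where "\<And>j. j < frame_rank e \<Longrightarrow> f j \<in> smooth_funs At" "isCont \<epsilon> q" "\<epsilon> q = 0"
    "\<And>p a \<xi>. p \<in> frame_dom e \<Longrightarrow> real (frame_rank e) * \<epsilon> p \<le> 1 / 2 \<Longrightarrow>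
      \<xi> = (\<Sum>i<frame_rank e. a i *\<^sub>R frame_vec e i p) \<Longrightarrow>
      (\<Sum>i<frame_rank e. \<bar>a i\<bar>) \<le> 2 * (\<Sum>j<frame_rank e. \<bar>\<rho> p \<xi> (f j)\<bar>) \<and>
      (\<forall>j<frame_rank e. \<bar>a j - \<rho> p \<xi> (f j)\<bar> \<le> 2 * \<epsilon> p * (\<Sum>j<frame_rank e. \<bar>\<rho> p \<xi> (f j)\<bar>))"
proof -
  let ?r = "frame_rank e"
  obtain f where f: "\<And>j. j < ?r \<Longrightarrow> f j \<in> smooth_funs At"
    "\<And>i j. i < ?r \<Longrightarrow> j < ?r \<Longrightarrow> \<rho> q (frame_vec e i q) (f j) = (if i = j then 1 else 0)"
    by (rule dual_functions[OF q e]) (rule that)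
  define R where "R p i j = \<rho> p (frame_vec e i p) (f j)" for p i j
  define \<epsilon> where "\<epsilon> p = (\<Sum>i<?r. \<Sum>j<?r. \<bar>R p i j - (if i = j then 1 else 0)\<bar>)" for p
  show thesis
  proof (rule that[of f \<epsilon>])
    show "f j \<in> smooth_funs At" if "j < ?r" for j by (rule f(1)[OF that])
    show "isCont \<epsilon> q"
      unfolding \<epsilon>_def R_def
      by (intro continuous_intros anchor_coeff_isCont[OF e] f(1)) auto
    show "\<epsilon> q = 0" by (simp add: \<epsilon>_def R_def f(2))
    fix p a \<xi>
    assume p: "p \<in> frame_dom e" and small: "real ?r * \<epsilon> p \<le> 1 / 2"
      and \<xi>: "\<xi> = (\<Sum>i<?r. a i *\<^sub>R frame_vec e i p)"
    have le: "\<bar>R p i j - (if i = j then 1 else 0)\<bar> \<le> \<epsilon> p" if "i < ?r" "j < ?r" for i j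
    proof -
      have "\<bar>R p i j - (if i = j then 1 else 0)\<bar> \<le> (\<Sum>j<?r. \<bar>R p i j - (if i = j then 1 else 0)\<bar>)"
        using that by (intro member_le_sum) auto
      also have "\<dots> \<le> \<epsilon> p"
        unfolding \<epsilon>_def using that
        by (intro member_le_sum[of i "{..<?r}" "\<lambda>i. \<Sum>j<?r. \<bar>R p i j - (if i = j then 1 else 0)\<bar>"])
          (auto intro: sum_nonneg)
      finally show ?thesis .
    qed
    have w: "\<rho> p \<xi> (f j) = (\<Sum>i<?r. a i * R p i j)" for j
      by (simp add: \<xi> frame_anchor[OF e(1) p] R_def)
    show "(\<Sum>i<?r. \<bar>a i\<bar>) \<le> 2 * (\<Sum>j<?r. \<bar>\<rho> p \<xi> (f j)\<bar>) \<and>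
      (\<forall>j<?r. \<bar>a j - \<rho> p \<xi> (f j)\<bar> \<le> 2 * \<epsilon> p * (\<Sum>j<?r. \<bar>\<rho> p \<xi> (f j)\<bar>))"
      using near_identity_system[OF le small w] by blast
  qed
qed

text \<open>The converse of \<open>anchor_bound_smooth\<close>: frame coefficients are controlled by
  derivatives of finitely many functions, and the metric coefficients are locally bounded. It is
  local and interior, because injectivity of the anchor is used.\<close>

lemma norm_upper_bound:
  assumes q: "q \<in> mfd_interior At"
  obtains W C r f where "open W" "q \<in> W" "0 \<le> C" "\<And>j. j < (r::nat) \<Longrightarrow> f j \<in> smooth_funs At"
    "\<And>p \<xi>. p \<in> W \<Longrightarrow> \<xi> \<in> fibre A p \<Longrightarrow> sqrt (g p \<xi> \<xi>) \<le> C * (\<Sum>j<r. \<bar>\<rho> p \<xi> (f j)\<bar>)"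
proof -
  obtain e where e: "e \<in> frames A" "q \<in> frame_dom e" by (rule frame_cover)
  let ?r = "frame_rank e"
  obtain f \<epsilon> where f: "\<And>j. j < ?r \<Longrightarrow> f j \<in> smooth_funs At" and \<epsilon>: "isCont \<epsilon> q" "\<epsilon> q = 0"
    and co: "\<And>p a \<xi>. p \<in> frame_dom e \<Longrightarrow> real ?r * \<epsilon> p \<le> 1 / 2 \<Longrightarrow>
      \<xi> = (\<Sum>i<?r. a i *\<^sub>R frame_vec e i p) \<Longrightarrow>
      (\<Sum>i<?r. \<bar>a i\<bar>) \<le> 2 * (\<Sum>j<?r. \<bar>\<rho> p \<xi> (f j)\<bar>) \<and>
      (\<forall>j<?r. \<bar>a j - \<rho> p \<xi> (f j)\<bar> \<le> 2 * \<epsilon> p * (\<Sum>j<?r. \<bar>\<rho> p \<xi> (f j)\<bar>))"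
    by (rule dual_coefficients[OF q e]) (rule that)
  define G where "G p i j = g p (frame_vec e i p) (frame_vec e j p)" for p i j
  define S where "S p = (\<Sum>i<?r. \<Sum>j<?r. \<bar>G p i j\<bar>)" for p
  have "isCont S q"
    unfolding S_def G_def by (intro continuous_intros metric_coeff_isCont[OF e]) auto
  then obtain W1 where W1: "open W1" "q \<in> W1" "\<forall>p\<in>W1. \<bar>S p\<bar> \<le> \<bar>S q\<bar> + 1"
    using isCont_locally_bounded by blast
  have "isCont (\<lambda>p. real ?r * \<epsilon> p) q" using \<epsilon>(1) by (intro continuous_intros)
  then have "((\<lambda>p. real ?r * \<epsilon> p) \<longlongrightarrow> 0) (nhds q)" using \<epsilon>(2) by (simp add: isCont_def tendsto_nhds_iff)
  then have "eventually (\<lambda>p. real ?r * \<epsilon> p < 1 / 2) (nhds q)" by (rule order_tendstoD) simp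
  then obtain W2 where W2: "open W2" "q \<in> W2" "\<And>p. p \<in> W2 \<Longrightarrow> real ?r * \<epsilon> p < 1 / 2"
    by (auto simp: eventually_nhds)
  define B where "B = \<bar>S q\<bar> + 1"
  show thesis
  proof (rule that[of "W1 \<inter> W2 \<inter> frame_dom e" "sqrt B * 2" ?r f])
    show "open (W1 \<inter> W2 \<inter> frame_dom e)" "q \<in> W1 \<inter> W2 \<inter> frame_dom e" "0 \<le> sqrt B * 2"
      using W1 W2 e open_frame_dom[OF e(1)] by (auto simp: B_def)
    show "f j \<in> smooth_funs At" if "j < ?r" for j by (rule f[OF that])
    fix p \<xi> assume p: "p \<in> W1 \<inter> W2 \<inter> frame_dom e" and \<xi>: "\<xi> \<in> fibre A p"
    then have pe: "p \<in> frame_dom e" by blast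
    obtain a where a: "\<xi> = (\<Sum>i<?r. a i *\<^sub>R frame_vec e i p)" by (rule frame_expand[OF e(1) pe \<xi>])
    have "\<bar>G p i j\<bar> \<le> B" if "i < ?r" "j < ?r" for i j
    proof -
      have "\<bar>G p i j\<bar> \<le> (\<Sum>j<?r. \<bar>G p i j\<bar>)" using that by (intro member_le_sum) auto
      also have "\<dots> \<le> S p"
        unfolding S_def using that
        by (intro member_le_sum[of i "{..<?r}" "\<lambda>i. \<Sum>j<?r. \<bar>G p i j\<bar>"]) (auto intro: sum_nonneg)
      also have "\<dots> \<le> B" using W1(3) p by (auto simp: B_def abs_le_iff)
      finally show ?thesis .
    qed
    then have "\<bar>\<Sum>i<?r. \<Sum>j<?r. a i * a j * G p i j\<bar> \<le> B * (\<Sum>i<?r. \<bar>a i\<bar>)\<^sup>2" by (rule form_abs_le)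
    then have "g p \<xi> \<xi> \<le> B * (\<Sum>i<?r. \<bar>a i\<bar>)\<^sup>2"
      unfolding a by (simp add: frame_metric[OF e(1) pe] G_def)
    then have "sqrt (g p \<xi> \<xi>) \<le> sqrt (B * (\<Sum>i<?r. \<bar>a i\<bar>)\<^sup>2)" by (rule real_sqrt_le_mono)
    also have "\<dots> = sqrt B * (\<Sum>i<?r. \<bar>a i\<bar>)" by (simp add: real_sqrt_mult sum_nonneg)
    also have "\<dots> \<le> sqrt B * (2 * (\<Sum>j<?r. \<bar>\<rho> p \<xi> (f j)\<bar>))"
      using co[OF pe _ a] W2(3)[of p] p by (intro mult_left_mono) (auto simp: B_def less_imp_le)
    finally show "sqrt (g p \<xi> \<xi>) \<le> sqrt B * 2 * (\<Sum>j<?r. \<bar>\<rho> p \<xi> (f j)\<bar>)" by simp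
  qed
qed

text \<open>Vectors over different base points are compared through their action on smooth
  functions; \<open>dual_coefficients\<close> turns this convergence into convergence of frame
  coefficients. A general filter allows one-sided limits at the ends of an arc.\<close>

lemma norm_tendsto:
  assumes q: "q \<in> mfd_interior At" and \<gamma>: "(\<gamma> \<longlongrightarrow> q) F"
    and \<xi>: "eventually (\<lambda>t. \<xi> t \<in> fibre A (\<gamma> t)) F" and \<zeta>: "\<zeta> \<in> fibre A q"
    and lim: "\<And>f. f \<in> smooth_funs At \<Longrightarrow> ((\<lambda>t. \<rho> (\<gamma> t) (\<xi> t) f) \<longlongrightarrow> \<rho> q \<zeta> f) F"
  shows "((\<lambda>t. g (\<gamma> t) (\<xi> t) (\<xi> t)) \<longlongrightarrow> g q \<zeta> \<zeta>) F"
proof -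
  obtain e where e: "e \<in> frames A" "q \<in> frame_dom e" by (rule frame_cover)
  let ?r = "frame_rank e"
  obtain f \<epsilon> where f: "\<And>j. j < ?r \<Longrightarrow> f j \<in> smooth_funs At" and \<epsilon>: "isCont \<epsilon> q" "\<epsilon> q = 0"
    and co: "\<And>p a \<xi>. p \<in> frame_dom e \<Longrightarrow> real ?r * \<epsilon> p \<le> 1 / 2 \<Longrightarrow>
      \<xi> = (\<Sum>i<?r. a i *\<^sub>R frame_vec e i p) \<Longrightarrow>
      (\<Sum>i<?r. \<bar>a i\<bar>) \<le> 2 * (\<Sum>j<?r. \<bar>\<rho> p \<xi> (f j)\<bar>) \<and>
      (\<forall>j<?r. \<bar>a j - \<rho> p \<xi> (f j)\<bar> \<le> 2 * \<epsilon> p * (\<Sum>j<?r. \<bar>\<rho> p \<xi> (f j)\<bar>))"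
    by (rule dual_coefficients[OF q e]) (rule that)
  define w where "w t j = \<rho> (\<gamma> t) (\<xi> t) (f j)" for t j
  have w: "((\<lambda>t. w t j) \<longlongrightarrow> \<rho> q \<zeta> (f j)) F" if "j < ?r" for j
    unfolding w_def by (rule lim[OF f[OF that]])
  have ev_dom: "eventually (\<lambda>t. \<gamma> t \<in> frame_dom e) F"
    using topological_tendstoD[OF \<gamma> open_frame_dom[OF e(1)] e(2)] .
  have \<epsilon>0: "((\<lambda>t. \<epsilon> (\<gamma> t)) \<longlongrightarrow> 0) F"
    using isCont_tendsto_compose[OF \<epsilon>(1) \<gamma>] \<epsilon>(2) by simp
  have "((\<lambda>t. real ?r * \<epsilon> (\<gamma> t)) \<longlongrightarrow> real ?r * 0) F" by (intro tendsto_intros \<epsilon>0)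
  then have ev_small: "eventually (\<lambda>t. real ?r * \<epsilon> (\<gamma> t) < 1 / 2) F"
    by (rule order_tendstoD) simp
  have "\<forall>t. \<exists>a. \<xi> t \<in> fibre A (\<gamma> t) \<longrightarrow> \<gamma> t \<in> frame_dom e \<longrightarrow>
      \<xi> t = (\<Sum>i<?r. a i *\<^sub>R frame_vec e i (\<gamma> t))"
    using frame_expand[OF e(1)] by metis
  then obtain a where a: "\<And>t. \<xi> t \<in> fibre A (\<gamma> t) \<Longrightarrow> \<gamma> t \<in> frame_dom e \<Longrightarrow>
      \<xi> t = (\<Sum>i<?r. a t i *\<^sub>R frame_vec e i (\<gamma> t))" by metis
  obtain b where b: "\<zeta> = (\<Sum>i<?r. b i *\<^sub>R frame_vec e i q)" by (rule frame_expand[OF e \<zeta>])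
  \<comment> \<open>Since \<open>\<epsilon> q = 0\<close>, the error term vanishes and the
    coefficients at \<open>q\<close> are exactly the derivatives.\<close>
  have bw: "\<rho> q \<zeta> (f j) = b j" if "j < ?r" for j using co[OF e(2) _ b] \<epsilon>(2) that by simp
  have at: "((\<lambda>t. a t j) \<longlongrightarrow> b j) F" if j: "j < ?r" for j
  proof -
    have "((\<lambda>t. 2 * \<epsilon> (\<gamma> t) * (\<Sum>j<?r. \<bar>w t j\<bar>)) \<longlongrightarrow> 2 * 0 * (\<Sum>j<?r. \<bar>\<rho> q \<zeta> (f j)\<bar>)) F"
      using w by (intro tendsto_intros \<epsilon>0) auto
    then have "((\<lambda>t. 2 * \<epsilon> (\<gamma> t) * (\<Sum>j<?r. \<bar>w t j\<bar>)) \<longlongrightarrow> 0) F" by simp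
    moreover have "eventually (\<lambda>t. norm (a t j - w t j) \<le> 2 * \<epsilon> (\<gamma> t) * (\<Sum>j<?r. \<bar>w t j\<bar>)) F"
      using \<xi> ev_dom ev_small
    proof eventually_elim
      case (elim t)
      then show ?case using co[OF elim(2) _ a[OF elim(1,2)]] j by (simp add: w_def)
    qed
    ultimately have "((\<lambda>t. a t j - w t j) \<longlongrightarrow> 0) F" by (rule Lim_null_comparison[rotated])
    from tendsto_add[OF this w[OF j]] show ?thesis by (simp add: bw[OF j])
  qed
  have G: "((\<lambda>t. g (\<gamma> t) (frame_vec e i (\<gamma> t)) (frame_vec e j (\<gamma> t))) \<longlongrightarrow> g q (frame_vec e i q) (frame_vec e j q)) F"
    if "i < ?r" "j < ?r" for i j
    using isCont_tendsto_compose[OF metric_coeff_isCont[OF e that] \<gamma>] .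
  have "((\<lambda>t. \<Sum>i<?r. \<Sum>j<?r. a t i * a t j * g (\<gamma> t) (frame_vec e i (\<gamma> t)) (frame_vec e j (\<gamma> t)))
      \<longlongrightarrow> (\<Sum>i<?r. \<Sum>j<?r. b i * b j * g q (frame_vec e i q) (frame_vec e j q))) F"
    by (intro tendsto_intros at G) auto
  moreover have "(\<Sum>i<?r. \<Sum>j<?r. b i * b j * g q (frame_vec e i q) (frame_vec e j q)) = g q \<zeta> \<zeta>"
    by (simp add: b frame_metric[OF e])
  moreover have "eventually (\<lambda>t. (\<Sum>i<?r. \<Sum>j<?r. a t i * a t j * g (\<gamma> t) (frame_vec e i (\<gamma> t)) (frame_vec e j (\<gamma> t))) =
      g (\<gamma> t) (\<xi> t) (\<xi> t)) F"
    using \<xi> ev_dom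
  proof eventually_elim
    case (elim t)
    then show ?case by (simp only: a[OF elim] frame_metric[OF e(1)])
  qed
  ultimately show ?thesis by (simp add: tendsto_cong)
qed

end

section \<open>Lengths of curves\<close>

text \<open>The fundamental theorem of calculus with finitely many exceptional points. Any
  \<open>x\<close> is allowed while the right side keeps the full length, so that one bound controls
  the whole path.\<close>

lemma abs_diff_le_integral_speed:
  fixes \<phi> L :: "real \<Rightarrow> real"
  assumes \<phi>: "continuous_on {0..1} \<phi>" and S: "finite S" and L: "L integrable_on {0..1}"
    and nonneg: "\<And>t. t \<in> {0<..<1} - S \<Longrightarrow> 0 \<le> L t" and K: "0 \<le> K"
    and deriv: "\<And>t. t \<in> {0<..<1} - S \<Longrightarrow> \<exists>d. (\<phi> has_vector_derivative d) (at t) \<and> \<bar>d\<bar> \<le> K * L t"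
    and x: "x \<in> {0..1}"
  shows "\<bar>\<phi> x - \<phi> 0\<bar> \<le> K * integral {0..1} L"
proof -
  define T where "T = S \<union> {0, 1}"
  have T: "finite T" using S by (simp add: T_def)
  \<comment> \<open>At exceptional points nothing is known of \<open>L\<close> or of the derivative.
    With the value \<open>0\<close> there, the bounds hold at every point and the integrals do not
    change.\<close>
  define L' where "L' t = (if t \<in> T then 0 else L t)" for t
  define \<phi>' where "\<phi>' t = (if t \<in> T then 0 else vector_derivative \<phi> (at t))" for t
  have off: "t \<in> {0<..<1} - S" if "t \<in> {0..1}" "t \<notin> T" for t using that by (auto simp: T_def)
  have L': "L' integrable_on {0..1}" "integral {0..1} L' = integral {0..1} L"
    using integrable_spike[OF L negligible_finite[OF T]] integral_spike[OF negligible_finite[OF T], of "{0..1}" L' L]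
    by (auto simp: L'_def)
  have L'0: "0 \<le> L' t" if "t \<in> {0..1}" for t
    using nonneg[OF off[OF that]] by (simp add: L'_def)
  have bound: "norm (\<phi>' t) \<le> K * L' t" if "t \<in> {0..1}" for t
    using deriv[OF off[OF that]] by (auto simp: \<phi>'_def L'_def dest: vector_derivative_at)
  have "(\<phi>' has_integral (\<phi> x - \<phi> 0)) {0..x}"
  proof (rule fundamental_theorem_of_calculus_interior_strong[OF T])
    show "0 \<le> x" using x by simp
    show "continuous_on {0..x} \<phi>" using x by (intro continuous_on_subset[OF \<phi>]) auto
    fix t assume t: "t \<in> {0<..<x} - T"
    then obtain d where "(\<phi> has_vector_derivative d) (at t)" using deriv[of t] off[of t] x by auto
    then show "(\<phi> has_vector_derivative \<phi>' t) (at t)"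
      using t by (simp add: \<phi>'_def vector_derivative_at)
  qed
  then have I: "\<phi>' integrable_on {0..x}" "integral {0..x} \<phi>' = \<phi> x - \<phi> 0" by (auto simp: has_integral_iff)
  have L'x: "L' integrable_on {0..x}" using x by (intro integrable_on_subinterval[OF L'(1)]) auto
  have "norm (integral {0..x} \<phi>') \<le> integral {0..x} (\<lambda>t. K * L' t)"
    using x by (intro integral_norm_bound_integral I integrable_on_mult_right L'x bound) auto
  also have "\<dots> = K * integral {0..x} L'" by simp
  also have "\<dots> \<le> K * integral {0..1} L'"
    using x by (intro mult_left_mono K integral_subset_le L'x L') (auto intro: L'0)
  finally show ?thesis by (simp add: I L')
qed

context lie_metric
begin

section \<open>Velocities and speeds along C1 arcs\<close>

lemma metric_nonneg: "\<xi> \<in> fibre A p \<Longrightarrow> 0 \<le> g p \<xi> \<xi>"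
  using metric_pos[of \<xi> p] metric_linear[of \<xi> p \<xi> \<xi> 0 0] by (cases "\<xi> = 0") auto

definition lift :: "'m \<Rightarrow> (('m \<Rightarrow> real) \<Rightarrow> real) \<Rightarrow> 'v" where
  "lift p = inv_into (fibre A p) (\<rho> p)"

lemma lift:
  assumes "p \<in> mfd_interior At" "v \<in> tangent_space At p"
  shows "lift p v \<in> fibre A p" "\<rho> p (lift p v) = v"
  using anchor_iso[OF assms(1)] assms(2) unfolding lift_def
  by (auto simp: bij_betw_def intro: inv_into_into f_inv_into_f)

definition speed :: "(real \<Rightarrow> 'm) \<Rightarrow> real \<Rightarrow> real" where
  "speed \<gamma> t = sqrt (induced_metric A \<rho> g (\<gamma> t) (velocity At \<gamma> t) (velocity At \<gamma> t))"

lemma speed_lift: "speed \<gamma> t = sqrt (g (\<gamma> t) (lift (\<gamma> t) (velocity At \<gamma> t)) (lift (\<gamma> t) (velocity At \<gamma> t)))"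
  by (simp add: speed_def induced_metric_def lift_def)

lemma curve_length_speed: "curve_length At A \<rho> g \<gamma> = integral {0..1} (speed \<gamma>)"
  by (simp add: curve_length_def speed_def[abs_def])

text \<open>For a closed interval \<open>S\<close> the derivative is one-sided at the ends, so that
  the velocity of a C1 arc is defined and continuous up to its end points.\<close>

definition velocity_within :: "real set \<Rightarrow> (real \<Rightarrow> 'm) \<Rightarrow> real \<Rightarrow> ('m \<Rightarrow> real) \<Rightarrow> real" where
  "velocity_within S \<gamma> t = (\<lambda>f. if f \<in> smooth_funs At then vector_derivative (f \<circ> \<gamma>) (at t within S) else 0)"

lemma velocity_UNIV: "velocity At \<gamma> t = velocity_within UNIV \<gamma> t"
  by (simp add: velocity_def velocity_within_def)

text \<open>Linearity and the product rule pass to derivatives along the curve; the filter has to be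
  nontrivial for these derivatives to be unique.\<close>

lemma velocity_within_tangent:
  assumes diff: "\<And>f. f \<in> smooth_funs At \<Longrightarrow> (f \<circ> \<gamma>) differentiable (at t within S)"
    and nb: "at t within S \<noteq> bot"
  shows "velocity_within S \<gamma> t \<in> tangent_space At (\<gamma> t)"
proof -
  have D: "((\<lambda>s. f (\<gamma> s)) has_vector_derivative velocity_within S \<gamma> t f) (at t within S)"
    if "f \<in> smooth_funs At" for f
    using diff[OF that] that by (simp add: velocity_within_def vector_derivative_works o_def)
  have eq: "velocity_within S \<gamma> t f = d"
    if "f \<in> smooth_funs At" "((\<lambda>s. f (\<gamma> s)) has_vector_derivative d) (at t within S)" for f d
    using vector_derivative_within[OF nb that(2)] that(1) by (simp add: velocity_within_def o_def)
  show ?thesis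
    unfolding tangent_space_def
  proof (intro CollectI conjI allI ballI impI)
    fix f h a b assume fh: "f \<in> smooth_funs At" "h \<in> smooth_funs At"
    show "velocity_within S \<gamma> t (\<lambda>q. a * f q + b * h q) =
        a * velocity_within S \<gamma> t f + b * velocity_within S \<gamma> t h"
      by (rule eq[OF smooth_funs_lincomb[OF fh]])
        (intro has_vector_derivative_add has_vector_derivative_mult_right D fh)
    show "velocity_within S \<gamma> t (\<lambda>q. f q * h q) =
        f (\<gamma> t) * velocity_within S \<gamma> t h + h (\<gamma> t) * velocity_within S \<gamma> t f"
      using eq[OF smooth_funs_mult[OF fh] has_vector_derivative_mult[OF D[OF fh(1)] D[OF fh(2)]]]
      by (simp add: mult.commute)
  qed (simp add: velocity_within_def)
qed

context
  fixes \<gamma> :: "real \<Rightarrow> 'm" and a b :: real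
  assumes arc: "C1_arc At \<gamma> a b" and ab: "a < b"
    and cont: "continuous_on {a..b} \<gamma>" and interior: "\<gamma> ` {a..b} \<subseteq> mfd_interior At"
begin

lemma arc_within_tangent:
  assumes "t \<in> {a..b}"
  shows "velocity_within {a..b} \<gamma> t \<in> tangent_space At (\<gamma> t)"
proof (rule velocity_within_tangent)
  show "(f \<circ> \<gamma>) differentiable at t within {a..b}" if "f \<in> smooth_funs At" for f
    using arc that assms by (simp add: C1_arc_def differentiable_on_def)
  show "at t within {a..b} \<noteq> bot"
    using assms ab by (simp add: trivial_limit_within islimpt_Icc)
qed

lemma arc_velocity:
  assumes "t \<in> {a<..<b}"
  shows "velocity At \<gamma> t = velocity_within {a..b} \<gamma> t"
proof -
  have at: "at t within {a..b} = at t" using assms by (simp add: at_within_Icc_at)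
  show ?thesis unfolding velocity_UNIV velocity_within_def at ..
qed

lemma arc_interior:
  assumes t: "t \<in> {a<..<b}"
  shows "velocity At \<gamma> t \<in> tangent_space At (\<gamma> t)"
    and "f \<in> smooth_funs At \<Longrightarrow> ((\<lambda>s. f (\<gamma> s)) has_vector_derivative velocity At \<gamma> t f) (at t)"
proof -
  show "velocity At \<gamma> t \<in> tangent_space At (\<gamma> t)"
    using arc_within_tangent[of t] arc_velocity[OF t] t by simp
  assume f: "f \<in> smooth_funs At"
  then have "(f \<circ> \<gamma>) differentiable at t within {a..b}"
    using arc t by (simp add: C1_arc_def differentiable_on_def)
  then have "(f \<circ> \<gamma>) differentiable at t" using t by (simp add: at_within_Icc_at)
  then show "((\<lambda>s. f (\<gamma> s)) has_vector_derivative velocity At \<gamma> t f) (at t)"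
    using f by (simp add: velocity_def vector_derivative_works o_def)
qed

text \<open>With one-sided velocities the speed is continuous on the closed interval, and
  \<open>speed\<close> agrees with it off the two end points. Integrability matters because
  \<open>integral\<close> has a default value on other functions, which would make lengths
  meaningless.\<close>

lemma arc_speed_integrable: "speed \<gamma> integrable_on {a..b}"
proof -
  define \<xi> where "\<xi> t = lift (\<gamma> t) (velocity_within {a..b} \<gamma> t)" for t
  have \<xi>: "\<xi> t \<in> fibre A (\<gamma> t)" "\<rho> (\<gamma> t) (\<xi> t) = velocity_within {a..b} \<gamma> t" if "t \<in> {a..b}" for t
  proof -
    have "\<gamma> t \<in> mfd_interior At" using interior that by blast
    from lift[OF this arc_within_tangent[OF that]]
    show "\<xi> t \<in> fibre A (\<gamma> t)" "\<rho> (\<gamma> t) (\<xi> t) = velocity_within {a..b} \<gamma> t" by (simp_all add: \<xi>_def)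
  qed
  have ev: "eventually (\<lambda>s. s \<in> {a..b}) (at t within {a..b})" for t
    by (simp add: eventually_at_filter)
  have "continuous_on {a..b} (\<lambda>t. g (\<gamma> t) (\<xi> t) (\<xi> t))"
    unfolding continuous_on_def
  proof
    fix t assume t: "t \<in> {a..b}"
    show "((\<lambda>t. g (\<gamma> t) (\<xi> t) (\<xi> t)) \<longlongrightarrow> g (\<gamma> t) (\<xi> t) (\<xi> t)) (at t within {a..b})"
    proof (rule norm_tendsto)
      show "\<gamma> t \<in> mfd_interior At" using interior t by auto
      show "(\<gamma> \<longlongrightarrow> \<gamma> t) (at t within {a..b})" using cont t by (simp add: continuous_on_def)
      show "eventually (\<lambda>t. \<xi> t \<in> fibre A (\<gamma> t)) (at t within {a..b})"
        using ev by (rule eventually_mono) (rule \<xi>)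
      show "\<xi> t \<in> fibre A (\<gamma> t)" by (rule \<xi>[OF t])
      fix f assume f: "f \<in> smooth_funs At"
      have "continuous_on {a..b} (\<lambda>t. velocity_within {a..b} \<gamma> t f)"
        using arc f by (simp add: C1_arc_def velocity_within_def)
      then have "((\<lambda>s. velocity_within {a..b} \<gamma> s f) \<longlongrightarrow> \<rho> (\<gamma> t) (\<xi> t) f) (at t within {a..b})"
        using t \<xi>(2)[OF t] by (simp add: continuous_on_def)
      moreover have "eventually (\<lambda>s. velocity_within {a..b} \<gamma> s f = \<rho> (\<gamma> s) (\<xi> s) f) (at t within {a..b})"
        using ev by (rule eventually_mono) (simp add: \<xi>(2))
      ultimately show "((\<lambda>t. \<rho> (\<gamma> t) (\<xi> t) f) \<longlongrightarrow> \<rho> (\<gamma> t) (\<xi> t) f) (at t within {a..b})"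
        by (rule Lim_transform_eventually)
    qed
  qed
  then have "(\<lambda>t. sqrt (g (\<gamma> t) (\<xi> t) (\<xi> t))) integrable_on {a..b}"
    by (intro integrable_continuous_interval continuous_intros)
  then show ?thesis
  proof (rule integrable_spike)
    show "negligible {a, b}" by simp
    show "speed \<gamma> t = sqrt (g (\<gamma> t) (\<xi> t) (\<xi> t))" if "t \<in> {a..b} - {a, b}" for t
      using arc_velocity[of t] that by (auto simp: speed_lift \<xi>_def)
  qed
qed

end

section \<open>Growth of functions along piecewise C1 curves in the interior\<close>

definition admissible :: "(real \<Rightarrow> 'm) \<Rightarrow> bool" where
  "admissible \<gamma> \<longleftrightarrow> piecewise_C1_curve At \<gamma> \<and> \<gamma> ` {0..1} \<subseteq> mfd_interior At"

text \<open>Integrability is assembled from piece to piece. \<open>S\<close> consists of the break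
  points, between which the two-sided velocity is a genuine tangent vector.\<close>

lemma admissible_pieces:
  assumes "admissible \<gamma>"
  obtains S where "finite S" "speed \<gamma> integrable_on {0..1}"
    "\<And>t. t \<in> {0<..<1} - S \<Longrightarrow> velocity At \<gamma> t \<in> tangent_space At (\<gamma> t)"
    "\<And>t f. t \<in> {0<..<1} - S \<Longrightarrow> f \<in> smooth_funs At \<Longrightarrow>
      ((\<lambda>s. f (\<gamma> s)) has_vector_derivative velocity At \<gamma> t f) (at t)"
proof -
  have cont: "continuous_on {0..1} \<gamma>" and int: "\<gamma> ` {0..1} \<subseteq> mfd_interior At"
    using assms by (auto simp: admissible_def piecewise_C1_curve_def)
  obtain m \<tau> where \<tau>: "\<tau> 0 = 0" "\<tau> m = 1" "\<And>i. i < m \<Longrightarrow> \<tau> i < \<tau> (Suc i)"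
    "\<And>i. i < m \<Longrightarrow> C1_arc At \<gamma> (\<tau> i) (\<tau> (Suc i))"
    using assms by (auto simp: admissible_def piecewise_C1_curve_def)
  have mono: "\<tau> i \<le> \<tau> j" if "i \<le> j" "j \<le> m" for i j
    using that
  proof (induction j)
    case (Suc j)
    then show ?case using \<tau>(3)[of j] by (cases "i = Suc j") auto
  qed simp
  have range: "0 \<le> \<tau> i" "\<tau> i \<le> 1" if "i \<le> m" for i
    using mono[of 0 i] mono[of i m] that \<tau>(1,2) by auto
  have sub: "{\<tau> i..\<tau> (Suc i)} \<subseteq> {0..1}" if "i < m" for i
    using range[of i] range[of "Suc i"] that by auto
  have arc: "C1_arc At \<gamma> (\<tau> i) (\<tau> (Suc i))" "\<tau> i < \<tau> (Suc i)" "continuous_on {\<tau> i..\<tau> (Suc i)} \<gamma>"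
    "\<gamma> ` {\<tau> i..\<tau> (Suc i)} \<subseteq> mfd_interior At" if "i < m" for i
    using \<tau>(3,4)[OF that] continuous_on_subset[OF cont sub[OF that]] int sub[OF that] by blast+
  have "speed \<gamma> integrable_on {0..\<tau> i}" if "i \<le> m" for i
    using that
  proof (induction i)
    case 0
    then show ?case using integrable_on_refl[of "speed \<gamma>" 0] \<tau>(1) by simp
  next
    case (Suc i)
    show ?case
    proof (rule Henstock_Kurzweil_Integration.integrable_combine)
      show "0 \<le> \<tau> i" "\<tau> i \<le> \<tau> (Suc i)" using range[of i] \<tau>(3)[of i] Suc.prems by auto
      show "speed \<gamma> integrable_on {0..\<tau> i}" using Suc by simp
      show "speed \<gamma> integrable_on {\<tau> i..\<tau> (Suc i)}"
        using Suc.prems by (intro arc_speed_integrable arc) auto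
    qed
  qed
  from this[OF order_refl] have I: "speed \<gamma> integrable_on {0..1}" by (simp add: \<tau>(2))
  have piece: "\<exists>i<k. t \<in> {\<tau> i<..<\<tau> (Suc i)}" if "k \<le> m" "0 < t" "t < \<tau> k" "t \<notin> \<tau> ` {..m}" for t k
    using that
  proof (induction k)
    case 0
    then show ?case using \<tau>(1) by simp
  next
    case (Suc k)
    then have "t \<noteq> \<tau> k" by (metis Suc_leD atMost_iff imageI)
    then consider "t < \<tau> k" | "\<tau> k < t" by linarith
    then show ?case
    proof cases
      case 1
      with Suc show ?thesis by (metis Suc_leD less_SucI)
    next
      case 2
      with Suc.prems show ?thesis by (intro exI[of _ k]) auto
    qed
  qed
  have piece: "\<exists>i<m. t \<in> {\<tau> i<..<\<tau> (Suc i)}" if "t \<in> {0<..<1} - \<tau> ` {..m}" for t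
    using piece[of m t] that \<tau>(2) by auto
  show thesis
  proof (rule that[of "\<tau> ` {..m}"])
    show "velocity At \<gamma> t \<in> tangent_space At (\<gamma> t)" if "t \<in> {0<..<1} - \<tau> ` {..m}" for t
      using piece[OF that] arc_interior(1)[OF arc] by blast
    show "((\<lambda>s. f (\<gamma> s)) has_vector_derivative velocity At \<gamma> t f) (at t)"
      if "t \<in> {0<..<1} - \<tau> ` {..m}" "f \<in> smooth_funs At" for t f
      using piece[OF that(1)] arc_interior(2)[OF arc _ that(2)] by blast
  qed (use I in auto)
qed

text \<open>\<open>h\<close> need not be smooth on \<open>M\<close>, since \<open>ln u\<close> has
  to be covered. Only its derivative along the curve is asked for, in terms of a vector
  \<open>\<xi>\<close> that is known through its action on smooth functions.\<close>

lemma admissible_estimate: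
  assumes \<gamma>: "admissible \<gamma>" and h: "continuous_on {0..1} (\<lambda>t. h (\<gamma> t))" and C: "0 \<le> C"
    and deriv: "\<And>t \<xi>. t \<in> {0<..<1} \<Longrightarrow> \<xi> \<in> fibre A (\<gamma> t) \<Longrightarrow>
      (\<And>f. f \<in> smooth_funs At \<Longrightarrow> ((\<lambda>s. f (\<gamma> s)) has_vector_derivative \<rho> (\<gamma> t) \<xi> f) (at t)) \<Longrightarrow>
      \<exists>d. ((\<lambda>s. h (\<gamma> s)) has_vector_derivative d) (at t) \<and> \<bar>d\<bar> \<le> C * sqrt (g (\<gamma> t) \<xi> \<xi>)"
    and x: "x \<in> {0..1}"
  shows "\<bar>h (\<gamma> x) - h (\<gamma> 0)\<bar> \<le> C * curve_length At A \<rho> g \<gamma>"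
proof -
  obtain S where S: "finite S" "speed \<gamma> integrable_on {0..1}"
    and v: "\<And>t. t \<in> {0<..<1} - S \<Longrightarrow> velocity At \<gamma> t \<in> tangent_space At (\<gamma> t)"
    and D: "\<And>t f. t \<in> {0<..<1} - S \<Longrightarrow> f \<in> smooth_funs At \<Longrightarrow>
      ((\<lambda>s. f (\<gamma> s)) has_vector_derivative velocity At \<gamma> t f) (at t)"
    by (rule admissible_pieces[OF \<gamma>]) (rule that)
  have l: "lift (\<gamma> t) (velocity At \<gamma> t) \<in> fibre A (\<gamma> t)"
    "\<rho> (\<gamma> t) (lift (\<gamma> t) (velocity At \<gamma> t)) = velocity At \<gamma> t" if "t \<in> {0<..<1} - S" for t
    using lift[OF _ v[OF that]] \<gamma> that by (auto simp: admissible_def image_subset_iff)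
  show ?thesis
    unfolding curve_length_speed
  proof (rule abs_diff_le_integral_speed[OF h S _ C _ x])
    fix t assume t: "t \<in> {0<..<1} - S"
    show "0 \<le> speed \<gamma> t" using metric_nonneg[OF l(1)[OF t]] by (simp add: speed_lift)
    show "\<exists>d. ((\<lambda>s. h (\<gamma> s)) has_vector_derivative d) (at t) \<and> \<bar>d\<bar> \<le> C * speed \<gamma> t"
      unfolding speed_lift
    proof (rule deriv[OF _ l(1)[OF t]])
      show "t \<in> {0<..<1}" using t by simp
      show "((\<lambda>s. f (\<gamma> s)) has_vector_derivative \<rho> (\<gamma> t) (lift (\<gamma> t) (velocity At \<gamma> t)) f) (at t)"
        if "f \<in> smooth_funs At" for f
        unfolding l(2)[OF t] by (rule D[OF t that])
    qed
  qed
qed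

lemma admissible_continuous: "admissible \<gamma> \<Longrightarrow> continuous_on {0..1} \<gamma>"
  by (simp add: admissible_def piecewise_C1_curve_def)

lemma curve_length_nonneg:
  assumes "admissible \<gamma>"
  shows "0 \<le> curve_length At A \<rho> g \<gamma>"
proof -
  \<comment> \<open>The general estimate for the zero function with constant
    \<open>1\<close>.\<close>
  have "\<bar>0 - (0::real)\<bar> \<le> 1 * curve_length At A \<rho> g \<gamma>"
    by (rule admissible_estimate[OF assms, where h="\<lambda>_. 0" and x=0])
      (auto intro!: exI[of _ 0] metric_nonneg)
  then show ?thesis by simp
qed

text \<open>Integrates \<open>anchor_bound_smooth\<close> along the curve. Every parameter
  \<open>x\<close> is covered because a bump function will also serve to confine whole curves to a
  neighbourhood.\<close>

lemma smooth_lipschitz: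
  assumes f: "f \<in> smooth_funs At"
  obtains C where "0 \<le> C" "\<And>\<gamma> x. admissible \<gamma> \<Longrightarrow> x \<in> {0..1} \<Longrightarrow>
    \<bar>f (\<gamma> x) - f (\<gamma> 0)\<bar> \<le> C * curve_length At A \<rho> g \<gamma>"
proof -
  obtain C where C: "0 \<le> C" "\<And>p \<xi>. \<xi> \<in> fibre A p \<Longrightarrow> \<bar>\<rho> p \<xi> f\<bar> \<le> C * sqrt (g p \<xi> \<xi>)"
    by (rule anchor_bound_smooth[OF f]) (rule that)
  show thesis
  proof (rule that[OF C(1)])
    fix \<gamma> and x :: real assume \<gamma>: "admissible \<gamma>" and x: "x \<in> {0..1}"
    show "\<bar>f (\<gamma> x) - f (\<gamma> 0)\<bar> \<le> C * curve_length At A \<rho> g \<gamma>"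
    proof (rule admissible_estimate[OF \<gamma> _ C(1) _ x])
      show "continuous_on {0..1} (\<lambda>t. f (\<gamma> t))"
        by (rule continuous_on_compose2[OF smooth_funs_continuous[OF f] admissible_continuous[OF \<gamma>] subset_UNIV])
      fix t \<xi> assume "\<xi> \<in> fibre A (\<gamma> t)"
        "\<And>f. f \<in> smooth_funs At \<Longrightarrow> ((\<lambda>s. f (\<gamma> s)) has_vector_derivative \<rho> (\<gamma> t) \<xi> f) (at t)"
      then show "\<exists>d. ((\<lambda>s. f (\<gamma> s)) has_vector_derivative d) (at t) \<and> \<bar>d\<bar> \<le> C * sqrt (g (\<gamma> t) \<xi> \<xi>)"
        using C(2) f by blast
    qed
  qed
qed

text \<open>The derivative of \<open>ln u\<close> is that of \<open>u\<close> divided by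
  \<open>u\<close>, so the weight \<open>u p\<close> cancels. The curve must run inside
  \<open>W\<close>, where the weighted bound is available.\<close>

lemma ln_weight_lipschitz:
  assumes u: "u \<in> smooth_funs At" "\<And>p. p \<in> mfd_interior At \<Longrightarrow> 0 < u p" and C: "0 \<le> C"
    and W: "\<And>p \<xi>. p \<in> W \<Longrightarrow> \<xi> \<in> fibre A p \<Longrightarrow> \<bar>\<rho> p \<xi> u\<bar> \<le> C * u p * sqrt (g p \<xi> \<xi>)"
    and \<gamma>: "admissible \<gamma>" "\<And>t. t \<in> {0..1} \<Longrightarrow> \<gamma> t \<in> W"
  shows "\<bar>ln (u (\<gamma> 1)) - ln (u (\<gamma> 0))\<bar> \<le> C * curve_length At A \<rho> g \<gamma>"
proof (rule admissible_estimate[OF \<gamma>(1) _ C])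
  have pos: "0 < u (\<gamma> t)" if "t \<in> {0..1}" for t
    using \<gamma>(1) that by (intro u(2)) (auto simp: admissible_def)
  have "continuous_on {0..1} (\<lambda>t. u (\<gamma> t))"
    by (rule continuous_on_compose2[OF smooth_funs_continuous[OF u(1)] admissible_continuous[OF \<gamma>(1)] subset_UNIV])
  moreover have "\<forall>t\<in>{0..1}. u (\<gamma> t) \<noteq> 0" using pos by (metis less_irrefl)
  ultimately show "continuous_on {0..1} (\<lambda>t. ln (u (\<gamma> t)))" by (rule continuous_on_ln)
  fix t \<xi> assume t: "t \<in> {0<..<1}" and \<xi>: "\<xi> \<in> fibre A (\<gamma> t)"
    and D: "\<And>f. f \<in> smooth_funs At \<Longrightarrow> ((\<lambda>s. f (\<gamma> s)) has_vector_derivative \<rho> (\<gamma> t) \<xi> f) (at t)"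
  have p: "0 < u (\<gamma> t)" using pos t by simp
  have "((\<lambda>s. u (\<gamma> s)) has_real_derivative \<rho> (\<gamma> t) \<xi> u) (at t)"
    using D[OF u(1)] by (simp add: has_real_derivative_iff_has_vector_derivative)
  from DERIV_chain2[OF DERIV_ln[OF p] this]
  have "((\<lambda>s. ln (u (\<gamma> s))) has_vector_derivative inverse (u (\<gamma> t)) * \<rho> (\<gamma> t) \<xi> u) (at t)"
    by (simp add: has_real_derivative_iff_has_vector_derivative)
  moreover have "\<bar>inverse (u (\<gamma> t)) * \<rho> (\<gamma> t) \<xi> u\<bar> \<le> C * sqrt (g (\<gamma> t) \<xi> \<xi>)"
  proof -
    have "\<bar>\<rho> (\<gamma> t) \<xi> u\<bar> \<le> C * u (\<gamma> t) * sqrt (g (\<gamma> t) \<xi> \<xi>)" using W[OF \<gamma>(2) \<xi>] t by simp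
    then show ?thesis using p by (simp add: abs_mult field_simps)
  qed
  ultimately show "\<exists>d. ((\<lambda>s. ln (u (\<gamma> s))) has_vector_derivative d) (at t) \<and> \<bar>d\<bar> \<le> C * sqrt (g (\<gamma> t) \<xi> \<xi>)"
    by blast
qed simp

subsection \<open>Short curves near interior points\<close>

text \<open>The sum of the absolute partial derivatives is continuous, so on a smaller ball it is at
  most its value at the centre plus \<open>1\<close>.\<close>

lemma local_extension_bounded:
  assumes c: "c \<in> At" "q \<in> chart_dom c" and f: "f \<in> smooth_funs At"
  obtains r F M where "r > 0" "\<And>k. Ck_on k F (ball (chart_map c q) r)" "0 \<le> M"
    "\<And>y. y \<in> quadrant N (chart_corner c) \<Longrightarrow> y \<in> ball (chart_map c q) r \<Longrightarrow>
      chart_inv c y \<in> chart_dom c \<and> chart_map c (chart_inv c y) = y \<and> F y = f (chart_inv c y)"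
    "\<And>y z. y \<in> ball (chart_map c q) r \<Longrightarrow> \<bar>frechet_derivative F (at y) z\<bar> \<le> M * norm z"
proof -
  let ?y = "chart_map c q"
  obtain r F where r: "r > 0" and F: "\<And>k. Ck_on k F (ball ?y r)"
    and loc: "\<And>y. y \<in> quadrant N (chart_corner c) \<Longrightarrow> y \<in> ball ?y r \<Longrightarrow>
      chart_inv c y \<in> chart_dom c \<and> chart_map c (chart_inv c y) = y \<and> F y = f (chart_inv c y)"
    by (rule local_extension[OF c f]) (rule that)
  define S where "S y = (\<Sum>b\<in>Basis. \<bar>frechet_derivative F (at y) b\<bar>)" for y
  have "continuous_on (ball ?y r) S"
    unfolding S_def using F[of 1] by (intro continuous_intros) simp
  then have "isCont S ?y" using r by (simp add: continuous_on_eq_continuous_at)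
  then obtain V where V: "open V" "?y \<in> V" "\<forall>y\<in>V. \<bar>S y\<bar> \<le> \<bar>S ?y\<bar> + 1"
    using isCont_locally_bounded by blast
  obtain s where s: "s > 0" "ball ?y s \<subseteq> V" using V(1,2) by (meson open_contains_ball)
  show thesis
  proof (rule that[of "min r s" F "\<bar>S ?y\<bar> + 1"])
    show "Ck_on k F (ball ?y (min r s))" for k by (rule Ck_on_subset[OF F]) auto
    fix y z assume y: "y \<in> ball ?y (min r s)"
    then have "y \<in> ball ?y r" by simp
    from Ck_on_has_derivative[OF F open_ball this] have L: "linear (frechet_derivative F (at y))"
      by (rule has_derivative_linear)
    have "frechet_derivative F (at y) (\<Sum>b\<in>Basis. (z \<bullet> b) *\<^sub>R b) = (\<Sum>b\<in>Basis. (z \<bullet> b) * frechet_derivative F (at y) b)"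
      by (simp only: linear_sum[OF L] linear_scale[OF L] real_scaleR_def)
    then have "\<bar>frechet_derivative F (at y) z\<bar> = \<bar>\<Sum>b\<in>Basis. (z \<bullet> b) * frechet_derivative F (at y) b\<bar>"
      by (simp only: euclidean_representation)
    also have "\<dots> \<le> (\<Sum>b\<in>Basis. norm z * \<bar>frechet_derivative F (at y) b\<bar>)"
      by (intro order_trans[OF sum_abs] sum_mono) (auto simp: abs_mult intro!: mult_right_mono Basis_le_norm)
    also have "\<dots> = norm z * S y" by (simp add: S_def sum_distrib_left)
    also have "\<dots> \<le> norm z * (\<bar>S ?y\<bar> + 1)"
      using V(3) s(2) y by (intro mult_left_mono) (auto simp: abs_le_iff subset_iff)
    finally show "\<bar>frechet_derivative F (at y) z\<bar> \<le> (\<bar>S ?y\<bar> + 1) * norm z" by (simp add: mult.commute)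
  qed (use r s loc in auto)
qed

text \<open>Where all constraints are strict, a ball of \<open>span N\<close> lies in the image of
  the chart, and straight segments in it are admissible. Their velocities act as directional
  derivatives of extensions, which is what makes their lengths easy to estimate.\<close>

lemma chart_segment:
  assumes c: "c \<in> At"
    and B: "\<forall>y\<in>span N \<inter> ball y0 \<delta>. (\<forall>b\<in>chart_corner c. 0 < y \<bullet> b) \<and>
      chart_inv c y \<in> chart_dom c \<and> chart_map c (chart_inv c y) = y"
    and y: "y \<in> span N \<inter> ball y0 \<delta>" "y' \<in> span N \<inter> ball y0 \<delta>"
  defines "\<gamma> \<equiv> \<lambda>s. chart_inv c (y + s *\<^sub>R (y' - y))"
  shows "admissible \<gamma>"
    and "f \<in> smooth_funs At \<Longrightarrow> (\<And>k. Ck_on k F (ball y0 \<delta>)) \<Longrightarrow>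
      (\<And>y. y \<in> span N \<Longrightarrow> y \<in> ball y0 \<delta> \<Longrightarrow> F y = f (chart_inv c y)) \<Longrightarrow> t \<in> {0..1} \<Longrightarrow>
      velocity At \<gamma> t f = frechet_derivative F (at (y + t *\<^sub>R (y' - y))) (y' - y)"
    and "t \<in> {0..1} \<Longrightarrow> velocity At \<gamma> t \<in> tangent_space At (\<gamma> t)"
proof -
  define z where "z = y' - y"
  \<comment> \<open>An open set of parameters around the unit interval: the segment continues a
    little beyond its ends, so two-sided derivatives exist at \<open>0\<close> and \<open>1\<close>
    too.\<close>
  define J where "J = {s. y + s *\<^sub>R z \<in> ball y0 \<delta>}"
  have zN: "y + s *\<^sub>R z \<in> span N" for s
    using y unfolding z_def by (intro span_add span_scale span_diff) auto
  have "open ((\<lambda>s. y + s *\<^sub>R z) -` ball y0 \<delta>)"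
    by (intro open_vimage open_ball continuous_intros)
  then have J: "open J" by (simp add: J_def vimage_def)
  have J01: "{0..1} \<subseteq> J"
  proof
    fix s :: real assume s: "s \<in> {0..1}"
    have "(1 - s) *\<^sub>R y + s *\<^sub>R y' \<in> ball y0 \<delta>"
      using y s by (intro convexD[OF convex_ball]) auto
    then show "s \<in> J" by (simp add: J_def z_def algebra_simps)
  qed
  have pt: "\<forall>b\<in>chart_corner c. 0 < (y + s *\<^sub>R z) \<bullet> b" "\<gamma> s \<in> chart_dom c" "chart_map c (\<gamma> s) = y + s *\<^sub>R z"
    if "s \<in> J" for s
    using B[rule_format, of "y + s *\<^sub>R z"] zN[of s] that by (auto simp: J_def \<gamma>_def z_def)
  have quad: "y + s *\<^sub>R z \<in> quadrant N (chart_corner c)" if "s \<in> J" for s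
    using zN pt(1)[OF that] by (auto simp: quadrant_def less_imp_le)
  have deriv: "((f \<circ> \<gamma>) has_vector_derivative frechet_derivative F (at (y + s *\<^sub>R z)) z) (at s)"
    if F: "\<And>k. Ck_on k F U" "open U" and s: "y + s *\<^sub>R z \<in> U" "s \<in> J"
      and Ff: "\<And>s. s \<in> J \<Longrightarrow> y + s *\<^sub>R z \<in> U \<Longrightarrow> F (y + s *\<^sub>R z) = f (\<gamma> s)" for F U s and f :: "'m \<Rightarrow> real"
  proof -
    have "((\<lambda>s. F (y + s *\<^sub>R z)) has_vector_derivative frechet_derivative F (at (y + s *\<^sub>R z)) z) (at s)"
      using Ck_on_line_derivative[OF F s(1)] by (simp add: has_real_derivative_iff_has_vector_derivative)
    moreover have "open (J \<inter> (\<lambda>s. y + s *\<^sub>R z) -` U)"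
      by (intro open_Int J open_vimage F(2) continuous_intros)
    ultimately show ?thesis
      by (rule has_vector_derivative_transform_within_open) (use s Ff in auto)
  qed
  \<comment> \<open>A smooth extension of \<open>f\<close> is at hand only near each single point of
    the segment, so regularity is checked parameter by parameter.\<close>
  have C1: "(f \<circ> \<gamma>) differentiable (at s) \<and> isCont (\<lambda>s. vector_derivative (f \<circ> \<gamma>) (at s)) s"
    if f: "f \<in> smooth_funs At" and s: "s \<in> J" for f s
  proof -
    obtain r F where r: "r > 0" and F: "\<And>k. Ck_on k F (ball (chart_map c (\<gamma> s)) r)"
      and loc: "\<And>y. y \<in> quadrant N (chart_corner c) \<Longrightarrow> y \<in> ball (chart_map c (\<gamma> s)) r \<Longrightarrow>
        chart_inv c y \<in> chart_dom c \<and> chart_map c (chart_inv c y) = y \<and> F y = f (chart_inv c y)"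
      by (rule local_extension[OF c pt(2)[OF s] f]) (rule that)
    let ?U = "ball (chart_map c (\<gamma> s)) r"
    have sU: "y + s *\<^sub>R z \<in> ?U" using pt(3)[OF s] r by simp
    have D: "((f \<circ> \<gamma>) has_vector_derivative frechet_derivative F (at (y + t *\<^sub>R z)) z) (at t)"
      if "t \<in> J" "y + t *\<^sub>R z \<in> ?U" for t
      by (rule deriv[OF F open_ball that(2,1)]) (use loc[OF quad] in \<open>auto simp: \<gamma>_def z_def\<close>)
    have "continuous_on ?U (\<lambda>x. frechet_derivative F (at x) z)" using F[of 1] by simp
    then have "isCont (\<lambda>x. frechet_derivative F (at x) z) (y + s *\<^sub>R z)"
      using sU by (simp add: continuous_on_eq_continuous_at)
    then have C: "isCont (\<lambda>t. frechet_derivative F (at (y + t *\<^sub>R z)) z) s"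
      by (rule isCont_o2[rotated]) (intro continuous_intros)
    have "open (J \<inter> (\<lambda>s. y + s *\<^sub>R z) -` ?U)"
      by (intro open_Int J open_vimage open_ball continuous_intros)
    then have "eventually (\<lambda>t. t \<in> J \<inter> (\<lambda>s. y + s *\<^sub>R z) -` ?U) (nhds s)"
      by (rule eventually_nhds_in_open) (use s sU in auto)
    then have "eventually (\<lambda>t. vector_derivative (f \<circ> \<gamma>) (at t) = frechet_derivative F (at (y + t *\<^sub>R z)) z) (nhds s)"
    proof (rule eventually_mono)
      fix t assume "t \<in> J \<inter> (\<lambda>s. y + s *\<^sub>R z) -` ?U"
      then have "t \<in> J" "y + t *\<^sub>R z \<in> ?U" by blast+
      then show "vector_derivative (f \<circ> \<gamma>) (at t) = frechet_derivative F (at (y + t *\<^sub>R z)) z"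
        by (intro vector_derivative_at D)
    qed
    from isCont_cong[OF this] C have "isCont (\<lambda>s. vector_derivative (f \<circ> \<gamma>) (at s)) s" by (rule iffD2)
    moreover have "(f \<circ> \<gamma>) differentiable (at s)"
      using D[OF s sU] by (rule differentiableI_vector)
    ultimately show ?thesis by blast
  qed
  have cont: "continuous_on {0..1} \<gamma>"
    unfolding \<gamma>_def
  proof (rule continuous_on_compose2[OF continuous_chart_inv[OF c]])
    show "continuous_on {0..1} (\<lambda>s. y + s *\<^sub>R (y' - y))" by (intro continuous_intros)
    show "(\<lambda>s. y + s *\<^sub>R (y' - y)) ` {0..1} \<subseteq> chart_map c ` chart_dom c"
    proof (rule image_subsetI)
      fix s :: real assume "s \<in> {0..1}"
      then have "s \<in> J" using J01 by blast
      then show "y + s *\<^sub>R (y' - y) \<in> chart_map c ` chart_dom c"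
        using pt(2,3)[of s] unfolding z_def by (metis imageI)
    qed
  qed
  have vd: "vector_derivative (f \<circ> \<gamma>) (at s within {0..1}) = vector_derivative (f \<circ> \<gamma>) (at s)"
    if f: "f \<in> smooth_funs At" and s: "s \<in> {0..1}" for f s
  proof (rule vector_derivative_within)
    show "at s within {0..1} \<noteq> bot" using s by (simp add: trivial_limit_within islimpt_Icc)
    have "(f \<circ> \<gamma>) differentiable (at s)" using C1[OF f] s J01 by blast
    then show "((f \<circ> \<gamma>) has_vector_derivative vector_derivative (f \<circ> \<gamma>) (at s)) (at s within {0..1})"
      by (intro has_vector_derivative_at_within[OF vector_derivative_works[THEN iffD1]])
  qed
  have "C1_arc At \<gamma> 0 1"
    unfolding C1_arc_def
  proof (intro ballI conjI)
    fix f assume f: "f \<in> smooth_funs At"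
    show "(f \<circ> \<gamma>) differentiable_on {0..1}"
      using C1[OF f] J01 unfolding differentiable_on_def by (blast intro: differentiable_at_withinI)
    have "continuous_on {0..1} (\<lambda>t. vector_derivative (f \<circ> \<gamma>) (at t))"
      using C1[OF f] J01 by (blast intro: continuous_at_imp_continuous_on)
    then show "continuous_on {0..1} (\<lambda>t. vector_derivative (f \<circ> \<gamma>) (at t within {0..1}))"
      by (rule continuous_on_eq) (simp add: vd[OF f])
  qed
  \<comment> \<open>There is one piece, with \<open>real\<close> supplying the end points
    \<open>0\<close> and \<open>1\<close>.\<close>
  then have "piecewise_C1_curve At \<gamma>"
    unfolding piecewise_C1_curve_def using cont
    by (intro conjI exI[of _ "Suc 0"] exI[of _ real]) auto
  moreover have "\<gamma> ` {0..1} \<subseteq> mfd_interior At"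
  proof (rule image_subsetI)
    fix s :: real assume "s \<in> {0..1}"
    then have "s \<in> J" using J01 by blast
    then show "\<gamma> s \<in> mfd_interior At" using interior_iff[OF c pt(2)] pt(1,3) by simp
  qed
  ultimately show "admissible \<gamma>" by (simp add: admissible_def)
  show "velocity At \<gamma> t f = frechet_derivative F (at (y + t *\<^sub>R (y' - y))) (y' - y)"
    if "f \<in> smooth_funs At" "\<And>k. Ck_on k F (ball y0 \<delta>)"
      "\<And>y. y \<in> span N \<Longrightarrow> y \<in> ball y0 \<delta> \<Longrightarrow> F y = f (chart_inv c y)" "t \<in> {0..1}"
  proof -
    have "t \<in> J" using J01 that(4) by blast
    then have "((f \<circ> \<gamma>) has_vector_derivative frechet_derivative F (at (y + t *\<^sub>R z)) z) (at t)"
      using that(3)[OF zN] by (intro deriv[OF that(2) open_ball]) (auto simp: J_def \<gamma>_def z_def)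
    then show ?thesis using that(1) by (simp add: velocity_def vector_derivative_at z_def)
  qed
  show "velocity At \<gamma> t \<in> tangent_space At (\<gamma> t)" if "t \<in> {0..1}"
    unfolding velocity_UNIV using C1 J01 that by (intro velocity_within_tangent) auto
qed

lemma riemannian_dist_le:
  assumes "admissible \<gamma>" "\<gamma> 0 = p" "\<gamma> 1 = q"
  shows "riemannian_dist At A \<rho> g p q \<le> ereal (curve_length At A \<rho> g \<gamma>)"
  unfolding riemannian_dist_def using assms by (intro Inf_lower) (auto simp: admissible_def)

lemma riemannian_dist_less:
  assumes "riemannian_dist At A \<rho> g p q < ereal \<epsilon>"
  obtains \<gamma> where "admissible \<gamma>" "\<gamma> 0 = p" "\<gamma> 1 = q" "curve_length At A \<rho> g \<gamma> < \<epsilon>"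
  using assms unfolding riemannian_dist_def Inf_less_iff by (auto simp: admissible_def)

lemma riemannian_dist_nonneg: "0 \<le> riemannian_dist At A \<rho> g p q"
  unfolding riemannian_dist_def
  by (intro Inf_greatest) (auto intro!: curve_length_nonneg simp: admissible_def)

text \<open>The speed of a chart segment is controlled by the derivatives of finitely many
  functions, and these by bounded derivatives of their extensions. The Riemannian length is
  therefore at most \<open>D\<close> times the length in the chart.\<close>

lemma riemannian_dist_small:
  assumes q: "q \<in> mfd_interior At" and \<epsilon>: "\<epsilon> > 0"
  obtains W where "open W" "q \<in> W" "\<And>p. p \<in> W \<Longrightarrow> riemannian_dist At A \<rho> g p q < ereal \<epsilon>"
proof -
  obtain c where c: "c \<in> At" "q \<in> chart_dom c" by (rule chart_cover)
  let ?y = "chart_map c q" and ?K = "chart_corner c"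
  obtain W0 C r f where W0: "open W0" "q \<in> W0" and C: "0 \<le> C" and f: "\<And>j. j < (r::nat) \<Longrightarrow> f j \<in> smooth_funs At"
    and up: "\<And>p \<xi>. p \<in> W0 \<Longrightarrow> \<xi> \<in> fibre A p \<Longrightarrow> sqrt (g p \<xi> \<xi>) \<le> C * (\<Sum>j<r. \<bar>\<rho> p \<xi> (f j)\<bar>)"
    by (rule norm_upper_bound[OF q]) (rule that)
  obtain s where s: "s > 0"
    "\<And>y. y \<in> quadrant N ?K \<Longrightarrow> y \<in> cball ?y s \<Longrightarrow>
       \<exists>p. p \<in> chart_dom c \<and> p \<in> W0 \<and> chart_map c p = y \<and> chart_inv c y = p"
    by (rule quadrant_ball[OF c W0]) (rule that)
  define P where "P j \<delta> F M \<longleftrightarrow> \<delta> > 0 \<and> (\<forall>k. Ck_on k F (ball ?y \<delta>)) \<and> 0 \<le> M \<and>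
    (\<forall>y. y \<in> quadrant N ?K \<longrightarrow> y \<in> ball ?y \<delta> \<longrightarrow> F y = f j (chart_inv c y)) \<and>
    (\<forall>y z. y \<in> ball ?y \<delta> \<longrightarrow> \<bar>frechet_derivative F (at y) z\<bar> \<le> M * norm z)" for j \<delta> F M
  have "\<exists>\<delta> F M. P j \<delta> F M" if "j < r" for j
    by (rule local_extension_bounded[OF c f[OF that]]) (unfold P_def, blast)
  then obtain \<delta> F M where "\<And>j. j < r \<Longrightarrow> P j (\<delta> j) (F j) (M j)" by metis
  then have loc: "\<And>j. j < r \<Longrightarrow> \<delta> j > 0" "\<And>j k. j < r \<Longrightarrow> Ck_on k (F j) (ball ?y (\<delta> j))"
    "\<And>j. j < r \<Longrightarrow> 0 \<le> M j"
    "\<And>j y. j < r \<Longrightarrow> y \<in> quadrant N ?K \<Longrightarrow> y \<in> ball ?y (\<delta> j) \<Longrightarrow> F j y = f j (chart_inv c y)"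
    "\<And>j y z. j < r \<Longrightarrow> y \<in> ball ?y (\<delta> j) \<Longrightarrow> \<bar>frechet_derivative (F j) (at y) z\<bar> \<le> M j * norm z"
    unfolding P_def by blast+
  have pos: "0 < ?y \<bullet> b" if "b \<in> ?K" for b using q interior_iff[OF c] that by blast
  \<comment> \<open>Within radius \<open>d\<close> all constraints stay strict, points stay in
    \<open>W0\<close>, and every extension \<open>F j\<close> is available.\<close>
  define d where "d = Min (insert s (\<delta> ` {..<r} \<union> (\<lambda>b. ?y \<bullet> b) ` ?K))"
  have d: "0 < d" "d \<le> s" "\<And>j. j < r \<Longrightarrow> d \<le> \<delta> j" "\<And>b. b \<in> ?K \<Longrightarrow> d \<le> ?y \<bullet> b"
    unfolding d_def using s(1) loc(1) pos finite_corner[OF c(1)] by auto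
  have coord: "0 < y \<bullet> b" if "b \<in> ?K" "y \<in> ball ?y d" for y b
  proof -
    have "norm b = 1" using that(1) corner_subset[OF c(1)] N_Basis by auto
    then have "\<bar>(?y - y) \<bullet> b\<bar> \<le> norm (?y - y)" using Cauchy_Schwarz_ineq2[of "?y - y" b] by simp
    moreover have "norm (?y - y) < d" using that(2) by (simp add: dist_norm)
    ultimately show ?thesis using d(4)[OF that(1)] by (simp add: inner_diff_left)
  qed
  have quad: "y \<in> quadrant N ?K" if "y \<in> span N" "y \<in> ball ?y d" for y
    using that coord by (auto simp: quadrant_def less_imp_le)
  have B': "(\<forall>b\<in>?K. 0 < y \<bullet> b) \<and> chart_inv c y \<in> chart_dom c \<and> chart_map c (chart_inv c y) = y"
    "chart_inv c y \<in> W0" if "y \<in> span N" "y \<in> ball ?y d" for y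
  proof -
    have "y \<in> cball ?y s" using that(2) d(2) by auto
    from s(2)[OF quad[OF that] this]
    show "(\<forall>b\<in>?K. 0 < y \<bullet> b) \<and> chart_inv c y \<in> chart_dom c \<and> chart_map c (chart_inv c y) = y"
      "chart_inv c y \<in> W0" using coord that(2) by auto
  qed
  have B: "\<forall>y\<in>span N \<inter> ball ?y d. (\<forall>b\<in>?K. 0 < y \<bullet> b) \<and>
      chart_inv c y \<in> chart_dom c \<and> chart_map c (chart_inv c y) = y"
    using B'(1) by blast
  define D where "D = C * (\<Sum>j<r. M j)"
  have D: "0 \<le> D" unfolding D_def using C loc(3) by (intro mult_nonneg_nonneg sum_nonneg) auto
  have yN: "chart_map c p \<in> span N" if "p \<in> chart_dom c" for p
    using chart_map_in_quadrant[OF c(1) that] by (simp add: quadrant_def)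
  have dist: "riemannian_dist At A \<rho> g p q \<le> ereal (D * norm (?y - chart_map c p))"
    if p: "p \<in> chart_dom c" "chart_map c p \<in> ball ?y d" for p
  proof -
    let ?p = "chart_map c p"
    define \<gamma> where "\<gamma> s = chart_inv c (?p + s *\<^sub>R (?y - ?p))" for s
    have y: "?p \<in> span N \<inter> ball ?y d" "?y \<in> span N \<inter> ball ?y d" using yN p c(2) d(1) by auto
    note seg = chart_segment[OF c(1) B y, folded \<gamma>_def]
    have \<gamma>: "admissible \<gamma>" by (rule seg(1))
    have line: "?p + t *\<^sub>R (?y - ?p) \<in> span N" "?p + t *\<^sub>R (?y - ?p) \<in> ball ?y d" if "t \<in> {0..1}" for t
    proof -
      show "?p + t *\<^sub>R (?y - ?p) \<in> span N" using y by (intro span_add span_scale span_diff) auto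
      have "(1 - t) *\<^sub>R ?p + t *\<^sub>R ?y \<in> ball ?y d"
        using y that by (intro convexD[OF convex_ball]) auto
      then show "?p + t *\<^sub>R (?y - ?p) \<in> ball ?y d" by (simp add: algebra_simps)
    qed
    have speed: "speed \<gamma> t \<le> D * norm (?y - ?p)" if t: "t \<in> {0..1}" for t
    proof -
      have "\<gamma> t \<in> mfd_interior At" using \<gamma> t by (auto simp: admissible_def)
      note l = lift[OF this seg(3)[OF t]]
      have "\<gamma> t \<in> W0" using B'(2)[OF line[OF t]] by (simp add: \<gamma>_def)
      from up[OF this l(1)] have "speed \<gamma> t \<le> C * (\<Sum>j<r. \<bar>velocity At \<gamma> t (f j)\<bar>)"
        by (simp add: speed_lift l(2))
      also have "\<dots> \<le> C * (\<Sum>j<r. M j * norm (?y - ?p))"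
      proof (intro mult_left_mono C sum_mono)
        fix j assume "j \<in> {..<r}"
        then have j: "j < r" by simp
        have "velocity At \<gamma> t (f j) = frechet_derivative (F j) (at (?p + t *\<^sub>R (?y - ?p))) (?y - ?p)"
        proof (rule seg(2)[OF f[OF j] _ _ t])
          show "Ck_on k (F j) (ball ?y d)" for k
            by (rule Ck_on_subset[OF loc(2)[OF j]]) (use d(3)[OF j] in auto)
          show "F j y = f j (chart_inv c y)" if "y \<in> span N" "y \<in> ball ?y d" for y
            using loc(4)[OF j quad[OF that]] that(2) d(3)[OF j] by auto
        qed
        moreover have "?p + t *\<^sub>R (?y - ?p) \<in> ball ?y (\<delta> j)" using line(2)[OF t] d(3)[OF j] by auto
        ultimately show "\<bar>velocity At \<gamma> t (f j)\<bar> \<le> M j * norm (?y - ?p)" using loc(5)[OF j] by simp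
      qed
      also have "\<dots> = D * norm (?y - ?p)" by (simp add: D_def sum_distrib_right)
      finally show ?thesis .
    qed
    have "speed \<gamma> integrable_on {0..1}" by (rule admissible_pieces[OF \<gamma>]) blast
    then have "integral {0..1} (speed \<gamma>) \<le> integral {0..1} (\<lambda>t::real. D * norm (?y - ?p))"
      by (rule integral_le) (use speed in auto)
    then have "curve_length At A \<rho> g \<gamma> \<le> D * norm (?y - ?p)" by (simp add: curve_length_speed)
    moreover have "\<gamma> 0 = p" "\<gamma> 1 = q" using chart_inv_map[OF c(1)] p(1) c(2) by (simp_all add: \<gamma>_def)
    ultimately show ?thesis using riemannian_dist_le[OF \<gamma>] by (meson ereal_less_eq(3) order_trans)
  qed
  \<comment> \<open>\<open>D + 1\<close> rather than \<open>D\<close> avoids a division by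
    zero.\<close>
  define e where "e = min d (\<epsilon> / (D + 1))"
  have e: "e > 0" "e \<le> d" "e \<le> \<epsilon> / (D + 1)" using d(1) \<epsilon> D by (auto simp: e_def)
  let ?W = "{p \<in> chart_dom c. chart_map c p \<in> ball ?y e}"
  show thesis
  proof (rule that[of ?W])
    show "open ?W" "q \<in> ?W" using open_chart_preimage[OF c(1) open_ball] c(2) e(1) by simp_all
    fix p assume p: "p \<in> ?W"
    then have n: "norm (?y - chart_map c p) < e" by (simp add: dist_norm)
    have "D * norm (?y - chart_map c p) \<le> (D + 1) * norm (?y - chart_map c p)"
      by (intro mult_right_mono) auto
    also have "\<dots> < (D + 1) * e" using n D by (intro mult_strict_left_mono) auto
    also have "\<dots> \<le> \<epsilon>" using e(3) D by (simp add: field_simps)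
    finally have "ereal (D * norm (?y - chart_map c p)) < ereal \<epsilon>" by simp
    moreover have "chart_map c p \<in> ball ?y d" using p e(2) by auto
    ultimately show "riemannian_dist At A \<rho> g p q < ereal \<epsilon>" using dist[of p] p by (auto intro: le_less_trans)
  qed
qed

section \<open>Completeness\<close>

theorem complete_interior: "complete_ext_metric (mfd_interior At) (riemannian_dist At A \<rho> g)"
  unfolding complete_ext_metric_def
proof (intro allI impI, elim conjE)
  let ?d = "riemannian_dist At A \<rho> g"
  fix x :: "nat \<Rightarrow> 'm"
  assume int: "\<forall>k. x k \<in> mfd_interior At"
    and cauchy: "\<forall>\<epsilon>>0. \<exists>n. \<forall>i\<ge>n. \<forall>j\<ge>n. ?d (x i) (x j) < ereal \<epsilon>"
  \<comment> \<open>Second countability turns compactness of \<open>M\<close> into sequential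
    compactness.\<close>
  obtain l \<sigma> where \<sigma>: "strict_mono (\<sigma> :: nat \<Rightarrow> nat)" "(x \<circ> \<sigma>) \<longlonglongrightarrow> l"
    using compact_imp_seq_compact[OF compact_M] by (rule seq_compactE[where f=x]) auto
  have short: "\<exists>n. \<forall>i\<ge>n. \<forall>j\<ge>n. \<exists>\<gamma>. admissible \<gamma> \<and> \<gamma> 0 = x i \<and> \<gamma> 1 = x j \<and> C * curve_length At A \<rho> g \<gamma> < \<epsilon>"
    if C: "0 \<le> C" and \<epsilon>: "0 < \<epsilon>" for C \<epsilon> :: real
  proof -
    \<comment> \<open>The denominator \<open>C + 1\<close> also covers \<open>C = 0\<close>.\<close>
    have "0 < \<epsilon> / (C + 1)" using that by simp
    then obtain n where n: "\<And>i j. i \<ge> n \<Longrightarrow> j \<ge> n \<Longrightarrow> ?d (x i) (x j) < ereal (\<epsilon> / (C + 1))"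
      using cauchy by blast
    have "\<exists>\<gamma>. admissible \<gamma> \<and> \<gamma> 0 = x i \<and> \<gamma> 1 = x j \<and> C * curve_length At A \<rho> g \<gamma> < \<epsilon>"
      if ij: "i \<ge> n" "j \<ge> n" for i j
    proof -
      obtain \<gamma> where \<gamma>: "admissible \<gamma>" "\<gamma> 0 = x i" "\<gamma> 1 = x j" "curve_length At A \<rho> g \<gamma> < \<epsilon> / (C + 1)"
        by (rule riemannian_dist_less[OF n[OF ij]]) (rule that)
      have "C * curve_length At A \<rho> g \<gamma> \<le> (C + 1) * curve_length At A \<rho> g \<gamma>"
        using curve_length_nonneg[OF \<gamma>(1)] by (intro mult_right_mono) auto
      also have "\<dots> < (C + 1) * (\<epsilon> / (C + 1))" using \<gamma>(4) C by (intro mult_strict_left_mono) auto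
      also have "\<dots> = \<epsilon>" using C by simp
      finally show ?thesis using \<gamma> by blast
    qed
    then show ?thesis by blast
  qed
  have lim: "x \<longlonglongrightarrow> l"
  proof (rule topological_tendstoI)
    fix W assume W: "open W" "l \<in> W"
    obtain \<eta> K where \<eta>: "\<eta> \<in> smooth_funs At" "\<eta> l = 1" "\<And>p. 0 \<le> \<eta> p" "closed K" "K \<subseteq> W"
      "\<And>p. p \<notin> K \<Longrightarrow> \<eta> p = 0"
      by (rule bump_function[OF W]) (rule that)
    obtain C where C: "0 \<le> C" "\<And>\<gamma> x. admissible \<gamma> \<Longrightarrow> x \<in> {0..1} \<Longrightarrow>
        \<bar>\<eta> (\<gamma> x) - \<eta> (\<gamma> 0)\<bar> \<le> C * curve_length At A \<rho> g \<gamma>"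
      by (rule smooth_lipschitz[OF \<eta>(1)]) (rule that)
    \<comment> \<open>Some term of the subsequence beyond \<open>n\<close> has \<open>\<eta>\<close>
      above \<open>1 / 2\<close>. A change of less than \<open>1 / 2\<close> along the joining curve
      leaves \<open>\<eta>\<close> positive at every \<open>x i\<close> of the tail, which places
      all of them in \<open>W\<close>.\<close>
    obtain n where n: "\<And>i j. i \<ge> n \<Longrightarrow> j \<ge> n \<Longrightarrow>
        \<exists>\<gamma>. admissible \<gamma> \<and> \<gamma> 0 = x i \<and> \<gamma> 1 = x j \<and> C * curve_length At A \<rho> g \<gamma> < 1 / 2"
      using short[OF C(1), of "1 / 2"] by auto
    have "isCont \<eta> l"
      using smooth_funs_continuous[OF \<eta>(1), of UNIV] by (simp add: continuous_on_eq_continuous_at)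
    from isCont_tendsto_compose[OF this \<sigma>(2)] have "(\<lambda>k. \<eta> ((x \<circ> \<sigma>) k)) \<longlonglongrightarrow> 1" by (simp add: \<eta>(2))
    then have "eventually (\<lambda>k. 1 / 2 < \<eta> ((x \<circ> \<sigma>) k)) sequentially" by (rule order_tendstoD) simp
    then have "eventually (\<lambda>k. 1 / 2 < \<eta> (x (\<sigma> k)) \<and> n \<le> k) sequentially"
      using eventually_ge_at_top[of n] by eventually_elim simp
    then obtain k where k: "1 / 2 < \<eta> (x (\<sigma> k))" "n \<le> k"
      using eventually_happens'[OF sequentially_bot] by blast
    have nk: "n \<le> \<sigma> k" using k(2) seq_suble[OF \<sigma>(1), of k] by simp
    have "x i \<in> W" if i: "i \<ge> n" for i
    proof -
      obtain \<gamma> where \<gamma>: "admissible \<gamma>" "\<gamma> 0 = x (\<sigma> k)" "\<gamma> 1 = x i" "C * curve_length At A \<rho> g \<gamma> < 1 / 2"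
        using n[OF nk i] by blast
      have "\<bar>\<eta> (x i) - \<eta> (x (\<sigma> k))\<bar> < 1 / 2" using C(2)[OF \<gamma>(1), of 1] \<gamma> by simp
      then have "\<eta> (x i) \<noteq> 0" using k(1) by linarith
      then show ?thesis using \<eta>(5,6) by blast
    qed
    then show "eventually (\<lambda>i. x i \<in> W) sequentially" unfolding eventually_sequentially by blast
  qed
  have l: "l \<in> mfd_interior At"
  proof (rule ccontr)
    assume "l \<notin> mfd_interior At"
    then have "l \<in> mfd_boundary At" by (simp add: mfd_interior_def)
    then obtain u W D where u: "u \<in> smooth_funs At" "u l = 0" "\<And>p. 0 \<le> u p" "\<And>p. p \<in> mfd_interior At \<Longrightarrow> 0 < u p"
      and W: "open W" "l \<in> W" and D: "0 \<le> D"
      and est: "\<And>p \<xi>. p \<in> W \<Longrightarrow> \<xi> \<in> fibre A p \<Longrightarrow> \<bar>\<rho> p \<xi> u\<bar> \<le> D * u p * sqrt (g p \<xi> \<xi>)"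
      by (rule boundary_weight) (rule that)
    \<comment> \<open>The weighted bound for \<open>u\<close> is available only on \<open>W\<close>.
      A second bump function confines short joining curves to this set.\<close>
    obtain \<eta> K where \<eta>: "\<eta> \<in> smooth_funs At" "\<eta> l = 1" "\<And>p. 0 \<le> \<eta> p" "closed K" "K \<subseteq> W"
      "\<And>p. p \<notin> K \<Longrightarrow> \<eta> p = 0"
      by (rule bump_function[OF W]) (rule that)
    obtain C where C: "0 \<le> C" "\<And>\<gamma> x. admissible \<gamma> \<Longrightarrow> x \<in> {0..1} \<Longrightarrow>
        \<bar>\<eta> (\<gamma> x) - \<eta> (\<gamma> 0)\<bar> \<le> C * curve_length At A \<rho> g \<gamma>"
      by (rule smooth_lipschitz[OF \<eta>(1)]) (rule that)
    have cont: "isCont f l" if "f \<in> smooth_funs At" for f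
      using smooth_funs_continuous[OF that, of UNIV] by (simp add: continuous_on_eq_continuous_at)
    \<comment> \<open>With the factor \<open>C + D\<close>, one choice of curve serves both the
      confinement and the estimate of \<open>ln u\<close>.\<close>
    obtain n where n: "\<And>i j. i \<ge> n \<Longrightarrow> j \<ge> n \<Longrightarrow>
        \<exists>\<gamma>. admissible \<gamma> \<and> \<gamma> 0 = x i \<and> \<gamma> 1 = x j \<and> (C + D) * curve_length At A \<rho> g \<gamma> < 1 / 2"
      using short[of "C + D" "1 / 2"] C(1) D by auto
    have "(\<lambda>k. \<eta> (x k)) \<longlonglongrightarrow> 1" using isCont_tendsto_compose[OF cont[OF \<eta>(1)] lim] by (simp add: \<eta>(2))
    then have "eventually (\<lambda>k. 1 / 2 < \<eta> (x k)) sequentially" by (rule order_tendstoD) simp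
    then have "eventually (\<lambda>k. 1 / 2 < \<eta> (x k) \<and> n \<le> k) sequentially"
      using eventually_ge_at_top[of n] by (rule eventually_conj)
    then obtain i where i: "1 / 2 < \<eta> (x i)" "n \<le> i"
      using eventually_happens'[OF sequentially_bot] by blast
    \<comment> \<open>A lower bound for \<open>ln u\<close> on the whole tail; it contradicts
      \<open>u (x k)\<close> tending to \<open>u l = 0\<close>.\<close>
    have lower: "ln (u (x i)) - 1 / 2 \<le> ln (u (x j))" if j: "j \<ge> n" for j
    proof -
      obtain \<gamma> where \<gamma>: "admissible \<gamma>" "\<gamma> 0 = x i" "\<gamma> 1 = x j"
        and len: "(C + D) * curve_length At A \<rho> g \<gamma> < 1 / 2"
        using n[OF i(2) j] by blast
      have "0 \<le> C * curve_length At A \<rho> g \<gamma>" "0 \<le> D * curve_length At A \<rho> g \<gamma>"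
        using C(1) D curve_length_nonneg[OF \<gamma>(1)] by simp_all
      then have CD: "C * curve_length At A \<rho> g \<gamma> < 1 / 2" "D * curve_length At A \<rho> g \<gamma> < 1 / 2"
        using len by (simp_all add: distrib_right)
      have "\<gamma> t \<in> W" if "t \<in> {0..1}" for t
      proof -
        have "\<bar>\<eta> (\<gamma> t) - \<eta> (x i)\<bar> < 1 / 2" using C(2)[OF \<gamma>(1) that] \<gamma>(2) CD(1) by simp
        then have "\<eta> (\<gamma> t) \<noteq> 0" using i(1) by linarith
        then show ?thesis using \<eta>(5,6) by blast
      qed
      from ln_weight_lipschitz[OF u(1,4) D est \<gamma>(1) this]
      have "\<bar>ln (u (x j)) - ln (u (x i))\<bar> \<le> D * curve_length At A \<rho> g \<gamma>" by (simp add: \<gamma>)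
      then show ?thesis using CD(2) by linarith
    qed
    have pos: "0 < u (x j)" for j using int by (intro u(4)) simp
    have "(\<lambda>k. u (x k)) \<longlonglongrightarrow> 0" using isCont_tendsto_compose[OF cont[OF u(1)] lim] by (simp add: u(2))
    then have "eventually (\<lambda>k. u (x k) < exp (ln (u (x i)) - 1 / 2)) sequentially"
      by (rule order_tendstoD) simp
    then have "eventually (\<lambda>k. u (x k) < exp (ln (u (x i)) - 1 / 2) \<and> n \<le> k) sequentially"
      using eventually_ge_at_top[of n] by (rule eventually_conj)
    then obtain k where k: "u (x k) < exp (ln (u (x i)) - 1 / 2)" "n \<le> k"
      using eventually_happens'[OF sequentially_bot] by blast
    have "exp (ln (u (x i)) - 1 / 2) \<le> exp (ln (u (x k)))" using lower[OF k(2)] by simp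
    then show False using k(1) pos[of k] by simp
  qed
  have "(\<lambda>k. ?d (x k) l) \<longlonglongrightarrow> 0"
  proof (rule order_tendstoI)
    fix a :: ereal assume "a < 0"
    then show "eventually (\<lambda>k. a < ?d (x k) l) sequentially"
      using riemannian_dist_nonneg by (intro always_eventually allI) (rule less_le_trans)
  next
    fix a :: ereal assume "0 < a"
    then obtain \<epsilon> where \<epsilon>: "0 < ereal \<epsilon>" "ereal \<epsilon> < a" using ereal_dense2 by blast
    then have "0 < \<epsilon>" by simp
    then obtain W where W: "open W" "l \<in> W" "\<And>p. p \<in> W \<Longrightarrow> ?d p l < ereal \<epsilon>"
      by (rule riemannian_dist_small[OF l]) (rule that)
    from topological_tendstoD[OF lim W(1,2)] show "eventually (\<lambda>k. ?d (x k) l < a) sequentially"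
      by (rule eventually_mono) (use W(3) \<epsilon>(2) in \<open>auto intro: less_trans\<close>)
  qed
  with l show "\<exists>l\<in>mfd_interior At. (\<lambda>k. ?d (x k) l) \<longlonglongrightarrow> 0" by blast
qed

end

theorem corollary3p9:
  fixes N :: "'e::euclidean_space set"
    and At :: "('m::{t2_space, second_countable_topology}, 'e) corner_chart set"
    and \<V> :: "'m vfield set"
    and A :: "('m, 'v::real_vector) vbundle"
    and \<rho> :: "'m \<Rightarrow> 'v \<Rightarrow> ('m \<Rightarrow> real) \<Rightarrow> real"
    and g :: "'m \<Rightarrow> 'v \<Rightarrow> 'v \<Rightarrow> real"
  assumes "lie_structure_at_infinity N At \<V> A \<rho>"
    and "bundle_metric At A g"
  shows "complete_ext_metric (mfd_interior At) (riemannian_dist At A \<rho> g)"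
proof -
  interpret lie_metric N At \<V> A \<rho> g
    using assms by unfold_locales (auto simp: lie_structure_at_infinity_def manifold_with_corners_def)
  show ?thesis by (rule complete_interior)
qed

end
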